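(* For every claw-free bridgeless cubic graph $G$ with $|V(G)| \geq 48$, $\nu_2(G) \geq \frac{140}{141}\cdot \frac{|V(G)| + 2\cdot \nu_3(G)}{4}$.
   Context: Graphs are finite, without loops, possibly with multiple edges; cubic means every vertex has degree $3$, bridgeless means no edge whose removal increases the number of connected components, claw-free means no induced subgraph isomorphic to $K_{1,3}$. For $k\geq 1$, $\nu_k(G)$ is the maximum number of edges of a $k$-edge-colorable subgraph of $G$. *)

theory Defs
  imports Complex_Main
begin

definition multigraph :: "'v set \<Rightarrow> 'e set \<Rightarrow> ('e \<Rightarrow> 'v set) \<Rightarrow> bool" where
  "multigraph V E inc \<longleftrightarrow> finite V \<and> finite E \<and>
     (\<forall>e\<in>E. inc e \<subseteq> V \<and> card (inc e) = 2)"

definition degree :: "'e set \<Rightarrow> ('e \<Rightarrow> 'v set) \<Rightarrow> 'v \<Rightarrow> nat" where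
  "degree E inc v = card {e\<in>E. v \<in> inc e}"

definition cubic :: "'v set \<Rightarrow> 'e set \<Rightarrow> ('e \<Rightarrow> 'v set) \<Rightarrow> bool" where
  "cubic V E inc \<longleftrightarrow> (\<forall>v\<in>V. degree E inc v = 3)"

definition adj :: "'e set \<Rightarrow> ('e \<Rightarrow> 'v set) \<Rightarrow> 'v \<Rightarrow> 'v \<Rightarrow> bool" where
  "adj E inc u v \<longleftrightarrow> (\<exists>e\<in>E. inc e = {u, v})"

definition reach :: "'e set \<Rightarrow> ('e \<Rightarrow> 'v set) \<Rightarrow> 'v \<Rightarrow> 'v \<Rightarrow> bool" where
  "reach E inc = (adj E inc)\<^sup>*\<^sup>*"

definition num_components :: "'v set \<Rightarrow> 'e set \<Rightarrow> ('e \<Rightarrow> 'v set) \<Rightarrow> nat" where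
  "num_components V E inc = card ((\<lambda>v. {u\<in>V. reach E inc v u}) ` V)"

definition is_bridge :: "'v set \<Rightarrow> 'e set \<Rightarrow> ('e \<Rightarrow> 'v set) \<Rightarrow> 'e \<Rightarrow> bool" where
  "is_bridge V E inc e \<longleftrightarrow> e \<in> E \<and> num_components V (E - {e}) inc > num_components V E inc"

definition bridgeless :: "'v set \<Rightarrow> 'e set \<Rightarrow> ('e \<Rightarrow> 'v set) \<Rightarrow> bool" where
  "bridgeless V E inc \<longleftrightarrow> (\<forall>e\<in>E. \<not> is_bridge V E inc e)"

definition claw_free :: "'v set \<Rightarrow> 'e set \<Rightarrow> ('e \<Rightarrow> 'v set) \<Rightarrow> bool" where
  "claw_free V E inc \<longleftrightarrow> \<not> (\<exists>c\<in>V. \<exists>a\<in>V. \<exists>b\<in>V. \<exists>d\<in>V.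
      distinct [c, a, b, d] \<and> adj E inc c a \<and> adj E inc c b \<and> adj E inc c d \<and>
      \<not> adj E inc a b \<and> \<not> adj E inc a d \<and> \<not> adj E inc b d)"

definition k_edge_colorable :: "nat \<Rightarrow> 'e set \<Rightarrow> ('e \<Rightarrow> 'v set) \<Rightarrow> bool" where
  "k_edge_colorable k F inc \<longleftrightarrow> (\<exists>col :: 'e \<Rightarrow> nat. (\<forall>e\<in>F. col e < k) \<and>
      (\<forall>e\<in>F. \<forall>e'\<in>F. e \<noteq> e' \<and> inc e \<inter> inc e' \<noteq> {} \<longrightarrow> col e \<noteq> col e'))"

definition nu :: "nat \<Rightarrow> 'e set \<Rightarrow> ('e \<Rightarrow> 'v set) \<Rightarrow> nat" where
  "nu k E inc = Max {card F | F. F \<subseteq> E \<and> k_edge_colorable k F inc}"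

end

theory Submission
  imports Defs
begin

text \<open>
  Contracting triangles and suppressing parallel edges turns a claw-free bridgeless cubic graph into
  a simple triangle-free cubic graph in which every vertex stands for at least three original
  vertices. These reductions neither increase the number of edges missed by a maximum
  3-edge-colourable subgraph nor decrease \<open>n - \<nu>\<^sub>2\<close>, so it suffices to show
  \<open>141 (n - \<nu>\<^sub>2) \<le> W + 70 (|E| - \<nu>\<^sub>3)\<close> for the reduced graph, where \<open>W \<ge> 3 n\<close> is the total weight.

  In the reduced graph take a partial 3-edge-colouring with as few uncoloured edges as possible. By
  Kempe changes, every uncoloured edge lies on an odd cycle (a ring) whose other edges alternate
  between two colours, while all edges leaving it have the third colour, its type. The uncoloured
  edge can be moved to any place on its ring, and distinct rings are disjoint. If an edge joins two
  rings of type \<open>s\<close>, it can lose the colour \<open>s\<close>; since deleting colour class \<open>s\<close> leaves a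
  2-edge-colourable graph, \<open>\<nu>\<^sub>2\<close> is bounded below in terms of the number of rings of type \<open>s\<close> that
  remain unpaired in this way. Discharging shows that an unpaired ring, together with its share of
  its neighbours, accounts for 8 vertices: for a pentagon a smaller share would allow two disjoint
  Kempe changes that free a common colour at both ends of its uncoloured edge.
\<close>

section \<open>Edge cuts, alternating chains and partial colourings\<close>

text \<open>The constants balance one extremal case. Let \<open>r\<close> be the number of edges
  missed by an optimal partial colouring, hence the number of rings, and let \<open>x\<close>
  joining edges leave \<open>u\<close> rings unpaired, so \<open>r = u + 2 x\<close>. Deleting a
  colour class and summing over the three colours gives \<open>6 (n - nu 2) <= u + 3 r\<close>;
  discharging gives \<open>8 u + 2 x <= n\<close>. An inequality
  \<open>A (n - nu 2) <= W + B r\<close> with \<open>|E| = 3 n / 2\<close> and \<open>W = n\<close>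
  bounds \<open>nu 2\<close> by a multiple of \<open>n + 2 nu 3\<close> exactly when
  \<open>A = 2 B + 1\<close>. If no rings are paired, a ring costs 2/3 in \<open>n - nu 2\<close>
  and owns 8 vertices of weight 3, so \<open>2 A / 3 = 24 + B\<close> is the best that can be asked.
  The two equations give \<open>A = 141\<close> and \<open>B = 70\<close>; every pair of rings then
  leaves a slack of 5.\<close>

lemma nu_cards_finite: "finite E \<Longrightarrow> finite {card F |F. F \<subseteq> E \<and> k_edge_colorable k F inc}"
  by (rule finite_subset[of _ "card ` Pow E"]) auto

lemma nu_ge:
  assumes "finite E" "F \<subseteq> E" "k_edge_colorable k F inc"
  shows "card F \<le> nu k E inc"
  unfolding nu_def by (rule Max_ge[OF nu_cards_finite]) (use assms in auto)

lemma nu_attained: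
  assumes "finite E"
  obtains F where "F \<subseteq> E" "k_edge_colorable k F inc" "card F = nu k E inc"
proof -
  have "k_edge_colorable k {} inc" by (simp add: k_edge_colorable_def)
  then have "{card F |F. F \<subseteq> E \<and> k_edge_colorable k F inc} \<noteq> {}" by blast
  from Max_in[OF nu_cards_finite[OF assms] this] that show thesis
    unfolding nu_def by auto
qed

text \<open>Cuts replace components because a vertex set of a contracted graph pulls back to one
  with the same crossing edges, so this form passes through every reduction.\<close>

definition cut_bridgeless :: "'v set \<Rightarrow> 'e set \<Rightarrow> ('e \<Rightarrow> 'v set) \<Rightarrow> bool" where
  "cut_bridgeless V E inc \<longleftrightarrow> (\<forall>S\<subseteq>V. card {e\<in>E. card (inc e \<inter> S) = 1} \<noteq> 1)"

lemma reach_refl: "reach E inc v v"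
  by (simp add: reach_def)

lemma reach_sym: "reach E inc u v \<Longrightarrow> reach E inc v u"
  unfolding reach_def
proof (induction rule: rtranclp_induct)
  case (step y z)
  have "adj E inc z y" using step(2) by (auto simp: adj_def insert_commute)
  then show ?case using step(3) by (rule converse_rtranclp_into_rtranclp)
qed simp

lemma reach_trans: "reach E inc u v \<Longrightarrow> reach E inc v w \<Longrightarrow> reach E inc u w"
  unfolding reach_def by (rule rtranclp_trans)

lemma reach_mono:
  assumes "F \<subseteq> E" "reach F inc u v"
  shows "reach E inc u v"
proof -
  have "adj F inc x y \<Longrightarrow> adj E inc x y" for x y using assms(1) unfolding adj_def by blast
  then have "adj F inc \<le> adj E inc" by blast
  from rtranclp_mono[OF this] assms(2) show ?thesis unfolding reach_def by blast
qed

text \<open>Deleting the only edge that crosses \<open>S\<close> separates its ends \<open>a\<close>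
  and \<open>b\<close>. Sending each component of \<open>E - {e}\<close> to the component of
  \<open>E\<close> containing it is therefore onto but not injective.\<close>

lemma cut_edge_is_bridge:
  assumes g: "multigraph V E inc" and S: "S \<subseteq> V" and cut: "{e\<in>E. card (inc e \<inter> S) = 1} = {e}"
  shows "is_bridge V E inc e"
proof -
  let ?E = "E - {e}"
  let ?cl = "\<lambda>E v. {u\<in>V. reach E inc v u}"
  from cut have e: "e \<in> E" "card (inc e \<inter> S) = 1" by auto
  then have "card (inc e) = 2" "inc e \<subseteq> V" using g by (auto simp: multigraph_def)
  obtain a where a: "inc e \<inter> S = {a}" using e(2) by (auto simp: card_1_singleton_iff)
  have "\<not> inc e \<subseteq> S" using e(2) \<open>card (inc e) = 2\<close> by (auto simp: Int_absorb2)
  then obtain b where b: "b \<in> inc e" "b \<notin> S" by auto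
  have ab: "inc e = {a, b}"
  proof (rule card_seteq[symmetric])
    show "finite (inc e)" using \<open>card (inc e) = 2\<close> card.infinite by fastforce
    show "{a, b} \<subseteq> inc e" using a b by auto
    show "card (inc e) \<le> card {a, b}" using a b \<open>card (inc e) = 2\<close> by (cases "a = b") auto
  qed
  have inS: "reach ?E inc a v \<Longrightarrow> v \<in> S" for v
    unfolding reach_def
  proof (induction rule: rtranclp_induct)
    case base then show ?case using a by auto
  next
    case (step y z)
    then obtain f where f: "f \<in> E" "f \<noteq> e" "inc f = {y, z}" by (auto simp: adj_def)
    with cut have "card (inc f \<inter> S) \<noteq> 1" by auto
    show ?case
    proof (rule ccontr)
      assume "z \<notin> S"
      then have "inc f \<inter> S = {y}" using f(3) step by auto
      with \<open>card (inc f \<inter> S) \<noteq> 1\<close> show False by simp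
    qed
  qed
  have V: "a \<in> V" "b \<in> V" using ab \<open>inc e \<subseteq> V\<close> by auto
  have "?cl ?E a \<noteq> ?cl ?E b"
    using inS b V reach_refl[of ?E inc b] by auto
  have cl_eq: "?cl E u = ?cl E v" if "reach E inc u v" for u v
    using reach_trans[OF that] reach_trans[OF reach_sym[OF that]] by blast
  have sub: "reach ?E inc u v \<Longrightarrow> reach E inc u v" for u v
    by (rule reach_mono[of ?E]) auto
  \<comment> \<open>\<open>SOME\<close> picks an arbitrary representative; all choices lie in the
    same component of \<open>E\<close>.\<close>
  define h where "h = (\<lambda>K. ?cl E (SOME v. v \<in> K))"
  have h: "h (?cl ?E v) = ?cl E v" if "v \<in> V" for v
  proof -
    have "(SOME u. u \<in> ?cl ?E v) \<in> ?cl ?E v"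
      by (rule someI[of _ v]) (use that reach_refl in auto)
    then have "reach E inc v (SOME u. u \<in> ?cl ?E v)" using sub by blast
    then show ?thesis unfolding h_def by (rule cl_eq[symmetric])
  qed
  have img: "?cl E ` V = h ` (?cl ?E ` V)"
    unfolding image_image using h by (intro image_cong) auto
  have fin: "finite (?cl ?E ` V)" using g by (simp add: multigraph_def)
  have "reach E inc a b" unfolding reach_def by (rule r_into_rtranclp) (use ab e(1) in \<open>auto simp: adj_def\<close>)
  then have "h (?cl ?E a) = h (?cl ?E b)" using h V cl_eq by simp
  then have "\<not> inj_on h (?cl ?E ` V)"
    using \<open>?cl ?E a \<noteq> ?cl ?E b\<close> V by (auto simp: inj_on_def)
  then have "card (?cl E ` V) < card (?cl ?E ` V)"
    unfolding img using card_image_le[OF fin, of h] eq_card_imp_inj_on[OF fin, of h] by linarith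
  then show ?thesis using e by (simp add: is_bridge_def num_components_def)
qed

lemma bridgeless_imp_cut_bridgeless:
  assumes "multigraph V E inc" "bridgeless V E inc"
  shows "cut_bridgeless V E inc"
  unfolding cut_bridgeless_def
proof (intro allI impI notI)
  fix S assume S: "S \<subseteq> V" "card {e\<in>E. card (inc e \<inter> S) = 1} = 1"
  then obtain e where "{e\<in>E. card (inc e \<inter> S) = 1} = {e}" by (auto simp: card_1_singleton_iff)
  from cut_edge_is_bridge[OF assms(1) S(1) this] assms(2) this show False
    by (auto simp: bridgeless_def)
qed

lemma handshake:
  assumes "finite E" "finite S" "\<And>v. v \<in> S \<Longrightarrow> card {e\<in>E. v \<in> inc e} = 3"
  shows "3 * card S = (\<Sum>e\<in>E. card (inc e \<inter> S))"
proof -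
  have "3 * card S = (\<Sum>v\<in>S. \<Sum>e\<in>{e\<in>E. v \<in> inc e}. 1)" using assms(3) by simp
  also have "\<dots> = (\<Sum>e\<in>E. \<Sum>v\<in>{v\<in>S. v \<in> inc e}. 1)" by (rule sum.swap_restrict[OF assms(2,1)])
  also have "\<dots> = (\<Sum>e\<in>E. card (inc e \<inter> S))"
    by (intro sum.cong) (auto intro: arg_cong[where f = card])
  finally show ?thesis .
qed

text \<open>A union of components of the graph \<open>F\<close>, not necessarily a single one: a
  Kempe change needs no connectedness, only that no edge of \<open>F\<close> leaves the set.\<close>

definition closed_under :: "'e set \<Rightarrow> ('e \<Rightarrow> 'v set) \<Rightarrow> 'v set \<Rightarrow> bool" where
  "closed_under F inc K \<longleftrightarrow> (\<forall>e\<in>F. inc e \<inter> K \<noteq> {} \<longrightarrow> inc e \<subseteq> K)"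

text \<open>Deleting the first edge either ends the chain or turns the far end of that edge into the
  start of a shorter chain. Closedness makes the path usable for a Kempe change, and the degrees
  tell which vertices can be its ends.\<close>

lemma chain_exists:
  assumes "finite F" "\<And>e. e \<in> F \<Longrightarrow> card (inc e) = 2" "\<And>v. degree F inc v \<le> 2"
    and "degree F inc z = 1"
  shows "\<exists>xs. distinct xs \<and> 2 \<le> length xs \<and> hd xs = z \<and> degree F inc (last xs) = 1 \<and>
    (\<forall>i. Suc i < length xs \<longrightarrow> (\<exists>e\<in>F. inc e = {xs ! i, xs ! Suc i})) \<and>
    closed_under F inc (set xs) \<and>
    (\<forall>x\<in>set xs. x = z \<or> x = last xs \<or> degree F inc x = 2)"
  using assms
proof (induction "card F" arbitrary: F z rule: less_induct)
  case less
  note fin = less.prems(1) and two = less.prems(2) and deg = less.prems(3)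
  from less.prems(4) obtain e where e: "{e\<in>F. z \<in> inc e} = {e}"
    by (auto simp: degree_def card_1_singleton_iff)
  then have eF: "e \<in> F" "z \<in> inc e" by auto
  with two obtain y where y: "inc e = {z, y}" "y \<noteq> z"
    by (metis card_2_iff doubleton_eq_iff insertE singletonD)
  define F' where "F' = F - {e}"
  have fin': "finite F'" using fin by (simp add: F'_def)
  have degF: "degree F inc v = degree F' inc v + (if v \<in> {z, y} then 1 else 0)" for v
  proof -
    have "{f\<in>F. v \<in> inc f} = {f\<in>F'. v \<in> inc f} \<union> (if v \<in> {z, y} then {e} else {})"
      using eF y by (auto simp: F'_def)
    moreover have "e \<notin> {f\<in>F'. v \<in> inc f}" by (simp add: F'_def)
    ultimately show ?thesis using fin' by (simp add: degree_def)
  qed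
  have dz: "degree F' inc z = 0" using degF[of z] less.prems(4) by simp
  have pos: "degree F' inc v > 0" if "f \<in> F'" "v \<in> inc f" for f v
    using that fin' by (auto simp: degree_def card_gt_0_iff)
  have "degree F' inc y \<le> 1" using degF[of y] deg[of y] by simp
  then consider "degree F' inc y = 0" | "degree F' inc y = 1" by linarith
  then show ?case
  proof cases
    case 1
    have "closed_under F inc (set [z, y])"
      unfolding closed_under_def
    proof (intro ballI impI)
      fix f assume f: "f \<in> F" "inc f \<inter> set [z, y] \<noteq> {}"
      have "f = e"
      proof (rule ccontr)
        assume "f \<noteq> e"
        then have "f \<in> F'" using f by (simp add: F'_def)
        then show False using pos[of f z] pos[of f y] dz 1 f(2) by auto
      qed
      then show "inc f \<subseteq> set [z, y]" using y by simp
    qed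
    then show ?thesis using eF y degF[of y] 1
      by (intro exI[of _ "[z, y]"]) (auto simp: less_Suc_eq)
  next
    case 2
    have "card F' < card F" unfolding F'_def using eF(1) fin by (rule card_Diff1_less[rotated])
    have "\<And>f. f \<in> F' \<Longrightarrow> card (inc f) = 2" using two by (simp add: F'_def)
    moreover have "\<And>v. degree F' inc v \<le> 2" using deg degF le_add1 le_trans by metis
    ultimately obtain ys where ys:
      "distinct ys" "2 \<le> length ys" "hd ys = y" "degree F' inc (last ys) = 1"
      "\<And>i. Suc i < length ys \<Longrightarrow> \<exists>e\<in>F'. inc e = {ys ! i, ys ! Suc i}"
      "closed_under F' inc (set ys)"
      "\<And>x. x\<in>set ys \<Longrightarrow> x = y \<or> x = last ys \<or> degree F' inc x = 2"
      using less.hyps[OF \<open>card F' < card F\<close> fin' _ _ 2] by blast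
    have ne: "ys \<noteq> []" using ys(2) by auto
    \<comment> \<open>\<open>z\<close> has lost its only edge, while every vertex of
      \<open>ys\<close> still has one.\<close>
    have zys: "z \<notin> set ys" using ys(4) ys(7)[of z] dz 2 by auto
    have lst: "last ys \<noteq> y"
    proof -
      have "ys ! (length ys - 1) \<noteq> ys ! 0"
        using nth_eq_iff_index_eq[OF ys(1), of "length ys - 1" 0] ys(2) ne by simp
      then show ?thesis using ne ys(3) by (simp add: last_conv_nth hd_conv_nth)
    qed
    have yin: "y \<in> set ys" using ys(3) ne by force
    show ?thesis
    proof (intro exI[of _ "z # ys"] conjI allI impI ballI)
      show "distinct (z # ys)" using zys ys(1) by simp
      show "2 \<le> length (z # ys)" using ys(2) by simp
      have "last ys \<noteq> z" using zys ne by force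
      then show "degree F inc (last (z # ys)) = 1" using degF ys(4) lst ne by simp
    next
      fix i assume i: "Suc i < length (z # ys)"
      show "\<exists>e\<in>F. inc e = {(z # ys) ! i, (z # ys) ! Suc i}"
      proof (cases i)
        case 0
        then show ?thesis using y eF(1) ys(3) ne by (auto simp: hd_conv_nth)
      next
        case (Suc j)
        then show ?thesis using ys(5)[of j] i by (auto simp: F'_def)
      qed
    next
      show "closed_under F inc (set (z # ys))"
        unfolding closed_under_def
      proof (intro ballI impI)
        fix f assume f: "f \<in> F" "inc f \<inter> set (z # ys) \<noteq> {}"
        show "inc f \<subseteq> set (z # ys)"
        proof (cases "f = e")
          case True then show ?thesis using y yin by auto
        next
          case False
          then have "f \<in> F'" using f by (simp add: F'_def)
          moreover then have "z \<notin> inc f" using pos[of f z] dz by auto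
          ultimately show ?thesis using f(2) ys(6) by (auto simp: closed_under_def)
        qed
      qed
    next
      fix x assume "x \<in> set (z # ys)"
      then consider "x = z" | "x = y" | "x = last ys" "x \<noteq> y" | "x \<in> set ys" "x \<noteq> y" "degree F' inc x = 2"
        using ys(7) by auto
      then show "x = z \<or> x = last (z # ys) \<or> degree F inc x = 2"
        by cases (use ne degF[of x] 2 zys deg[of x] in auto)
    qed simp
  qed
qed

text \<open>Chains with both ends in \<open>C\<close> pair up elements of \<open>C\<close>, and an
  odd set cannot be paired off completely. Such a chain is removed and the argument repeats on the
  rest.\<close>

lemma odd_escape:
  assumes "finite F" "\<And>e. e \<in> F \<Longrightarrow> card (inc e) = 2" "\<And>v. degree F inc v \<le> 2"
    and "finite C" "odd (card C)" "\<And>z. z \<in> C \<Longrightarrow> degree F inc z = 1"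
  shows "\<exists>z\<in>C. \<exists>K. closed_under F inc K \<and> K \<inter> C = {z}"
  using assms
proof (induction "card C" arbitrary: F C rule: less_induct)
  case less
  note fin = less.prems(1) and two = less.prems(2) and deg = less.prems(3) and C = less.prems(4-6)
  from C(2) obtain z where z: "z \<in> C" by fastforce
  from chain_exists[OF fin two deg C(3)[OF z]] obtain xs where xs:
    "distinct xs" "2 \<le> length xs" "hd xs = z" "closed_under F inc (set xs)"
    "\<And>x. x\<in>set xs \<Longrightarrow> x = z \<or> x = last xs \<or> degree F inc x = 2" by blast
  define K where "K = set xs"
  have zK: "z \<in> K" using xs(2,3) hd_in_set[of xs] by (cases xs) (auto simp: K_def)
  have KC: "K \<inter> C \<subseteq> {z, last xs}" using xs(5) C(3) by (fastforce simp: K_def)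
  show ?case
  proof (cases "K \<inter> C = {z}")
    case True
    then show ?thesis using z xs(4) K_def by blast
  next
    case False
    define z' where "z' = last xs"
    have z': "z' \<in> C" "z' \<noteq> z" "K \<inter> C = {z, z'}" using False KC zK z by (auto simp: z'_def)
    define F' where "F' = {e\<in>F. inc e \<inter> K = {}}"
    define C' where "C' = C - {z, z'}"
    have "card C' = card C - 2" using z z' C(1) by (simp add: C'_def card_Diff_subset)
    moreover have "card C \<ge> 2" using z z' C(1) by (metis card_2_iff card_mono empty_subsetI insert_subset)
    ultimately have cC: "card C' < card C" "odd (card C')" using C(2) by auto
    have sub: "degree F' inc v \<le> degree F inc v" for v
      unfolding degree_def by (rule card_mono) (use fin in \<open>auto simp: F'_def\<close>)
    have same: "degree F' inc v = 1" if "v \<in> C'" for v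
    proof -
      have "v \<notin> K" using that z'(3) by (auto simp: C'_def)
      then have "{e\<in>F'. v \<in> inc e} = {e\<in>F. v \<in> inc e}"
        using xs(4) by (auto simp: F'_def closed_under_def K_def)
      then show ?thesis using C(3)[of v] that by (simp add: degree_def C'_def)
    qed
    have "\<exists>z\<in>C'. \<exists>K. closed_under F' inc K \<and> K \<inter> C' = {z}"
    proof (rule less.hyps[OF cC(1) _ _ _ _ cC(2) same])
      show "finite F'" "finite C'" using fin C(1) by (auto simp: F'_def C'_def)
      show "card (inc e) = 2" if "e \<in> F'" for e using that two by (simp add: F'_def)
      show "degree F' inc v \<le> 2" for v using sub deg le_trans by blast
    qed
    then obtain z1 K1 where 1: "z1 \<in> C'" "closed_under F' inc K1" "K1 \<inter> C' = {z1}" by blast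
    \<comment> \<open>\<open>K1\<close> is known to be closed only for edges that miss
      \<open>K\<close>. Since no edge of \<open>F\<close> leaves \<open>K\<close>, cutting
      \<open>K\<close> away gives closedness for all of \<open>F\<close>.\<close>
    have "closed_under F inc (K1 - K)"
      unfolding closed_under_def
    proof (intro ballI impI)
      fix f assume f: "f \<in> F" "inc f \<inter> (K1 - K) \<noteq> {}"
      then have "inc f \<inter> K = {}" using xs(4) by (auto simp: closed_under_def K_def)
      then show "inc f \<subseteq> K1 - K" using f 1(2) by (auto simp: closed_under_def F'_def)
    qed
    moreover have "(K1 - K) \<inter> C = {z1}" using 1 z'(3) by (auto simp: C'_def)
    ultimately show ?thesis using 1(1) unfolding C'_def by blast
  qed
qed

section \<open>Partial 3-edge-colourings and Kempe changes\<close>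

text \<open>The value 0 stands for uncoloured, so colourings are total functions that can be updated
  edge by edge; only this value may repeat at a vertex.\<close>

definition partial_colouring :: "'e set \<Rightarrow> ('e \<Rightarrow> 'v set) \<Rightarrow> ('e \<Rightarrow> nat) \<Rightarrow> bool" where
  "partial_colouring E inc c \<longleftrightarrow> (\<forall>e\<in>E. c e \<le> 3) \<and>
     (\<forall>e\<in>E. \<forall>f\<in>E. e \<noteq> f \<and> inc e \<inter> inc f \<noteq> {} \<and> c e = c f \<longrightarrow> c e = 0)"

lemma partial_colouringD:
  assumes "partial_colouring E inc c" "e \<in> E" "f \<in> E" "e \<noteq> f" "x \<in> inc e" "x \<in> inc f" "c e = c f"
  shows "c e = 0"
  using assms unfolding partial_colouring_def by blast

lemma degree_two_colours:
  assumes c: "partial_colouring E inc c" and ab: "a \<in> {1..3}" "b \<in> {1..3}"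
    and F: "F \<subseteq> {e\<in>E. c e \<in> {a, b}}"
  shows "degree F inc v \<le> 2"
proof -
  have "inj_on c {e\<in>F. v \<in> inc e}"
  proof (rule inj_onI)
    fix e f assume e: "e \<in> {e\<in>F. v \<in> inc e}" and f: "f \<in> {e\<in>F. v \<in> inc e}" and ef: "c e = c f"
    have *: "c e \<noteq> 0" "e \<in> E" "f \<in> E" using e f F ab by auto
    have "c e = 0" if "e \<noteq> f"
      by (rule partial_colouringD[OF c *(2,3) that _ _ ef]) (use e f in auto)
    then show "e = f" using *(1) by blast
  qed
  then have "degree F inc v = card (c ` {e\<in>F. v \<in> inc e})" by (simp add: degree_def card_image)
  also have "\<dots> \<le> card {a, b}" by (rule card_mono) (use F in auto)
  finally show ?thesis by (simp add: card_insert_if split: if_splits)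
qed

definition uncoloured :: "'e set \<Rightarrow> ('e \<Rightarrow> nat) \<Rightarrow> 'e set" where
  "uncoloured E c = {e\<in>E. c e = 0}"

text \<open>Together with \<open>nu3_colouring\<close> this identifies
  \<open>card E - nu 3 E inc\<close> with the least number of uncoloured edges.\<close>

lemma colouring_le_nu3:
  assumes "finite E" "partial_colouring E inc c"
  shows "card E \<le> nu 3 E inc + card (uncoloured E c)"
proof -
  let ?F = "{e\<in>E. c e \<noteq> 0}"
  have "k_edge_colorable 3 ?F inc"
    unfolding k_edge_colorable_def
  proof (intro exI[of _ "\<lambda>e. c e - 1"] conjI ballI impI)
    fix e assume e: "e \<in> ?F"
    then have "c e \<le> 3" using assms(2) by (simp add: partial_colouring_def)
    then show "c e - 1 < 3" by linarith
    fix f assume f: "f \<in> ?F" and "e \<noteq> f \<and> inc e \<inter> inc f \<noteq> {}"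
    then have "c e \<noteq> c f" using assms(2) e f unfolding partial_colouring_def by (metis (mono_tags, lifting) mem_Collect_eq)
    then show "c e - 1 \<noteq> c f - 1" using e f by auto
  qed
  then have "card ?F \<le> nu 3 E inc" by (intro nu_ge) (use assms in auto)
  moreover have "card E = card ?F + card (uncoloured E c)"
    unfolding uncoloured_def using assms(1) by (subst card_Un_disjoint[symmetric]) (auto intro: arg_cong[where f = card])
  ultimately show ?thesis by simp
qed

lemma nu3_colouring:
  assumes "finite E"
  obtains c where "partial_colouring E inc c" "card E = nu 3 E inc + card (uncoloured E c)"
proof -
  obtain F where F: "F \<subseteq> E" "k_edge_colorable 3 F inc" "card F = nu 3 E inc"
    using nu_attained[OF assms] by blast
  then obtain col where col: "\<And>e. e \<in> F \<Longrightarrow> col e < (3::nat)"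
    "\<And>e f. e \<in> F \<Longrightarrow> f \<in> F \<Longrightarrow> e \<noteq> f \<Longrightarrow> inc e \<inter> inc f \<noteq> {} \<Longrightarrow> col e \<noteq> col f"
    unfolding k_edge_colorable_def by blast
  let ?c = "\<lambda>e. if e \<in> F then Suc (col e) else 0"
  have "partial_colouring E inc ?c"
    using col by (auto simp: partial_colouring_def Suc_le_eq)
  moreover have "uncoloured E ?c = E - F" by (auto simp: uncoloured_def)
  then have "card E = nu 3 E inc + card (uncoloured E ?c)"
    using F assms by (simp add: card_Diff_subset finite_subset card_mono flip: F(3))
  ultimately show thesis by (rule that)
qed

definition kempe :: "('e \<Rightarrow> 'v set) \<Rightarrow> nat \<Rightarrow> nat \<Rightarrow> 'v set \<Rightarrow> ('e \<Rightarrow> nat) \<Rightarrow> 'e \<Rightarrow> nat" where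
  "kempe inc a b K c e =
     (if inc e \<inter> K = {} then c e else if c e = a then b else if c e = b then a else c e)"

lemma kempe_zero_iff: "a \<noteq> 0 \<Longrightarrow> b \<noteq> 0 \<Longrightarrow> kempe inc a b K c e = 0 \<longleftrightarrow> c e = 0"
  by (auto simp: kempe_def)

lemma uncoloured_kempe: "a \<noteq> 0 \<Longrightarrow> b \<noteq> 0 \<Longrightarrow> uncoloured E (kempe inc a b K c) = uncoloured E c"
  by (simp add: uncoloured_def kempe_zero_iff)

text \<open>An edge that changes colour lies inside \<open>K\<close> by closedness, so every
  adjacent edge of colour \<open>a\<close> or \<open>b\<close> meets \<open>K\<close> and changes as
  well.\<close>

lemma partial_colouring_kempe:
  assumes c: "partial_colouring E inc c" and ab: "a \<in> {1..3}" "b \<in> {1..3}"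
    and K: "closed_under {e\<in>E. c e \<in> {a, b}} inc K"
  shows "partial_colouring E inc (kempe inc a b K c)"
  unfolding partial_colouring_def
proof (intro conjI ballI impI)
  fix e assume e: "e \<in> E"
  show "kempe inc a b K c e \<le> 3" using c ab e by (auto simp: partial_colouring_def kempe_def)
  fix f assume f: "f \<in> E" and ef: "e \<noteq> f \<and> inc e \<inter> inc f \<noteq> {} \<and> kempe inc a b K c e = kempe inc a b K c f"
  have "c e = c f \<Longrightarrow> c e = 0" using c e f ef by (auto simp: partial_colouring_def)
  then show "kempe inc a b K c e = 0"
    using ef K e f ab unfolding kempe_def closed_under_def by (auto split: if_splits)
qed

lemma kempe_inside: "inc e \<inter> K \<noteq> {} \<Longrightarrow> kempe inc a b K c e = a \<longleftrightarrow> c e = b"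
  by (auto simp: kempe_def)

lemma kempe_outside:
  assumes "closed_under {e\<in>E. c e \<in> {a, b}} inc K" "e \<in> E" "\<not> inc e \<subseteq> K"
  shows "kempe inc a b K c e = c e"
  using assms by (auto simp: kempe_def closed_under_def)

section \<open>Paths and cycles as vertex lists\<close>

fun path_edges :: "'v list \<Rightarrow> 'v set set" where
  "path_edges (x # y # zs) = insert {x, y} (path_edges (y # zs))"
| "path_edges _ = {}"

text \<open>The closing edge is kept apart from the path because, after a suitable arrangement of
  the list, it becomes the uncoloured edge of a ring.\<close>

definition cyc :: "'v list \<Rightarrow> 'v set set" where
  "cyc xs = insert {last xs, hd xs} (path_edges xs)"

lemma path_edges_Cons: "ys \<noteq> [] \<Longrightarrow> path_edges (x # ys) = insert {x, hd ys} (path_edges ys)"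
  by (cases ys) auto

lemma path_edges_snoc: "ys \<noteq> [] \<Longrightarrow> path_edges (ys @ [x]) = insert {last ys, x} (path_edges ys)"
  by (induction ys rule: path_edges.induct) auto

lemma path_edges_rev: "path_edges (rev xs) = path_edges xs"
  by (induction xs rule: path_edges.induct) (auto simp: path_edges_snoc insert_commute simp flip: append_assoc)

lemma path_edges_conv_nth: "path_edges xs = {{xs ! i, xs ! Suc i} |i. Suc i < length xs}"
proof (induction xs rule: path_edges.induct)
  case (1 x y zs)
  show ?case unfolding path_edges.simps 1
  proof (intro set_eqI iffI)
    fix e assume "e \<in> insert {x, y} {{(y # zs) ! i, (y # zs) ! Suc i} |i. Suc i < length (y # zs)}"
    then consider "e = {x, y}" | i where "Suc i < length (y # zs)" "e = {(y # zs) ! i, (y # zs) ! Suc i}" by blast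
    then show "e \<in> {{(x # y # zs) ! i, (x # y # zs) ! Suc i} |i. Suc i < length (x # y # zs)}"
    proof cases
      case 1 then show ?thesis by (intro CollectI exI[of _ 0]) simp
    next
      case (2 i) then show ?thesis by (intro CollectI exI[of _ "Suc i"]) simp
    qed
  next
    fix e assume "e \<in> {{(x # y # zs) ! i, (x # y # zs) ! Suc i} |i. Suc i < length (x # y # zs)}"
    then obtain i where "Suc i < length (x # y # zs)" "e = {(x # y # zs) ! i, (x # y # zs) ! Suc i}" by blast
    then show "e \<in> insert {x, y} {{(y # zs) ! i, (y # zs) ! Suc i} |i. Suc i < length (y # zs)}"
      by (cases i) auto
  qed
qed auto

lemma path_edges_subset: "e \<in> path_edges xs \<Longrightarrow> e \<subseteq> set xs"
  by (induction xs rule: path_edges.induct) auto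

lemma cyc_subset: "xs \<noteq> [] \<Longrightarrow> e \<in> cyc xs \<Longrightarrow> e \<subseteq> set xs"
  using path_edges_subset by (fastforce simp: cyc_def)

lemma cyc_rev: "cyc (rev xs) = cyc xs"
  by (cases "xs = []") (auto simp: cyc_def path_edges_rev hd_rev last_rev insert_commute)

lemma cyc_rotate1: "2 \<le> length xs \<Longrightarrow> cyc (rotate1 xs) = cyc xs"
proof (cases xs)
  case (Cons x ys)
  assume "2 \<le> length xs"
  then have "ys \<noteq> []" using Cons by auto
  then show ?thesis using Cons by (auto simp: cyc_def path_edges_snoc path_edges_Cons insert_commute)
qed simp

lemma cyc_rotate: "2 \<le> length xs \<Longrightarrow> cyc (rotate n xs) = cyc xs"
  by (induction n) (simp_all add: cyc_rotate1)

text \<open>Rotation makes the chosen edge the closing one and reversal fixes its orientation; the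
  other edges then form a path from \<open>x\<close> to \<open>y\<close>.\<close>

lemma cyc_arrange:
  assumes "distinct xs" "2 \<le> length xs" "{x, y} \<in> cyc xs"
  obtains zs where "distinct zs" "set zs = set xs" "length zs = length xs" "cyc zs = cyc xs"
    "hd zs = x" "last zs = y"
proof -
  have "\<exists>zs. distinct zs \<and> set zs = set xs \<and> length zs = length xs \<and> cyc zs = cyc xs \<and>
    {last zs, hd zs} = {x, y}"
  proof (cases "{x, y} = {last xs, hd xs}")
    case True then show ?thesis using assms(1) by (intro exI[of _ xs]) auto
  next
    case False
    then obtain i where i: "Suc i < length xs" "{x, y} = {xs ! i, xs ! Suc i}"
      using assms(3) by (auto simp: cyc_def path_edges_conv_nth)
    have "rotate (Suc i) xs = drop (Suc i) xs @ take (Suc i) xs"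
      using i(1) by (simp add: rotate_drop_take)
    then have "hd (rotate (Suc i) xs) = xs ! Suc i" "last (rotate (Suc i) xs) = xs ! i"
      using i(1) by (simp_all add: hd_drop_conv_nth take_Suc_conv_app_nth)
    then show ?thesis using assms i by (intro exI[of _ "rotate (Suc i) xs"]) (auto simp: cyc_rotate simp del: rotate_Suc)
  qed
  then obtain zs where zs: "distinct zs" "set zs = set xs" "length zs = length xs" "cyc zs = cyc xs"
    "{last zs, hd zs} = {x, y}" by blast
  show thesis
  proof (cases "hd zs = x \<and> last zs = y")
    case True then show ?thesis using that[of zs] zs by auto
  next
    case False
    then have "hd zs = y \<and> last zs = x" using zs(5) by (auto simp: doubleton_eq_iff)
    moreover have "zs \<noteq> []" using zs(3) assms(2) by auto
    ultimately show ?thesis using that[of "rev zs"] zs by (simp add: cyc_rev hd_rev last_rev)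
  qed
qed

lemma cyc_at_vertex:
  assumes "distinct xs" "3 \<le> length xs" "x \<in> set xs"
  obtains y z where "{e\<in>cyc xs. x \<in> e} = {{x, y}, {x, z}}" "x \<noteq> y" "x \<noteq> z" "y \<noteq> z" "y \<in> set xs" "z \<in> set xs"
proof -
  obtain i where i: "i < length xs" "x = xs ! i" using assms(3) by (auto simp: in_set_conv_nth)
  have "\<exists>z. {x, z} \<in> cyc xs"
  proof (cases "Suc i < length xs")
    case True then show ?thesis using i by (auto simp: cyc_def path_edges_conv_nth)
  next
    case False
    then have "x = last xs" using i by (metis Suc_lessI diff_Suc_1 last_conv_nth length_0_conv not_less_zero)
    then show ?thesis by (auto simp: cyc_def)
  qed
  then obtain z where "{x, z} \<in> cyc xs" by blast
  from cyc_arrange[OF assms(1) _ this] assms(2) obtain zs where zs: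
    "distinct zs" "set zs = set xs" "length zs = length xs" "cyc zs = cyc xs" "hd zs = x" "last zs = z"
    by (metis One_nat_def Suc_1 Suc_leD numeral_3_eq_3)
  obtain y ws where ws: "zs = x # y # ws" "ws \<noteq> []"
  proof -
    have "3 \<le> length zs" using zs assms(2) by simp
    then show thesis using that zs(5) by (cases zs; cases "tl zs"; cases "tl (tl zs)") auto
  qed
  have "x \<notin> e" if "e \<in> path_edges (y # ws)" for e
    using path_edges_subset[OF that] zs(1) ws(1) by auto
  then have "{e\<in>cyc zs. x \<in> e} = {{x, y}, {x, z}}"
    using ws zs(6) by (auto simp: cyc_def)
  moreover have "z \<in> set ws" using zs(6) ws by auto
  moreover have "x \<notin> set (y # ws)" "y \<notin> set ws" using zs(1) ws(1) by auto
  moreover have "set xs = set (x # y # ws)" using zs(2) ws(1) by simp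
  ultimately show thesis by (intro that[of y z]) (auto simp: zs(4))
qed

fun paint :: "nat \<Rightarrow> nat \<Rightarrow> 'v list \<Rightarrow> ('v set \<Rightarrow> nat) \<Rightarrow> 'v set \<Rightarrow> nat" where
  "paint a b (x # y # zs) c = (paint b a (y # zs) c)({x, y} := a)"
| "paint a b _ c = c"

lemma paint_outside: "e \<notin> path_edges xs \<Longrightarrow> paint a b xs c e = c e"
  by (induction a b xs c rule: paint.induct) auto

lemma paint_range: "e \<in> path_edges xs \<Longrightarrow> paint a b xs c e \<in> {a, b}"
  by (induction a b xs c rule: paint.induct) auto

lemma paint_hd:
  assumes "distinct xs" "e \<in> path_edges xs" "hd xs \<in> e"
  shows "paint a b xs c e = a"
proof (cases "(a, b, xs, c)" rule: paint.cases)
  case (1 a b x y zs c)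
  then have "x \<notin> set (y # zs)" using assms(1) by auto
  then have "e \<notin> path_edges (y # zs)" using path_edges_subset[of e "y # zs"] assms(3) 1 by auto
  then show ?thesis using 1 assms(2) by auto
qed (use assms in auto)

text \<open>A path on an odd number of vertices has an even number of edges, so it starts with
  \<open>a\<close> and ends with \<open>b\<close>. This parity is what frees different colours at
  the two ends.\<close>

lemma paint_last:
  "distinct xs \<Longrightarrow> e \<in> path_edges xs \<Longrightarrow> last xs \<in> e \<Longrightarrow>
    paint a b xs c e = (if even (length xs) then a else b)"
proof (induction a b xs c rule: paint.induct)
  case (1 a b x y zs c)
  have lx: "last (x # y # zs) \<noteq> x" using 1(2) by auto
  show ?case
  proof (cases zs)
    case Nil
    then show ?thesis using 1(3) by simp
  next
    case (Cons z zs')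
    have "last (y # zs) \<noteq> y" using 1(2) Cons by auto
    then have "e \<noteq> {x, y}" using lx 1(4) by auto
    then show ?thesis using 1 by auto
  qed
qed auto

lemma paint_proper:
  assumes "distinct xs" "a \<noteq> b" "e \<in> path_edges xs" "f \<in> path_edges xs" "e \<noteq> f" "e \<inter> f \<noteq> {}"
  shows "paint a b xs c e \<noteq> paint a b xs c f"
  using assms
proof (induction a b xs c rule: paint.induct)
  case (1 a b x y zs c)
  have *: "paint b a (y # zs) c g = b" if "g \<in> path_edges (y # zs)" "g \<inter> {x, y} \<noteq> {}" for g
  proof -
    have "x \<notin> g" using path_edges_subset[OF that(1)] 1(2) by auto
    then show ?thesis using that 1(2) by (intro paint_hd) auto
  qed
  show ?case
  proof (cases "e = {x, y} \<or> f = {x, y}")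
    case True
    then show ?thesis using *[of e] *[of f] 1(3-7) by auto
  next
    case False
    then show ?thesis using 1 by auto
  qed
qed auto

text \<open>A permutation of the three colours; usually \<open>s\<close> is the type of a ring and
  \<open>a\<close>, \<open>b\<close> alternate on it.\<close>

definition cols :: "nat \<Rightarrow> nat \<Rightarrow> nat \<Rightarrow> bool" where
  "cols a b s \<longleftrightarrow> a \<in> {1..3} \<and> b \<in> {1..3} \<and> s \<in> {1..3} \<and> a \<noteq> b \<and> a \<noteq> s \<and> b \<noteq> s"

lemma cols_cases: "cols a b s \<Longrightarrow> k \<in> {1..3} \<Longrightarrow> k = a \<or> k = b \<or> k = s"
  unfolding cols_def by auto

lemma cols_le_cases: "cols a b s \<Longrightarrow> k \<le> 3 \<Longrightarrow> k = 0 \<or> k = a \<or> k = b \<or> k = s"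
  unfolding cols_def by auto

lemma cols_swap: "cols a b s \<Longrightarrow> cols b a s" "cols a b s \<Longrightarrow> cols a s b" "cols a b s \<Longrightarrow> cols s b a"
  by (auto simp: cols_def)

lemma cols_third: "a \<in> {1..3} \<Longrightarrow> b \<in> {1..3} \<Longrightarrow> a \<noteq> b \<Longrightarrow> \<exists>s. cols a b s"
  \<comment> \<open>The three colours sum to 6.\<close>
  by (rule exI[of _ "6 - a - b"]) (simp add: cols_def; presburger)

lemma cols_others: "s \<in> {1..3} \<Longrightarrow> \<exists>a b. cols a b s"
  by (rule exI[of _ "if s = 1 then 2 else 1"], rule exI[of _ "if s = 3 then 2 else 3"]) (auto simp: cols_def)

section \<open>Optimal partial colourings of simple triangle-free cubic graphs\<close>

locale cubic_graph =
  fixes V :: "'v set" and E :: "'v set set"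
  assumes finV: "finite V"
    and edgeD: "e \<in> E \<Longrightarrow> e \<subseteq> V \<and> card e = 2"
    and cubic: "v \<in> V \<Longrightarrow> card {e\<in>E. v \<in> e} = 3"
    and triangle_free: "{x, y} \<in> E \<Longrightarrow> {y, z} \<in> E \<Longrightarrow> {x, z} \<in> E \<Longrightarrow> False"
    and cutb: "cut_bridgeless V E (\<lambda>e. e)"
begin

lemma finE: "finite E"
  by (rule finite_subset[of _ "Pow V"]) (use edgeD finV in auto)

lemma edge_neq: "{x, y} \<in> E \<Longrightarrow> x \<noteq> y"
  using edgeD[of "{x, y}"] by auto

lemma edge_V: "{x, y} \<in> E \<Longrightarrow> x \<in> V" "{x, y} \<in> E \<Longrightarrow> y \<in> V"
  using edgeD[of "{x, y}"] by auto

lemma edge_other: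
  assumes "e \<in> E" "x \<in> e"
  obtains y where "e = {x, y}" "x \<noteq> y"
  using edgeD[OF assms(1)] assms(2) by (metis card_2_iff doubleton_eq_iff insertE singletonD)

lemma three_edges:
  assumes "v \<in> V"
  obtains e f g where "{e\<in>E. v \<in> e} = {e, f, g}" "e \<noteq> f" "e \<noteq> g" "f \<noteq> g"
  using cubic[OF assms] by (auto simp: card_3_iff)

abbreviation good :: "('v set \<Rightarrow> nat) \<Rightarrow> bool" where
  "good c \<equiv> partial_colouring E (\<lambda>e. e) c"

abbreviation unc :: "('v set \<Rightarrow> nat) \<Rightarrow> 'v set set" where
  "unc c \<equiv> uncoloured E c"

definition opt :: "('v set \<Rightarrow> nat) \<Rightarrow> bool" where
  "opt c \<longleftrightarrow> good c \<and> (\<forall>c'. good c' \<longrightarrow> card (unc c) \<le> card (unc c'))"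

definition miss :: "('v set \<Rightarrow> nat) \<Rightarrow> 'v \<Rightarrow> nat \<Rightarrow> bool" where
  "miss c v k \<longleftrightarrow> (\<forall>e\<in>E. v \<in> e \<longrightarrow> c e \<noteq> k)"

abbreviation chain_closed :: "('v set \<Rightarrow> nat) \<Rightarrow> nat \<Rightarrow> nat \<Rightarrow> 'v set \<Rightarrow> bool" where
  "chain_closed c a b K \<equiv> closed_under {e\<in>E. c e \<in> {a, b}} (\<lambda>e. e) K"

abbreviation swap :: "nat \<Rightarrow> nat \<Rightarrow> 'v set \<Rightarrow> ('v set \<Rightarrow> nat) \<Rightarrow> 'v set \<Rightarrow> nat" where
  "swap a b K c \<equiv> kempe (\<lambda>e. e) a b K c"

lemma goodD: "good c \<Longrightarrow> e \<in> E \<Longrightarrow> f \<in> E \<Longrightarrow> e \<noteq> f \<Longrightarrow> x \<in> e \<Longrightarrow> x \<in> f \<Longrightarrow> c e = c f \<Longrightarrow> c e = 0"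
  unfolding partial_colouring_def by blast

lemma good_le: "good c \<Longrightarrow> e \<in> E \<Longrightarrow> c e \<le> 3"
  unfolding partial_colouring_def by blast

lemma opt_good: "opt c \<Longrightarrow> good c"
  by (simp add: opt_def)

lemma opt_cong: "opt c \<Longrightarrow> good c' \<Longrightarrow> card (unc c') = card (unc c) \<Longrightarrow> opt c'"
  by (simp add: opt_def)

lemma opt_exists: "\<exists>c. opt c"
proof -
  have "good (\<lambda>_. 0)" by (simp add: partial_colouring_def)
  then show ?thesis
    using ex_has_least_nat[of good "\<lambda>_. 0" "\<lambda>c. card (unc c)"] by (auto simp: opt_def)
qed

text \<open>Otherwise the uncoloured edge could receive \<open>k\<close>, leaving fewer uncoloured
  edges.\<close>

lemma opt_no_common:
  assumes c: "opt c" and e: "{u, v} \<in> E" "c {u, v} = 0" and k: "k \<in> {1..3}" "miss c u k" "miss c v k"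
  shows False
proof -
  let ?c = "c({u, v} := k)"
  have "good ?c"
    unfolding partial_colouring_def
  proof (intro conjI ballI impI)
    fix f assume f: "f \<in> E"
    show "?c f \<le> 3" using good_le[OF opt_good[OF c] f] k by auto
    fix g assume g: "g \<in> E" and fg: "f \<noteq> g \<and> f \<inter> g \<noteq> {} \<and> ?c f = ?c g"
    then obtain x where x: "x \<in> f" "x \<in> g" by blast
    have no: "?c h = c h \<and> c h \<noteq> k" if "h \<in> E" "h \<noteq> {u, v}" "h \<inter> {u, v} \<noteq> {}" for h
    proof -
      have "u \<in> h \<or> v \<in> h" using that(3) by blast
      then show ?thesis using that(1,2) k unfolding miss_def by auto
    qed
    have "f \<noteq> {u, v}"
    proof
      assume "f = {u, v}"
      then show False using no[OF g] fg by (auto simp: Int_commute split: if_splits)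
    qed
    moreover have "g \<noteq> {u, v}"
    proof
      assume "g = {u, v}"
      then show False using no[OF f] fg by (auto split: if_splits)
    qed
    ultimately have cf: "c f = c g" "?c f = c f" using fg by auto
    show "?c f = 0" unfolding cf(2) by (rule goodD[OF opt_good[OF c] f g conjunct1[OF fg] x cf(1)])
  qed
  moreover have "unc ?c = unc c - {{u, v}}" using k by (auto simp: uncoloured_def)
  moreover have "{u, v} \<in> unc c" using e by (simp add: uncoloured_def)
  moreover have "finite (unc c)" using finE by (simp add: uncoloured_def)
  ultimately show False using c card_Diff1_less[of "unc c"] by (fastforce simp: opt_def)
qed

lemma opt_swap:
  assumes "opt c" "a \<in> {1..3}" "b \<in> {1..3}" "chain_closed c a b K"
  shows "opt (swap a b K c)"
proof (rule opt_cong[OF assms(1)])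
  show "good (swap a b K c)" by (rule partial_colouring_kempe[OF opt_good[OF assms(1)] assms(2-4)])
  show "card (unc (swap a b K c)) = card (unc c)" using assms(2,3) by (simp add: uncoloured_kempe)
qed

lemma miss_swap_in:
  assumes "x \<in> K" "miss c x a"
  shows "miss (swap a b K c) x b"
  using assms by (auto simp: miss_def kempe_def)

lemma miss_swap_out:
  assumes "chain_closed c a b K" "x \<notin> K" "miss c x k"
  shows "miss (swap a b K c) x k"
  using assms kempe_outside[OF assms(1)] by (fastforce simp: miss_def)

text \<open>Exchanging the colours on \<open>K\<close> would make \<open>u\<close> miss
  \<open>b\<close> and leave \<open>v\<close> untouched, so both ends would miss \<open>b\<close>.
  Hence a chain of the colours missing at the ends of an uncoloured edge connects these
  ends.\<close>

lemma opt_no_separation: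
  assumes c: "opt c" and e: "{u, v} \<in> E" "c {u, v} = 0"
    and ab: "a \<in> {1..3}" "b \<in> {1..3}" and m: "miss c u a" "miss c v b"
    and K: "chain_closed c a b K" "u \<in> K" "v \<notin> K"
  shows False
  using opt_no_common[OF opt_swap[OF c ab K(1)] e(1)] e(2) ab
    miss_swap_in[OF K(2) m(1)] miss_swap_out[OF K(1) K(3) m(2)]
  by (auto simp: kempe_zero_iff)

text \<open>Disjointness keeps \<open>K\<close> closed after the change on \<open>L\<close>;
  together the two changes free \<open>s\<close> at both ends.\<close>

lemma opt_no_double_swap:
  assumes c: "opt c" and e: "{u, v} \<in> E" "c {u, v} = 0" and s: "cols s p q"
    and m: "miss c u p" "miss c v q"
    and K: "chain_closed c s p K" "u \<in> K" and L: "chain_closed c s q L" "v \<in> L" and KL: "K \<inter> L = {}"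
  shows False
proof -
  let ?c = "swap s q L c"
  have c': "opt ?c" using opt_swap[OF c _ _ L(1)] s by (auto simp: cols_def)
  have K': "chain_closed ?c s p K"
    unfolding closed_under_def
  proof (intro ballI impI)
    fix f assume f: "f \<in> {e \<in> E. ?c e \<in> {s, p}}" "f \<inter> K \<noteq> {}"
    then have "\<not> f \<subseteq> L" using KL by auto
    then have "?c f = c f" using kempe_outside[OF L(1)] f by auto
    then show "f \<subseteq> K" using f K(1) by (auto simp: closed_under_def)
  qed
  have u: "miss ?c u p" using miss_swap_out[OF L(1) _ m(1)] K KL by auto
  have v: "miss ?c v s" using L m s by (auto simp: miss_def kempe_def)
  show False
    by (rule opt_no_separation[OF c' e(1) _ _ _ u v, of K])
      (use e s K' K KL L in \<open>auto simp: kempe_zero_iff cols_def insert_commute\<close>)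
qed

lemma misses_some:
  assumes "v \<in> V" "e \<in> unc c" "v \<in> e"
  shows "\<exists>m\<in>{1..3}. miss c v m"
proof (rule ccontr)
  let ?D = "{e\<in>E. v \<in> e}"
  assume "\<not> ?thesis"
  then have *: "\<forall>m\<in>{1..3}. \<exists>e\<in>?D. c e = m" by (auto simp: miss_def)
  have "{1..3} \<subseteq> c ` ?D"
  proof
    fix m assume "m \<in> {1..3::nat}"
    then obtain e where "e \<in> ?D" "c e = m" using * by blast
    then show "m \<in> c ` ?D" by blast
  qed
  moreover have "0 \<in> c ` ?D" using assms by (auto simp: uncoloured_def image_iff)
  moreover have "{0..3} = insert 0 {1..3::nat}" by auto
  ultimately have "{0..3} \<subseteq> c ` ?D" by simp
  then have "card {0..3::nat} \<le> card (c ` ?D)" using finE by (intro card_mono) auto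
  also have "\<dots> \<le> card ?D" by (rule card_image_le) (use finE in auto)
  finally show False using cubic[OF assms(1)] by simp
qed

text \<open>At a common end \<open>u\<close> only one colour \<open>m\<close> occurs, and both far
  ends must miss it. For a colour \<open>n\<close> missing at \<open>u\<close>, the chain of colours
  \<open>n\<close> and \<open>m\<close> starting in \<open>u\<close> must reach both far ends, but
  each of them can only be its last vertex.\<close>

lemma unc_matching:
  assumes c: "opt c" and e: "e \<in> unc c" "u \<in> e" and e': "e' \<in> unc c" "u \<in> e'"
  shows "e = e'"
proof (rule ccontr)
  assume ne: "e \<noteq> e'"
  have E: "e \<in> E" "e' \<in> E" "c e = 0" "c e' = 0" using e e' by (auto simp: uncoloured_def)
  obtain v v' where v: "e = {u, v}" "u \<noteq> v" and v': "e' = {u, v'}" "u \<noteq> v'"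
    using edge_other E e e' by metis
  have V: "u \<in> V" "v \<in> V" "v' \<in> V" using edge_V E v v' by auto
  obtain m where m: "m \<in> {1..3}" "miss c v m" using misses_some[OF V(2) e(1)] v by auto
  obtain m' where m': "m' \<in> {1..3}" "miss c v' m'" using misses_some[OF V(3) e'(1)] v' by auto
  have "\<not> miss c u m" using opt_no_common[OF c, of u v m] E v m by auto
  then obtain g where g: "g \<in> E" "u \<in> g" "c g = m" by (auto simp: miss_def)
  have "\<not> miss c u m'" using opt_no_common[OF c, of u v' m'] E v' m' by auto
  then obtain g' where g': "g' \<in> E" "u \<in> g'" "c g' = m'" by (auto simp: miss_def)
  have three: "{e\<in>E. u \<in> e} = {e, e', g}"
  proof (rule card_seteq[symmetric])
    have "g \<noteq> e" "g \<noteq> e'" using g E m by auto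
    then show "card {e\<in>E. u \<in> e} \<le> card {e, e', g}" using cubic[OF V(1)] ne by simp
  qed (use E e e' g finE in auto)
  then have "g' \<in> {e, e', g}" using g' by auto
  then have "m' = m" using g g' E m' by auto
  obtain n where n: "n \<in> {1..3}" "n \<noteq> m" using m by (metis atLeastAtMost_iff le_refl one_le_numeral numeral_eq_one_iff semiring_norm(86))
  have un: "miss c u n" unfolding miss_def
  proof (intro ballI impI)
    fix f assume "f \<in> E" "u \<in> f"
    then have "f \<in> {e, e', g}" using three by auto
    then show "c f \<noteq> n" using E g n by auto
  qed
  define F where "F = {e\<in>E. c e \<in> {n, m}}"
  have deg: "degree F (\<lambda>e. e) x \<le> 2" for x
    unfolding F_def by (rule degree_two_colours[OF opt_good[OF c] n(1) m(1)]) auto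
  have "{f\<in>F. u \<in> f} = {g}"
  proof -
    have "f = g" if "f \<in> F" "u \<in> f" for f
    proof -
      have "f \<in> {e, e', g}" using that three by (auto simp: F_def)
      then show ?thesis using that E n m by (auto simp: F_def)
    qed
    then show ?thesis using g by (auto simp: F_def)
  qed
  then have d1: "degree F (\<lambda>e. e) u = 1" by (simp add: degree_def)
  have finF: "finite F" using finE by (simp add: F_def)
  have two: "e \<in> F \<Longrightarrow> card e = 2" for e using edgeD by (auto simp: F_def)
  obtain xs where xs: "closed_under F (\<lambda>e. e) (set xs)" "2 \<le> length xs" "hd xs = u"
    "\<And>x. x\<in>set xs \<Longrightarrow> x = u \<or> x = last xs \<or> degree F (\<lambda>e. e) x = 2"
    using chain_exists[OF finF two deg d1] by blast
  have uxs: "u \<in> set xs" using xs(2,3) by (cases xs) auto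
  \<comment> \<open>Missing \<open>m\<close>, the vertex \<open>w\<close> meets at most one edge of
    the chain colours, so it is not interior.\<close>
  have *: "w = last xs" if "{u, w} \<in> E" "c {u, w} = 0" "w \<noteq> u" "miss c w m" for w
  proof -
    have "w \<in> set xs"
      using opt_no_separation[OF c that(1,2) n(1) m(1) un that(4), of "set xs"] xs(1) uxs
      by (auto simp: F_def)
    moreover have "degree F (\<lambda>e. e) w \<noteq> 2"
    proof
      assume "degree F (\<lambda>e. e) w = 2"
      then obtain f h where fh: "{e\<in>F. w \<in> e} = {f, h}" "f \<noteq> h" by (auto simp: degree_def card_2_iff)
      then have "f \<in> F" "h \<in> F" "w \<in> f" "w \<in> h" by auto
      moreover then have "c f = n" "c h = n" using that(4) by (auto simp: F_def miss_def)
      ultimately show False using goodD[OF opt_good[OF c], of f h w] fh(2) n by (auto simp: F_def)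
    qed
    ultimately show ?thesis using xs(4) that(3) by auto
  qed
  have "v = last xs" by (rule *) (use E v m in auto)
  moreover have "v' = last xs" by (rule *) (use E v' m' \<open>m' = m\<close> in auto)
  ultimately show False using ne v v' by simp
qed

end

section \<open>Rings through uncoloured edges\<close>

lemma path_connected:
  assumes "\<And>g. g \<in> path_edges xs \<Longrightarrow> g \<inter> S \<noteq> {} \<Longrightarrow> g \<subseteq> S" "xs \<noteq> []" "hd xs \<in> S"
  shows "set xs \<subseteq> S"
  using assms
proof (induction xs)
  case (Cons x ys)
  show ?case
  proof (cases "ys = []")
    case False
    have "{x, hd ys} \<subseteq> S"
      by (rule Cons.prems(1)) (use Cons.prems False in \<open>auto simp: path_edges_Cons\<close>)
    moreover have "set ys \<subseteq> S"
      by (rule Cons.IH[OF Cons.prems(1)]) (use False calculation in \<open>auto simp: path_edges_Cons\<close>)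
    ultimately show ?thesis by simp
  qed (use Cons.prems in simp)
qed simp

lemma cyc_neighbour:
  assumes "distinct xs" "3 \<le> length xs" "x \<in> set xs"
  obtains y where "{x, y} \<in> cyc xs"
proof -
  obtain y z where yz: "{e\<in>cyc xs. x \<in> e} = {{x, y}, {x, z}}"
    by (rule cyc_at_vertex[OF assms])
  have "{x, y} \<in> {e\<in>cyc xs. x \<in> e}" unfolding yz by simp
  then show thesis using that by simp
qed

lemma cyc_connected:
  assumes "distinct xs" "3 \<le> length xs" "\<And>g. g \<in> cyc xs \<Longrightarrow> g \<inter> S \<noteq> {} \<Longrightarrow> g \<subseteq> S" "x \<in> set xs" "x \<in> S"
  shows "set xs \<subseteq> S"
proof -
  obtain y where y: "{x, y} \<in> cyc xs" by (rule cyc_neighbour[OF assms(1,2,4)])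
  obtain zs where zs: "set zs = set xs" "length zs = length xs" "cyc zs = cyc xs" "hd zs = x"
    using cyc_arrange[OF assms(1) _ y] assms(2) by auto
  have "set zs \<subseteq> S"
  proof (rule path_connected)
    show "g \<subseteq> S" if "g \<in> path_edges zs" "g \<inter> S \<noteq> {}" for g
      by (rule assms(3)[OF _ that(2)]) (use that(1) zs(3) in \<open>auto simp: cyc_def[of zs]\<close>)
    show "zs \<noteq> []" using zs(2) assms(2) by auto
    show "hd zs \<in> S" using zs(4) assms(5) by simp
  qed
  then show ?thesis using zs by simp
qed

context cubic_graph
begin

text \<open>The value 0 is admitted on the outer edges only for the construction of rings; \<open>ring_outer\<close>
  rules it out for optimal colourings.\<close>

definition ring :: "('v set \<Rightarrow> nat) \<Rightarrow> nat \<Rightarrow> 'v list \<Rightarrow> bool" where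
  "ring c s xs \<longleftrightarrow> distinct xs \<and> odd (length xs) \<and> 3 \<le> length xs \<and> cyc xs \<subseteq> E \<and> s \<in> {1..3} \<and>
    (\<forall>g\<in>cyc xs. c g \<noteq> s) \<and> card {g\<in>cyc xs. c g = 0} = 1 \<and>
    (\<forall>g\<in>E - cyc xs. g \<inter> set xs \<noteq> {} \<longrightarrow> c g \<in> {0, s})"

lemma ringD:
  assumes "ring c s xs"
  shows "distinct xs" "odd (length xs)" "3 \<le> length xs" "2 \<le> length xs" "cyc xs \<subseteq> E" "s \<in> {1..3}" "xs \<noteq> []"
    "\<And>g. g \<in> cyc xs \<Longrightarrow> c g \<noteq> s"
    "\<And>g. g \<in> E \<Longrightarrow> g \<notin> cyc xs \<Longrightarrow> g \<inter> set xs \<noteq> {} \<Longrightarrow> c g \<in> {0, s}"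
    "\<And>g. g \<in> cyc xs \<Longrightarrow> g \<subseteq> set xs"
proof -
  have "3 \<le> length xs" using assms by (simp add: ring_def)
  then show ne: "xs \<noteq> []" by auto
  show "g \<in> cyc xs \<Longrightarrow> g \<subseteq> set xs" for g by (rule cyc_subset[OF ne])
qed (use assms in \<open>auto simp: ring_def\<close>)

lemma ring_unique_zero:
  assumes "ring c s xs" "e \<in> cyc xs" "f \<in> cyc xs" "c e = 0" "c f = 0"
  shows "e = f"
proof -
  have "card {g\<in>cyc xs. c g = 0} = 1" using assms(1) by (simp add: ring_def)
  then obtain h where "{g\<in>cyc xs. c g = 0} = {h}" by (auto simp: card_1_singleton_iff)
  then show ?thesis using assms by blast
qed

lemma ring_vertex:
  assumes "ring c s xs" "x \<in> set xs"
  shows "x \<in> V"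
proof -
  obtain y where "{x, y} \<in> cyc xs"
    by (rule cyc_neighbour[OF ringD(1,3)[OF assms(1)] assms(2)])
  then have "{x, y} \<in> E" using ringD(5)[OF assms(1)] by blast
  then show ?thesis by (rule edge_V)
qed

lemma ring_at:
  assumes "ring c s xs" "x \<in> set xs"
  obtains y z g where "{e\<in>E. x \<in> e} = {{x, y}, {x, z}, g}" "{e\<in>cyc xs. x \<in> e} = {{x, y}, {x, z}}"
    "x \<noteq> y" "x \<noteq> z" "y \<noteq> z" "y \<in> set xs" "z \<in> set xs" "g \<notin> cyc xs" "g \<in> E" "x \<in> g"
proof -
  obtain y z where yz: "{e\<in>cyc xs. x \<in> e} = {{x, y}, {x, z}}" "x \<noteq> y" "x \<noteq> z" "y \<noteq> z"
    "y \<in> set xs" "z \<in> set xs"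
    by (rule cyc_at_vertex[OF ringD(1,3)[OF assms(1)] assms(2)])
  let ?D = "{e\<in>E. x \<in> e}" and ?C = "{e\<in>cyc xs. x \<in> e}"
  have "card ?C = 2" using yz by (simp add: doubleton_eq_iff)
  moreover have sub: "?C \<subseteq> ?D" using ringD(5)[OF assms(1)] by auto
  moreover have "finite ?C" using yz(1) by simp
  ultimately have "card (?D - ?C) = 1"
    using cubic[OF ring_vertex[OF assms]] by (simp add: card_Diff_subset)
  then obtain g where g: "?D - ?C = {g}" by (auto simp: card_1_singleton_iff)
  have "?D = ?C \<union> (?D - ?C)" using sub by blast
  also have "\<dots> = {{x, y}, {x, z}} \<union> {g}" by (rule arg_cong2[where f = "(\<union>)", OF yz(1) g])
  also have "\<dots> = {{x, y}, {x, z}, g}" by blast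
  finally have "?D = {{x, y}, {x, z}, g}" .
  moreover have "g \<in> ?D - ?C" unfolding g by simp
  then have "g \<notin> cyc xs" "g \<in> E" "x \<in> g" by auto
  ultimately show thesis by (rule that[OF _ yz])
qed

text \<open>Edges leaving the ring avoid \<open>a\<close> and \<open>b\<close>, so the ring can be
  recoloured independently of the rest. Without \<open>{x, y}\<close> the odd cycle is a path with
  an even number of edges; painted alternately from \<open>x\<close>, it shows \<open>a\<close> but
  not \<open>b\<close> at \<open>x\<close>, and \<open>b\<close> but not \<open>a\<close> at
  \<open>y\<close>.\<close>

lemma repaint:
  assumes c: "opt c" and r: "ring c s xs" and xy: "{x, y} \<in> cyc xs" and ab: "cols a b s"
  obtains c' where "opt c'" "ring c' s xs" "\<And>e. e \<notin> cyc xs \<Longrightarrow> c' e = c e" "c' {x, y} = 0"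
    "miss c' x b" "miss c' y a"
proof -
  obtain zs where zs: "distinct zs" "set zs = set xs" "length zs = length xs" "cyc zs = cyc xs"
    "hd zs = x" "last zs = y" by (rule cyc_arrange[OF ringD(1,4)[OF r] xy])
  define c' where "c' = (paint a b zs c)({x, y} := 0)"
  have abs: "a \<noteq> b" "a \<noteq> 0" "b \<noteq> 0" "s \<noteq> 0" "a \<noteq> s" "b \<noteq> s" "a \<le> 3" "b \<le> 3" using ab by (auto simp: cols_def)
  have cz: "cyc xs = insert {x, y} (path_edges zs)" using zs by (simp add: cyc_def insert_commute flip: zs(4))
  \<comment> \<open>As first and as last edge of the path, this edge would be painted
    \<open>a\<close> and \<open>b\<close> at once.\<close>
  have ends: "{x, y} \<notin> path_edges zs"
  proof
    assume "{x, y} \<in> path_edges zs"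
    then have "paint a b zs c {x, y} = a" "paint a b zs c {x, y} = b"
      using paint_hd[of zs "{x, y}" a b c] paint_last[of zs "{x, y}" a b c] zs ringD(2)[OF r] by simp_all
    then show False using abs by simp
  qed
  have out: "c' e = c e" if "e \<notin> cyc xs" for e
    using that paint_outside[of e zs] cz by (auto simp: c'_def)
  have xy0: "c' {x, y} = 0" by (simp add: c'_def)
  have path: "c' e = paint a b zs c e" if "e \<in> path_edges zs" for e
    using that ends by (auto simp: c'_def)
  have rng: "c' e \<in> {0, a, b}" if "e \<in> cyc xs" for e
    using that paint_range[of e zs a b c] path cz xy0 by auto
  have zero: "{g\<in>cyc xs. c' g = 0} = {{x, y}}"
    using cz paint_range[of _ zs a b c] path xy0 abs by fastforce
  have good': "good c'"
    unfolding partial_colouring_def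
  proof (intro conjI ballI impI)
    fix e assume e: "e \<in> E"
    show "c' e \<le> 3"
    proof (cases "e \<in> cyc xs")
      case True then show ?thesis using rng[of e] abs by auto
    next
      case False then show ?thesis using out good_le[OF opt_good[OF c] e] by simp
    qed
    fix f assume f: "f \<in> E" and ef: "e \<noteq> f \<and> e \<inter> f \<noteq> {} \<and> c' e = c' f"
    \<comment> \<open>Ring edges have values among \<open>0, a, b\<close> and edges leaving the ring
      among \<open>0, s\<close>, so only 0 can coincide.\<close>
    have mixed: "c' g = 0" if "g \<in> cyc xs" "h \<notin> cyc xs" "h \<in> E" "g \<inter> h \<noteq> {}" "c' g = c' h" for g h
    proof -
      have "h \<inter> set xs \<noteq> {}" using ringD(10)[OF r that(1)] that(4) by blast
      then have "c' h \<in> {0, s}" using ringD(9)[OF r that(3,2)] out[OF that(2)] by simp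
      then show ?thesis using rng[OF that(1)] that(5) abs by auto
    qed
    show "c' e = 0"
    proof (cases "e \<in> cyc xs"; cases "f \<in> cyc xs")
      assume ef': "e \<in> cyc xs" "f \<in> cyc xs"
      show ?thesis
      proof (cases "e = {x, y} \<or> f = {x, y}")
        case True then show ?thesis using ef xy0 by auto
      next
        case False
        then have "e \<in> path_edges zs" "f \<in> path_edges zs" using ef' cz by auto
        then show ?thesis using paint_proper[OF zs(1) abs(1), of e f c] path ef by simp
      qed
    next
      assume "e \<in> cyc xs" "f \<notin> cyc xs"
      then show ?thesis using mixed[of e f] f ef by blast
    next
      assume "e \<notin> cyc xs" "f \<in> cyc xs"
      then show ?thesis using mixed[of f e] e ef by (simp add: Int_commute)
    next
      assume "e \<notin> cyc xs" "f \<notin> cyc xs"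
      then have "c' e = c e" "c' f = c f" by (simp_all add: out)
      moreover then have "c e = c f" using ef by simp
      moreover obtain w where "w \<in> e" "w \<in> f" using ef by blast
      ultimately show ?thesis using goodD[OF opt_good[OF c] e f] ef by metis
    qed
  qed
  have U: "unc c' = (unc c - cyc xs) \<union> {g\<in>cyc xs. c' g = 0}"
    using out ringD(5)[OF r] by (auto simp: uncoloured_def)
  have U0: "unc c = (unc c - cyc xs) \<union> {g\<in>cyc xs. c g = 0}"
    using ringD(5)[OF r] by (auto simp: uncoloured_def)
  have fin: "finite (unc c)" "finite (cyc xs)"
    using finE ringD(5)[OF r] finite_subset by (auto simp: uncoloured_def)
  have "card {g\<in>cyc xs. c g = 0} = 1" using r by (simp add: ring_def)
  then have "card (unc c) = card (unc c - cyc xs) + 1"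
    by (subst U0, subst card_Un_disjoint) (use fin in auto)
  moreover have "card (unc c') = card (unc c - cyc xs) + 1"
    unfolding U zero by (subst card_Un_disjoint) (use fin xy in auto)
  ultimately have "card (unc c') = card (unc c)" by simp
  with opt_cong[OF c good'] have opt': "opt c'" by simp
  have ring': "ring c' s xs"
    unfolding ring_def zero
  proof (intro conjI ballI impI)
    show "c' g \<noteq> s" if "g \<in> cyc xs" for g using rng[OF that] abs by auto
    show "c' g \<in> {0, s}" if "g \<in> E - cyc xs" "g \<inter> set xs \<noteq> {}" for g
      using ringD(9)[OF r _ _ that(2)] that(1) out by simp
  qed (use ringD[OF r] in auto)
  have nz: "xs \<noteq> []" "x \<in> set xs" "y \<in> set xs" using ringD(10)[OF r xy] ringD(7)[OF r] by auto
  have at: "c' g \<noteq> k" if g: "g \<in> E" "w \<in> g" "w \<in> set xs" and k: "k \<in> {a, b}"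
    and *: "g \<in> path_edges zs \<Longrightarrow> paint a b zs c g \<noteq> k" for g w k
  proof (cases "g \<in> cyc xs")
    case True
    then consider "g = {x, y}" | "g \<in> path_edges zs" using cz by blast
    then show ?thesis
    proof cases
      case 1 then show ?thesis using xy0 k abs by auto
    next
      case 2 then show ?thesis using *[OF 2] path[OF 2] by simp
    qed
  next
    case False
    then have "c g \<in> {0, s}" using ringD(9)[OF r g(1)] g by blast
    then show ?thesis using out False k abs by auto
  qed
  have "miss c' x b"
    unfolding miss_def
  proof (intro ballI impI)
    fix g assume g: "g \<in> E" "x \<in> g"
    have "paint a b zs c g = a" if "g \<in> path_edges zs"
      using paint_hd[OF zs(1) that] zs(5) g(2) by simp
    then show "c' g \<noteq> b" using at[OF g nz(2), of b] abs by simp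
  qed
  moreover have "miss c' y a"
    unfolding miss_def
  proof (intro ballI impI)
    fix g assume g: "g \<in> E" "y \<in> g"
    have "paint a b zs c g = b" if "g \<in> path_edges zs"
      using paint_last[OF zs(1) that] zs(3,6) g(2) ringD(2)[OF r] by simp
    then show "c' g \<noteq> a" using at[OF g nz(3), of a] abs by simp
  qed
  ultimately show thesis using that opt' ring' out xy0 by blast
qed

text \<open>The uncoloured edge of the ring can be moved to \<open>x\<close>. If the outer edge at
  \<open>x\<close> were uncoloured as well, two uncoloured edges would share a vertex.\<close>

lemma ring_outer:
  assumes c: "opt c" and r: "ring c s xs" and g: "g \<in> E" "g \<notin> cyc xs" "x \<in> g" "x \<in> set xs"
  shows "c g = s"
proof (rule ccontr)
  assume "c g \<noteq> s"
  then have g0: "c g = 0" using ringD(9)[OF r g(1,2)] g by auto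
  obtain y where y: "{x, y} \<in> cyc xs" by (rule cyc_neighbour[OF ringD(1,3)[OF r] g(4)])
  obtain a b where "cols a b s" using cols_others ringD(6)[OF r] by blast
  from repaint[OF c r y this] obtain c' where c': "opt c'" "\<And>e. e \<notin> cyc xs \<Longrightarrow> c' e = c e" "c' {x, y} = 0"
    by blast
  have "{x, y} \<in> unc c'" using c'(3) y ringD(5)[OF r] by (auto simp: uncoloured_def)
  moreover have "g \<in> unc c'" using c'(2) g g0 by (simp add: uncoloured_def)
  ultimately have "g = {x, y}" using unc_matching[OF c'(1) _ g(3)] by blast
  then show False using y g(2) by simp
qed

text \<open>Uncoloured edges form a matching, so the two other edges at \<open>u\<close> are
  coloured; with \<open>a\<close> missing there, they carry the two remaining colours.\<close>

lemma unc_vertex: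
  assumes c: "opt c" and e: "e \<in> unc c" "u \<in> e" and m: "miss c u a" and s: "cols a b s"
  obtains g h where "{e\<in>E. u \<in> e} = {e, g, h}" "c g = b" "c h = s" "g \<noteq> h"
proof -
  have eE: "e \<in> E" "c e = 0" using e by (auto simp: uncoloured_def)
  then have "u \<in> V" using edgeD e(2) by blast
  then obtain f1 f2 f3 where f: "{e\<in>E. u \<in> e} = {f1, f2, f3}" "f1 \<noteq> f2" "f1 \<noteq> f3" "f2 \<noteq> f3"
    by (rule three_edges)
  have "e \<in> {f1, f2, f3}" using eE e(2) by (simp flip: f(1))
  then obtain g h where gh: "{e\<in>E. u \<in> e} = {e, g, h}" "e \<noteq> g" "e \<noteq> h" "g \<noteq> h"
    using f by (elim insertE emptyE) (auto simp: insert_commute)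
  have col: "c k = b \<or> c k = s" if "k \<in> {g, h}" for k
  proof -
    have k: "k \<in> E" "u \<in> k" "k \<noteq> e" using that gh by blast+
    have "c k \<noteq> 0" using unc_matching[OF c e, of k] k by (auto simp: uncoloured_def)
    moreover have "c k \<noteq> a" using m k by (auto simp: miss_def)
    ultimately show ?thesis using cols_le_cases[OF s good_le[OF opt_good[OF c] k(1)]] by auto
  qed
  have "c g \<noteq> c h"
  proof
    assume eq: "c g = c h"
    have "c g = 0" by (rule goodD[OF opt_good[OF c], of g h u]) (use gh eq in blast)+
    then show False using col[of g] s by (auto simp: cols_def)
  qed
  then consider "c g = b" "c h = s" | "c g = s" "c h = b" using col[of g] col[of h] by auto
  then show thesis
  proof cases
    case 1 then show ?thesis using that gh by blast
  next
    case 2 then show ?thesis using that[of h g] gh by (simp add: insert_commute)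
  qed
qed

text \<open>The ends of \<open>e\<close> miss different colours \<open>a\<close> and
  \<open>b\<close>, and the chain of these colours from one end reaches the other. It starts with
  \<open>b\<close> and ends with \<open>a\<close>, so it has an even number of edges, and
  \<open>e\<close> closes it to an odd cycle whose type is the third colour.\<close>

lemma ring_exists:
  assumes c: "opt c" and e: "e \<in> unc c"
  obtains s xs where "ring c s xs" "e \<in> cyc xs"
proof -
  have eE: "e \<in> E" "c e = 0" using e by (auto simp: uncoloured_def)
  then obtain u v where uv: "e = {u, v}" "u \<noteq> v" using edgeD[of e] by (auto simp: card_2_iff)
  have V: "u \<in> V" "v \<in> V" using edge_V eE uv by auto
  obtain a where a: "a \<in> {1..3}" "miss c u a" using misses_some[OF V(1) e] uv by auto
  obtain b where b: "b \<in> {1..3}" "miss c v b" using misses_some[OF V(2) e] uv by auto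
  have "a \<noteq> b" using opt_no_common[OF c, of u v a] a b eE uv by auto
  then obtain s where s: "cols a b s" using cols_third a b by blast
  define F where "F = {g\<in>E. c g \<in> {a, b}}"
  have finF: "finite F" using finE by (simp add: F_def)
  have two: "g \<in> F \<Longrightarrow> card g = 2" for g using edgeD by (auto simp: F_def)
  have deg: "degree F (\<lambda>e. e) x \<le> 2" for x
    unfolding F_def by (rule degree_two_colours[OF opt_good[OF c] a(1) b(1)]) auto
  have deg1: "degree F (\<lambda>e. e) w = 1" if w: "w \<in> e" "miss c w p" "cols p q s" "{p, q} = {a, b}" for w p q
  proof -
    obtain g h where gh: "{e\<in>E. w \<in> e} = {e, g, h}" "c g = q" "c h = s"
      by (rule unc_vertex[OF c e w(1-3)])
    have F': "F = {f\<in>E. c f \<in> {p, q}}" using w(4) by (simp add: F_def)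
    have "{f\<in>F. w \<in> f} = {f\<in>{e\<in>E. w \<in> e}. c f \<in> {p, q}}" unfolding F' by blast
    also have "\<dots> = {g}" unfolding gh(1) using gh(2,3) eE w(3) by (auto simp: cols_def)
    finally show ?thesis by (simp add: degree_def)
  qed
  have du: "degree F (\<lambda>e. e) u = 1" using deg1[of u a b] a s uv by auto
  have dv: "degree F (\<lambda>e. e) v = 1" using deg1[of v b a] b cols_swap(1)[OF s] uv by auto
  obtain xs where xs: "distinct xs" "2 \<le> length xs" "hd xs = u"
    "\<And>i. Suc i < length xs \<Longrightarrow> \<exists>e\<in>F. e = {xs ! i, xs ! Suc i}"
    "closed_under F (\<lambda>e. e) (set xs)"
    "\<And>x. x\<in>set xs \<Longrightarrow> x = u \<or> x = last xs \<or> degree F (\<lambda>e. e) x = 2"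
    using chain_exists[OF finF two deg du] by blast
  have ne: "xs \<noteq> []" using xs(2) by auto
  have uxs: "u \<in> set xs" using xs(3) ne by auto
  have vxs: "v \<in> set xs"
    using opt_no_separation[OF c _ _ a(1) b(1) a(2) b(2), of "set xs"] eE uv uxs xs(5) by (auto simp: F_def)
  have last: "last xs = v" using xs(6)[OF vxs] dv uv by auto
  have inF: "{xs ! i, xs ! Suc i} \<in> F" if "Suc i < length xs" for i using xs(4)[OF that] by auto
  have alt: "c {xs ! i, xs ! Suc i} = (if even i then b else a)" if "Suc i < length xs" for i
    using that
  proof (induction i)
    case 0
    have "xs ! 0 = u" using xs(3) ne by (simp add: hd_conv_nth)
    then have "c {xs ! 0, xs ! Suc 0} \<noteq> a" using inF[OF 0] a by (auto simp: miss_def F_def)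
    then show ?case using inF[OF 0] by (auto simp: F_def)
  next
    case (Suc i)
    let ?g = "{xs ! i, xs ! Suc i}" and ?h = "{xs ! Suc i, xs ! Suc (Suc i)}"
    have gh: "?g \<in> F" "?h \<in> F" using inF Suc.prems by auto
    have "xs ! i \<noteq> xs ! Suc (Suc i)" "xs ! i \<noteq> xs ! Suc i"
      using xs(1) Suc.prems by (simp_all add: nth_eq_iff_index_eq)
    then have "?g \<noteq> ?h" by blast
    have "c ?g \<noteq> c ?h"
    proof
      assume "c ?g = c ?h"
      then have "c ?g = 0"
        using goodD[OF opt_good[OF c] _ _ \<open>?g \<noteq> ?h\<close>, of "xs ! Suc i"] gh unfolding F_def by simp
      then show False using gh(1) a(1) b(1) unfolding F_def by simp
    qed
    then show ?case using Suc.IH Suc.prems gh by (auto simp: F_def)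
  qed
  have odd: "odd (length xs)"
  proof
    assume ev: "even (length xs)"
    let ?i = "length xs - 2"
    have i: "Suc ?i < length xs" "even ?i" "xs ! Suc ?i = v"
      using xs(2) ev last ne by (auto simp: last_conv_nth Suc_diff_Suc numeral_2_eq_2)
    then have "c {xs ! ?i, v} = b" using alt[OF i(1)] by simp
    then show False using b(2) inF[OF i(1)] i(3) by (auto simp: miss_def F_def)
  qed
  have len: "3 \<le> length xs" using odd xs(2) by (cases "length xs = 2") auto
  have cz: "cyc xs = insert e (path_edges xs)" using last xs(3) uv by (simp add: cyc_def insert_commute)
  have pF: "path_edges xs \<subseteq> F" using inF by (auto simp: path_edges_conv_nth)
  \<comment> \<open>The cycle edges other than \<open>e\<close> already exhaust the degree of
    \<open>x\<close> in \<open>F\<close>, so no further edge at \<open>x\<close> has colour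
    \<open>a\<close> or \<open>b\<close>.\<close>
  have outer: "c g \<in> {0, s}" if g: "g \<in> E" "g \<notin> cyc xs" "x \<in> g" "x \<in> set xs" for g x
  proof (rule ccontr)
    assume "c g \<notin> {0, s}"
    then have gF: "g \<in> F" using cols_le_cases[OF s good_le[OF opt_good[OF c] g(1)]] g(1) by (auto simp: F_def)
    obtain y z where yz: "{e\<in>cyc xs. x \<in> e} = {{x, y}, {x, z}}" "x \<noteq> y" "x \<noteq> z" "y \<noteq> z"
      by (rule cyc_at_vertex[OF xs(1) len g(4)])
    let ?A = "{e\<in>cyc xs. x \<in> e} - {e}"
    have c2: "card {e\<in>cyc xs. x \<in> e} = 2" using yz by (simp add: doubleton_eq_iff)
    have "degree F (\<lambda>e. e) x \<le> card ?A"
    proof (cases "x \<in> e")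
      case True
      then have "e \<in> {e\<in>cyc xs. x \<in> e}" using cz by auto
      then have "card ?A = 1" using c2 by simp
      then show ?thesis using True uv du dv by auto
    next
      case False
      then have "?A = {e\<in>cyc xs. x \<in> e}" by auto
      then show ?thesis using c2 deg[of x] by simp
    qed
    moreover have "?A \<subseteq> {f\<in>F. x \<in> f}" using cz pF by auto
    ultimately have "?A = {f\<in>F. x \<in> f}"
      using finF by (intro card_seteq) (auto simp: degree_def)
    then show False using gF g by blast
  qed
  have "ring c s xs"
    unfolding ring_def
  proof (intro conjI ballI impI)
    show "distinct xs" "odd (length xs)" "3 \<le> length xs" by (fact xs(1) odd len)+
    show "cyc xs \<subseteq> E" using cz pF eE by (auto simp: F_def)
    show "s \<in> {1..3}" using s by (simp add: cols_def)
    have pc: "c g \<in> {a, b}" if "g \<in> path_edges xs" for g using that pF by (auto simp: F_def)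
    show "c g \<noteq> s" if "g \<in> cyc xs" for g
    proof (cases "g = e")
      case True then show ?thesis using eE s by (simp add: cols_def)
    next
      case False
      then show ?thesis using pc[of g] that cz s by (auto simp: cols_def)
    qed
    have "g = e" if "g \<in> cyc xs" "c g = 0" for g
      using pc[of g] that cz s by (auto simp: cols_def)
    then have "{g \<in> cyc xs. c g = 0} = {e}" using cz eE by blast
    then show "card {g \<in> cyc xs. c g = 0} = 1" by simp
    show "c g \<in> {0, s}" if "g \<in> E - cyc xs" "g \<inter> set xs \<noteq> {}" for g using outer that by blast
  qed
  then show thesis using that cz by blast
qed

lemma ring_cong:
  assumes "ring c s xs" "\<And>g. g \<in> E \<Longrightarrow> g \<inter> set xs \<noteq> {} \<Longrightarrow> c' g = c g"
  shows "ring c' s xs"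
proof -
  have "g \<inter> set xs \<noteq> {}" if "g \<in> cyc xs" for g
  proof -
    have "g \<in> E" using that ringD(5)[OF assms(1)] by blast
    then have "g \<noteq> {}" using edgeD by fastforce
    then show ?thesis using ringD(10)[OF assms(1) that] by blast
  qed
  then have eq: "c' g = c g" if "g \<in> cyc xs" for g
    using that assms(2) ringD(5)[OF assms(1)] by blast
  then have "{g \<in> cyc xs. c' g = 0} = {g \<in> cyc xs. c g = 0}" by auto
  then show ?thesis using assms eq unfolding ring_def by auto
qed

text \<open>For equal types, the edges of one ring at a shared vertex do not have colour
  \<open>s\<close> and so belong to the other ring; following them gives one ring two uncoloured
  edges. For different types, \<open>ys\<close> is followed from an end of its uncoloured edge to
  its first vertex on \<open>xs\<close>, and a repainting of \<open>xs\<close> stops the chain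
  there, which separates the ends of that uncoloured edge.\<close>

lemma rings_disjoint:
  assumes c: "opt c" and r: "ring c s xs" and q: "ring c t ys"
    and e: "e \<in> cyc xs" "c e = 0" and f: "f \<in> cyc ys" "c f = 0" and ef: "e \<noteq> f"
  shows "set xs \<inter> set ys = {}"
proof (cases "s = t")
  case True
  show ?thesis
  proof (rule ccontr)
    assume "set xs \<inter> set ys \<noteq> {}"
    then obtain x where x: "x \<in> set xs" "x \<in> set ys" by blast
    have sub: "g \<in> cyc ys" if "g \<in> cyc xs" "w \<in> g" "w \<in> set ys" for g w
      using ring_outer[OF c q _ _ that(2,3)] that(1) ringD(5,8)[OF r] True by blast
    have "set xs \<subseteq> set ys"
      by (rule cyc_connected[OF ringD(1,3)[OF r] _ x]) (use sub ringD(10)[OF q] in blast)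
    moreover obtain w where "w \<in> e" "w \<in> set xs"
      using ringD(5,10)[OF r] e(1) edgeD[of e] by (metis card_2_iff insertI1 subsetD)
    ultimately have "e \<in> cyc ys" using sub e by blast
    then show False using ring_unique_zero[OF q _ f(1) e(2) f(2)] ef by simp
  qed
next
  case False
  obtain b where b: "cols t b s"
    using cols_third[of t s] False ringD(6)[OF r] ringD(6)[OF q] cols_swap by blast
  then have bs: "b \<in> {1..3}" "s \<in> {1..3}" "t \<in> {1..3}" "b \<noteq> s" "b \<noteq> t" "s \<noteq> t" by (auto simp: cols_def)
  have fE: "f \<in> E" using f ringD(5)[OF q] by blast
  then obtain z w where zw: "f = {z, w}" "z \<noteq> w" using edgeD[of f] by (auto simp: card_2_iff)
  have fx: "f \<notin> cyc xs" using ring_unique_zero[OF r e(1)] e f ef by blast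
  have out: "z \<notin> set xs" "w \<notin> set xs"
    using ring_outer[OF c r fE fx] zw f bs by auto
  obtain zs where zs: "distinct zs" "set zs = set ys" "length zs = length ys" "cyc zs = cyc ys"
    "hd zs = z" "last zs = w" using cyc_arrange[OF ringD(1,4)[OF q]] f zw by metis
  have ne: "zs \<noteq> []" and len: "3 \<le> length zs" using zs ringD(3)[OF q] by auto
  have cz: "cyc ys = insert f (path_edges zs)" using zs zw by (simp add: cyc_def insert_commute flip: zs(4))
  show ?thesis
  proof (rule ccontr)
    assume "set xs \<inter> set ys \<noteq> {}"
    then obtain k where k: "k < length zs" "zs ! k \<in> set xs" using zs(2) by (metis disjoint_iff in_set_conv_nth)
    \<comment> \<open>Vertices before this first meeting see no change when \<open>xs\<close> is
      repainted.\<close>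
    define j where "j = (LEAST k. k < length zs \<and> zs ! k \<in> set xs)"
    have j: "j < length zs" "zs ! j \<in> set xs"
      using LeastI[of "\<lambda>k. k < length zs \<and> zs ! k \<in> set xs" k] k unfolding j_def by auto
    have before: "zs ! i \<notin> set xs" if "i < j" for i
      using not_less_Least[of i "\<lambda>k. k < length zs \<and> zs ! k \<in> set xs"] that j(1) unfolding j_def by auto
    define x where "x = zs ! j"
    have "j \<noteq> 0" using j out zs(5) ne by (metis hd_conv_nth)
    have "j \<noteq> length zs - 1" using j out zs(6) ne by (metis last_conv_nth)
    have "x \<in> set xs" using j by (simp add: x_def)
    then obtain y where y: "{x, y} \<in> cyc xs" by (rule cyc_neighbour[OF ringD(1,3)[OF r]])
    \<comment> \<open>With \<open>b\<close> missing at \<open>x\<close>, the chain of colours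
      \<open>s\<close> and \<open>b\<close> that starts in \<open>z\<close> ends at \<open>x\<close>
      and cannot run on to \<open>w\<close>.\<close>
    obtain c' where c': "opt c'" "\<And>e. e \<notin> cyc xs \<Longrightarrow> c' e = c e" "miss c' x b"
      using repaint[OF c r y b] by blast
    have off: "c' g = c g" if "v \<in> g" "v \<notin> set xs" for g v
      using c'(2) ringD(10)[OF r] that by blast
    define K where "K = {zs ! i |i. i \<le> j}"
    have K: "v \<in> K \<longleftrightarrow> (\<exists>i\<le>j. v = zs ! i)" for v by (auto simp: K_def)
    define h where "h = {zs ! (j - 1), zs ! j}"
    have h: "h \<in> E" "c' h = s" "x \<in> h" "h \<subseteq> K"
    proof -
      have "h \<in> path_edges zs" using \<open>j \<noteq> 0\<close> j by (auto simp: h_def path_edges_conv_nth intro!: exI[of _ "j - 1"])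
      then show "h \<in> E" using cz ringD(5)[OF q] by auto
      have "h \<notin> cyc xs" using before[of "j - 1"] \<open>j \<noteq> 0\<close> ringD(10)[OF r] by (auto simp: h_def)
      then show "c' h = s" using ring_outer[OF c r \<open>h \<in> E\<close>, of x] c'(2) j by (simp add: h_def x_def)
      show "x \<in> h" by (simp add: h_def x_def)
      show "h \<subseteq> K" using K by (auto simp: h_def intro: exI[of _ j] exI[of _ "j - 1"])
    qed
    have closed: "chain_closed c' s b K"
      unfolding closed_under_def
    proof (intro ballI impI)
      fix g assume g: "g \<in> {e\<in>E. c' e \<in> {s, b}}" and "g \<inter> K \<noteq> {}"
      then obtain i where i: "i \<le> j" "zs ! i \<in> g" using K by auto
      show "g \<subseteq> K"
      proof (cases "i = j")
        case True
        have "c' g = s" using g c'(3) i True by (auto simp: miss_def x_def)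
        then have "g = h"
          using goodD[OF opt_good[OF c'(1)], of g h x] g h i True bs by (auto simp: x_def)
        then show ?thesis using h by simp
      next
        case False
        then have gc: "c g \<in> {s, b}" using off[OF i(2)] before[of i] i(1) g by auto
        have "zs ! i \<in> set ys" using i(1) j(1) by (simp flip: zs(2))
        then have "g \<in> cyc ys" using ring_outer[OF c q _ _ i(2)] g gc bs by auto
        moreover have "g \<noteq> f" using f gc bs by auto
        ultimately obtain k where k: "Suc k < length zs" "g = {zs ! k, zs ! Suc k}"
          using cz by (auto simp: path_edges_conv_nth)
        then have "i = k \<or> i = Suc k" using i zs(1) j(1) by (auto simp: nth_eq_iff_index_eq)
        then have "k \<le> j" "Suc k \<le> j" using i(1) False by auto
        then have "zs ! k \<in> K" "zs ! Suc k \<in> K" using K by blast+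
        then show ?thesis using k(2) by simp
      qed
    qed
    have zK: "z \<in> K" using K zs(5) ne by (metis hd_conv_nth le0)
    have wK: "w \<notin> K"
    proof
      assume "w \<in> K"
      then obtain i where "i \<le> j" "zs ! (length zs - 1) = zs ! i" using K zs(6) ne by (metis last_conv_nth)
      then show False using zs(1) j(1) \<open>j \<noteq> length zs - 1\<close> ne by (auto simp: nth_eq_iff_index_eq)
    qed
    have f': "{z, w} \<in> E" "c' {z, w} = 0" using fE f off[of z f] out zw by auto
    \<comment> \<open>Both ends of \<open>f\<close> keep an edge of colour \<open>t\<close>, so the
      missing colour is one of the two that alternate on \<open>ys\<close>.\<close>
    have miss: "\<exists>m\<in>{s, b}. miss c' v m" if v: "v \<in> f" for v
    proof -
      have vys: "v \<in> set ys" using v ringD(10)[OF q f(1)] by blast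
      have "f \<in> unc c'" using f' zw by (simp add: uncoloured_def)
      then obtain m where m: "m \<in> {1..3}" "miss c' v m" using misses_some[of v f] v ring_vertex[OF q vys] by blast
      obtain g where g: "g \<notin> cyc ys" "g \<in> E" "v \<in> g" by (rule ring_at[OF q vys])
      then have "c g = t" using ring_outer[OF c q] vys by blast
      then have "c' g = t" using off[OF g(3)] v zw out by auto
      then have "m \<noteq> t" using m g by (auto simp: miss_def)
      then show ?thesis using m cols_cases[OF b m(1)] by blast
    qed
    obtain m where m: "m \<in> {s, b}" "miss c' z m" using miss[of z] zw by auto
    obtain n where n: "n \<in> {s, b}" "miss c' w n" using miss[of w] zw by auto
    have "m \<noteq> n" using opt_no_common[OF c'(1) f', of m] m n bs by auto
    then have "{m, n} = {s, b}" using m n by auto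
    then have "chain_closed c' m n K" using closed by simp
    then show False using opt_no_separation[OF c'(1) f' _ _ m(2) n(2) _ zK wK] m n bs by auto
  qed
qed


section \<open>Thinning a colour class by shifts between rings\<close>

abbreviation colour_class :: "('v set \<Rightarrow> nat) \<Rightarrow> nat \<Rightarrow> 'v set set" where
  "colour_class c s \<equiv> {e\<in>E. c e = s}"

lemma repaint_class:
  assumes "ring c s xs" "ring c' s xs" "\<And>e. e \<notin> cyc xs \<Longrightarrow> c' e = c e"
  shows "colour_class c' s = colour_class c s"
proof -
  have "c' e = s \<longleftrightarrow> c e = s" for e
    using ringD(8)[OF assms(1), of e] ringD(8)[OF assms(2), of e] assms(3)[of e] by (cases "e \<in> cyc xs") auto
  then show ?thesis by simp
qed

lemma repaint_missing:
  assumes "opt c" "ring c s xs" "x \<in> set xs" "cols a b s"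
  obtains c' where "opt c'" "ring c' s xs" "\<And>e. e \<notin> cyc xs \<Longrightarrow> c' e = c e" "miss c' x b"
proof -
  obtain y where "{x, y} \<in> cyc xs" by (rule cyc_neighbour[OF ringD(1,3)[OF assms(2)] assms(3)])
  from repaint[OF assms(1,2) this assms(4)] that show thesis by blast
qed

lemma ring_other:
  assumes "ring c s xs" "set xs \<inter> set ys = {}" "\<And>e. e \<notin> cyc ys \<Longrightarrow> c' e = c e" "ys \<noteq> []"
  shows "ring c' s xs"
proof (rule ring_cong[OF assms(1)])
  fix g assume "g \<in> E" "g \<inter> set xs \<noteq> {}"
  then have "g \<notin> cyc ys" using cyc_subset[OF assms(4), of g] assms(2) by blast
  then show "c' g = c g" by (rule assms(3))
qed

lemma miss_cong:
  assumes "miss c x k" "\<And>e. e \<in> E \<Longrightarrow> x \<in> e \<Longrightarrow> c' e = c e"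
  shows "miss c' x k"
  using assms by (simp add: miss_def)

lemma miss_other:
  assumes "miss c x k" "x \<notin> set ys" "\<And>e. e \<notin> cyc ys \<Longrightarrow> c' e = c e" "ys \<noteq> []"
  shows "miss c' x k"
proof (rule miss_cong[OF assms(1)])
  fix e assume "x \<in> e"
  then have "e \<notin> cyc ys" using cyc_subset[OF assms(4)] assms(2) by blast
  then show "c' e = c e" by (rule assms(3))
qed

text \<open>Once both ends of \<open>g\<close> miss \<open>p\<close>, the edge \<open>g\<close> by
  itself is a chain of the colours \<open>s\<close> and \<open>p\<close>, so it can take colour
  \<open>p\<close>. The last conclusion localises the change, which lets shifts on disjoint pairs of
  rings be combined.\<close>

lemma shift:
  assumes c: "opt c" and r: "ring c s xs" and q: "ring c s ys" and dis: "set xs \<inter> set ys = {}"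
    and g: "g \<in> E" "g \<inter> set xs \<noteq> {}" "g \<inter> set ys \<noteq> {}"
  obtains c' where "opt c'" "card (colour_class c' s) + 1 = card (colour_class c s)"
    "\<And>e. e \<in> E \<Longrightarrow> \<not> e \<subseteq> set xs \<union> set ys \<Longrightarrow> c' e = c e"
proof -
  obtain x x' where x: "x \<in> g" "x \<in> set xs" and x': "x' \<in> g" "x' \<in> set ys" using g by blast
  have nx: "x \<notin> set ys" "x' \<notin> set xs" using x x' dis by auto
  obtain w where "g = {x, w}" "x \<noteq> w" by (rule edge_other[OF g(1) x(1)])
  then have gx: "g = {x, x'}" using x x' dis by auto
  have gc: "g \<notin> cyc xs" "g \<notin> cyc ys" using ringD(10)[OF r] ringD(10)[OF q] x x' nx by blast+
  obtain p k where pk: "cols k p s" using cols_others ringD(6)[OF r] by blast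
  have ps: "p \<in> {1..3}" "s \<in> {1..3}" "p \<noteq> s" using pk by (auto simp: cols_def)
  obtain c1 where c1: "opt c1" "ring c1 s xs" "\<And>e. e \<notin> cyc xs \<Longrightarrow> c1 e = c e" "miss c1 x p"
    using repaint_missing[OF c r x(2) pk] by blast
  have q1: "ring c1 s ys" by (rule ring_other[OF q _ c1(3)]) (use dis ringD(7)[OF r] in auto)
  obtain c2 where c2: "opt c2" "ring c2 s ys" "\<And>e. e \<notin> cyc ys \<Longrightarrow> c2 e = c1 e" "miss c2 x' p"
    using repaint_missing[OF c1(1) q1 x'(2) pk] by blast
  have m: "miss c2 x p" by (rule miss_other[OF c1(4) nx(1) c2(3) ringD(7)[OF q]])
  have "c g = s" using ring_outer[OF c r g(1) gc(1) x] .
  then have gs: "c2 g = s" using c1(3) c2(3) gc by simp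
  have only: "h = g" if that: "h \<in> E" "c2 h \<in> {s, p}" "h \<inter> {x, x'} \<noteq> {}" for h
  proof -
    from that(3) obtain v where v: "v \<in> h" "v \<in> {x, x'}" by blast
    then have "c2 h \<noteq> p" using m c2(4) that(1) by (auto simp: miss_def)
    then have "c2 h = s" using that(2) by simp
    then show ?thesis
      using goodD[OF opt_good[OF c2(1)] that(1) g(1) _ v(1)] v(2) gs gx ps by auto
  qed
  let ?K = "{x, x'}"
  have cl: "chain_closed c2 s p ?K"
    unfolding closed_under_def using only gx by blast
  define c3 where "c3 = swap s p ?K c2"
  have "opt c3" unfolding c3_def by (rule opt_swap[OF c2(1) ps(2,1) cl])
  moreover have "colour_class c3 s = colour_class c2 s - {g}"
  proof -
    have "c3 h = s \<longleftrightarrow> c2 h = s \<and> h \<noteq> g" if h: "h \<in> E" for h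
    proof (cases "h \<inter> ?K = {}")
      case True
      then show ?thesis using gx by (auto simp: c3_def kempe_def)
    next
      case False
      then have "c3 h = s \<longleftrightarrow> c2 h = p" unfolding c3_def by (rule kempe_inside)
      then show ?thesis using only[OF h _ False] gs ps by auto
    qed
    then show ?thesis by blast
  qed
  then have "card (colour_class c3 s) + 1 = card (colour_class c2 s)"
    using gs g(1) finE card_Suc_Diff1[of "colour_class c2 s" g] by simp
  moreover have "colour_class c2 s = colour_class c1 s" by (rule repaint_class[OF q1 c2(2,3)])
  moreover have "colour_class c1 s = colour_class c s" by (rule repaint_class[OF r c1(2,3)])
  moreover have "c3 e = c e" if e: "e \<in> E" "\<not> e \<subseteq> set xs \<union> set ys" for e
  proof -
    have "e \<notin> cyc xs" "e \<notin> cyc ys" using e ringD(10)[OF r, of e] ringD(10)[OF q, of e] by blast+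
    moreover have "\<not> e \<subseteq> ?K" using e x x' by blast
    ultimately show ?thesis using c1(3) c2(3) kempe_outside[OF cl e(1)] by (simp add: c3_def)
  qed
  ultimately show thesis by (intro that[of c3]) auto
qed

text \<open>Each shift leaves the rings of the other pairs intact, so the shifts can be made one
  after another.\<close>

lemma multishift:
  assumes "finite X" "opt c"
    and "\<And>g. g \<in> X \<Longrightarrow> g \<in> E \<and> ring c s (A g) \<and> ring c s (B g) \<and> set (A g) \<inter> set (B g) = {} \<and>
        g \<inter> set (A g) \<noteq> {} \<and> g \<inter> set (B g) \<noteq> {}"
    and "\<And>g h. g \<in> X \<Longrightarrow> h \<in> X \<Longrightarrow> g \<noteq> h \<Longrightarrow> (set (A g) \<union> set (B g)) \<inter> (set (A h) \<union> set (B h)) = {}"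
  shows "\<exists>c'. opt c' \<and> card (colour_class c' s) + card X = card (colour_class c s)"
  using assms
proof (induction X arbitrary: c rule: finite_induct)
  case empty
  then show ?case by auto
next
  case (insert g X)
  have g: "g \<in> E" "ring c s (A g)" "ring c s (B g)" "set (A g) \<inter> set (B g) = {}"
    "g \<inter> set (A g) \<noteq> {}" "g \<inter> set (B g) \<noteq> {}" using insert.prems(2)[of g] by auto
  obtain c1 where c1: "opt c1" "card (colour_class c1 s) + 1 = card (colour_class c s)"
    "\<And>e. e \<in> E \<Longrightarrow> \<not> e \<subseteq> set (A g) \<union> set (B g) \<Longrightarrow> c1 e = c e"
    using shift[OF insert.prems(1) g(2,3,4,1,5,6)] by blast
  have keep: "ring c1 s L" if L: "ring c s L" "set L \<inter> (set (A g) \<union> set (B g)) = {}" for L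
    by (rule ring_cong[OF L(1)]) (use c1(3) L(2) in blast)
  have "\<exists>c'. opt c' \<and> card (colour_class c' s) + card X = card (colour_class c1 s)"
  proof (rule insert.IH[OF c1(1)])
    fix h assume h: "h \<in> X"
    then have "h \<noteq> g" using insert.hyps by blast
    then have "(set (A h) \<union> set (B h)) \<inter> (set (A g) \<union> set (B g)) = {}"
      using insert.prems(3)[of h g] h by blast
    then have "ring c1 s (A h)" "ring c1 s (B h)"
      using keep insert.prems(2)[of h] h by blast+
    then show "h \<in> E \<and> ring c1 s (A h) \<and> ring c1 s (B h) \<and> set (A h) \<inter> set (B h) = {} \<and>
        h \<inter> set (A h) \<noteq> {} \<and> h \<inter> set (B h) \<noteq> {}" using insert.prems(2)[of h] h by blast
  next
    fix h h' assume "h \<in> X" "h' \<in> X" "h \<noteq> h'"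
    then show "(set (A h) \<union> set (B h)) \<inter> (set (A h') \<union> set (B h')) = {}"
      using insert.prems(3)[of h h'] by blast
  qed
  then show ?case using c1(2) insert.hyps by auto
qed

section \<open>Forbidden connections between nearby rings\<close>

lemma closed_triple:
  assumes c: "good c" and e: "{x, w} \<in> E" "{w, y} \<in> E" "c {x, w} = s" "c {w, y} = p"
    and m: "miss c x p" "miss c y s" and sp: "s \<noteq> 0" "p \<noteq> 0"
  shows "chain_closed c s p {x, w, y}"
  unfolding closed_under_def
proof (intro ballI impI)
  fix h assume h: "h \<in> {e\<in>E. c e \<in> {s, p}}" "h \<inter> {x, w, y} \<noteq> {}"
  then obtain v where v: "v \<in> h" "v \<in> {x, w, y}" by blast
  have sE: "h = {x, w}" if "v \<in> {x, w}" "c h = s"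
    using goodD[OF c _ e(1) _ v(1), of] h(1) that e(3) sp(1) by auto
  have pE: "h = {w, y}" if "v \<in> {w, y}" "c h = p"
    using goodD[OF c _ e(2) _ v(1), of] h(1) that e(4) sp(2) by auto
  have "v = x \<Longrightarrow> c h \<noteq> p" "v = y \<Longrightarrow> c h \<noteq> s" using m h(1) v(1) by (auto simp: miss_def)
  then have "h = {x, w} \<or> h = {w, y}" using sE pE h(1) v(2) by blast
  then show "h \<subseteq> {x, w, y}" by blast
qed

text \<open>The uncoloured edge is moved to \<open>{z0, x1}\<close> so that \<open>z0\<close> misses
  \<open>q\<close> and \<open>x1\<close> misses \<open>p\<close>, and \<open>ys\<close> is repainted
  so that \<open>y\<close> misses \<open>s\<close>. Then \<open>{x1, w, y}\<close> is a complete
  chain of the colours \<open>s\<close> and \<open>p\<close>, while \<open>K\<close> carries the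
  chain of \<open>s\<close> and \<open>q\<close> from \<open>z0\<close>. Exchanging both frees
  \<open>s\<close> at both ends.\<close>

lemma no_short_next_to_escape:
  assumes c: "opt c" and r: "ring c s xs" and rp: "ring c p ys" and cl: "cols p q s"
    and dis: "set ys \<inter> set xs = {}" and x1: "{z0, x1} \<in> cyc xs"
    and w: "{x1, w} \<in> E" "w \<notin> set xs" "w \<notin> set ys" "{w, y} \<in> E" "y \<in> set ys"
    and K: "closed_under ({e\<in>E. c e \<in> {s, q}} - cyc xs) (\<lambda>e. e) K" "K \<inter> set xs = {z0}"
  shows False
proof -
  have nz: "s \<noteq> 0" "p \<noteq> 0" "q \<noteq> 0" "s \<noteq> p" "s \<noteq> q" "p \<noteq> q" using cl by (auto simp: cols_def)
  define F where "F = {e\<in>E. c e \<in> {s, q}} - cyc xs"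
  have KF: "closed_under F (\<lambda>e. e) K" using K(1) by (simp only: F_def)
  have x1s: "x1 \<in> set xs" and z0s: "z0 \<in> set xs" and xE: "{z0, x1} \<in> E" using ringD(5,10)[OF r] x1 by blast+
  obtain c1 where c1: "opt c1" "ring c1 s xs" "\<And>e. e \<notin> cyc xs \<Longrightarrow> c1 e = c e" "c1 {z0, x1} = 0" "miss c1 z0 q" "miss c1 x1 p"
    using repaint[OF c r x1 cl] by blast
  have rp1: "ring c1 p ys" by (rule ring_other[OF rp dis c1(3) ringD(7)[OF r]])
  have "cols q s p" using cl by (auto simp: cols_def)
  from repaint_missing[OF c1(1) rp1 w(5) this]
  obtain c2 where c2: "opt c2" "\<And>e. e \<notin> cyc ys \<Longrightarrow> c2 e = c1 e" "miss c2 y s" by blast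
  have nys: "z0 \<notin> set ys" "x1 \<notin> set ys" using z0s x1s dis by auto
  have ne: "ys \<noteq> []" using w(5) by auto
  have e0: "c2 {x1, z0} = 0"
    using c1(4) c2(2)[of "{z0, x1}"] cyc_subset[OF ne, of "{z0, x1}"] nys by (auto simp: insert_commute)
  have m: "miss c2 z0 q" "miss c2 x1 p"
    using miss_other[OF c1(5) nys(1) c2(2) ne] miss_other[OF c1(6) nys(2) c2(2) ne] by blast+
  have "{x1, w} \<notin> cyc xs" "{w, y} \<notin> cyc xs" "{x1, w} \<notin> cyc ys" "{w, y} \<notin> cyc ys"
    using ringD(10)[OF r] w(2,3) cyc_subset[OF ne] by blast+
  then have cw: "c {x1, w} = s" "c {w, y} = p" "c2 {x1, w} = s" "c2 {w, y} = p"
    using ring_outer[OF c r w(1), of x1] ring_outer[OF c rp w(4), of y] x1s w(5) c1(3) c2(2) by auto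
  have cl1: "chain_closed c2 s p {x1, w, y}"
    by (rule closed_triple[OF opt_good[OF c2(1)] w(1,4) cw(3,4) m(2) c2(3) nz(1,2)])
  \<comment> \<open>Repainting \<open>ys\<close> may change where \<open>s\<close> and
    \<open>q\<close> occur on this ring. Edges leaving it have colour \<open>p\<close>, so without
    its vertices the rest of \<open>K\<close> is still closed.\<close>
  define L where "L = K - set ys"
  have ysF: "h \<subseteq> set ys" if "h \<in> F" "h \<inter> set ys \<noteq> {}" for h
  proof -
    have "h \<in> cyc ys"
    proof (rule ccontr)
      assume n: "h \<notin> cyc ys"
      from that(2) obtain v where "v \<in> h" "v \<in> set ys" by blast
      then have "c h = p" using ring_outer[OF c rp _ n] that(1) by (auto simp: F_def)
      then show False using that(1) nz by (auto simp: F_def)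
    qed
    then show ?thesis by (rule cyc_subset[OF ne])
  qed
  have cl2: "chain_closed c2 s q L"
    unfolding closed_under_def
  proof (intro ballI impI)
    fix h assume h: "h \<in> {e\<in>E. c2 e \<in> {s, q}}" "h \<inter> L \<noteq> {}"
    have hy: "h \<notin> cyc ys" using h(2) cyc_subset[OF ne, of h] by (auto simp: L_def)
    have hx: "h \<notin> cyc xs"
    proof
      assume hx: "h \<in> cyc xs"
      then have "z0 \<in> h" using h(2) K(2) ringD(10)[OF r hx] by (auto simp: L_def)
      then have "c2 h = s" using m(1) h(1) by (auto simp: miss_def)
      then show False using c2(2)[OF hy] ringD(8)[OF c1(2) hx] by simp
    qed
    have hF: "h \<in> F" using h(1) c2(2)[OF hy] c1(3)[OF hx] hx by (auto simp: F_def)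
    then have "h \<subseteq> K" using KF h(2) by (auto simp: closed_under_def L_def)
    moreover have "h \<inter> set ys = {}" using ysF[OF hF] h(2) by (auto simp: L_def)
    ultimately show "h \<subseteq> L" by (auto simp: L_def)
  qed
  have "{x1, w} \<in> F" using w(1) cw(1) \<open>{x1, w} \<notin> cyc xs\<close> by (simp add: F_def)
  have x1K: "x1 \<notin> K" using K(2) x1s edge_neq[OF xE] by auto
  have wK: "w \<notin> K" using KF \<open>{x1, w} \<in> F\<close> x1K by (auto simp: closed_under_def)
  have dj: "{x1, w, y} \<inter> L = {}" using x1K wK w(5) by (auto simp: L_def)
  show False
    by (rule opt_no_double_swap[OF c2(1) _ e0 _ m(2,1) cl1 _ cl2 _ dj])
      (use cl xE K nys in \<open>auto simp: cols_def L_def insert_commute\<close>)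
qed

text \<open>Repainting \<open>zs\<close> so that \<open>z\<close> misses \<open>s\<close> turns
  \<open>{x1, w1, z}\<close> into a closed set for \<open>s\<close> and \<open>q\<close> that meets
  the ring only in \<open>x1\<close>. It plays the part of \<open>K\<close> in
  \<open>no_short_next_to_escape\<close>, with the connection from \<open>x0\<close> to
  \<open>ys\<close> as the short one.\<close>

lemma two_short:
  assumes c: "opt c" and r: "ring c s xs" and rp: "ring c p ys" and rq: "ring c q zs" and cl: "cols p q s"
    and dis: "set xs \<inter> set ys = {}" "set xs \<inter> set zs = {}" "set ys \<inter> set zs = {}"
    and x: "{x0, x1} \<in> cyc xs"
    and w0: "{x0, w0} \<in> E" "w0 \<notin> set xs \<union> set ys \<union> set zs" "{w0, y} \<in> E" "y \<in> set ys"
    and w1: "{x1, w1} \<in> E" "w1 \<notin> set xs \<union> set ys \<union> set zs" "{w1, z} \<in> E" "z \<in> set zs"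
  shows False
proof -
  have nz: "s \<noteq> 0" "q \<noteq> 0" "s \<noteq> q" "cols p s q" using cl by (auto simp: cols_def)
  have x1: "x1 \<in> set xs" using ringD(10)[OF r x] by auto
  obtain c1 where c1: "opt c1" "\<And>e. e \<notin> cyc zs \<Longrightarrow> c1 e = c e" "miss c1 z s"
    using repaint_missing[OF c rq w1(4) nz(4)] by blast
  have r1: "ring c1 s xs" "ring c1 p ys"
    using ring_other[OF r _ c1(2) ringD(7)[OF rq]] ring_other[OF rp _ c1(2) ringD(7)[OF rq]] dis by auto
  have "{x1, w1} \<notin> cyc xs" "{w1, z} \<notin> cyc zs" "{w1, z} \<notin> cyc xs" "{x1, w1} \<notin> cyc zs"
    using ringD(10)[OF r] ringD(10)[OF rq] w1(2) by blast+
  then have col: "c1 {x1, w1} = s" "c1 {w1, z} = q"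
    using ring_outer[OF c1(1) r1(1) w1(1) _ _ x1] ring_outer[OF c rq w1(3) _ _ w1(4)] c1(2) by auto
  have only: "h = e" if "h \<in> E" "v \<in> h" "e \<in> E" "v \<in> e" "c1 e = k" "c1 h = k" "k \<noteq> 0" for h e v k
    using goodD[OF opt_good[OF c1(1)] that(1,3) _ that(2,4)] that(5-7) by auto
  have K: "closed_under ({e\<in>E. c1 e \<in> {s, q}} - cyc xs) (\<lambda>e. e) {x1, w1, z}"
    unfolding closed_under_def
  proof (intro ballI impI)
    fix h assume h: "h \<in> {e\<in>E. c1 e \<in> {s, q}} - cyc xs" "h \<inter> {x1, w1, z} \<noteq> {}"
    then have hE: "h \<in> E" "h \<notin> cyc xs" by auto
    from h(2) consider "x1 \<in> h" | "w1 \<in> h" | "z \<in> h" by blast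
    then have "h = {x1, w1} \<or> h = {w1, z}"
    proof cases
      case 1
      then show ?thesis using only[OF hE(1) 1 w1(1) _ col(1)] ring_outer[OF c1(1) r1(1) hE 1 x1] nz by simp
    next
      case 2
      then show ?thesis using only[OF hE(1) 2 w1(1) _ col(1)] only[OF hE(1) 2 w1(3) _ col(2)] h(1) nz by auto
    next
      case 3
      then show ?thesis using only[OF hE(1) 3 w1(3) _ col(2)] c1(3) h(1) nz by (auto simp: miss_def)
    qed
    then show "h \<subseteq> {x1, w1, z}" by blast
  qed
  have x': "{x1, x0} \<in> cyc xs" using x by (simp add: insert_commute)
  show False
    by (rule no_short_next_to_escape[OF c1(1) r1 cl _ x' w0(1) _ _ w0(3,4) K])
      (use w0(2) w1(2,4) dis x1 in auto)
qed

text \<open>Off the ring, each of its oddly many vertices has exactly one edge of colour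
  \<open>s\<close> or \<open>q\<close>, so by \<open>odd_escape\<close> the chain from some
  \<open>z0\<close> never returns to the ring. A neighbour of \<open>z0\<close> on the ring supplies
  the short connection.\<close>

lemma all_short:
  assumes c: "opt c" and r: "ring c s xs" and cl: "cols p q s"
    and short: "\<And>x. x \<in> set xs \<Longrightarrow> \<exists>w y ys. {x, w} \<in> E \<and> w \<notin> set xs \<and> {w, y} \<in> E \<and>
        ring c p ys \<and> y \<in> set ys \<and> w \<notin> set ys \<and> set ys \<inter> set xs = {}"
  shows False
proof -
  have nz: "s \<noteq> 0" "p \<noteq> 0" "q \<noteq> 0" "s \<in> {1..3}" "q \<in> {1..3}" "s \<noteq> p" "s \<noteq> q" "p \<noteq> q" using cl by (auto simp: cols_def)
  define F where "F = {e\<in>E. c e \<in> {s, q}} - cyc xs"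
  have finF: "finite F" using finE by (simp add: F_def)
  have two: "e \<in> F \<Longrightarrow> card e = 2" for e using edgeD by (auto simp: F_def)
  have deg: "degree F (\<lambda>e. e) v \<le> 2" for v
    by (rule degree_two_colours[OF opt_good[OF c] nz(4,5)]) (auto simp: F_def)
  have deg1: "degree F (\<lambda>e. e) x = 1" if x: "x \<in> set xs" for x
  proof -
    obtain y z g where at: "{e\<in>E. x \<in> e} = {{x, y}, {x, z}, g}" "{e\<in>cyc xs. x \<in> e} = {{x, y}, {x, z}}"
      "g \<notin> cyc xs" "g \<in> E" "x \<in> g" by (rule ring_at[OF r x])
    have "c g = s" using ring_outer[OF c r at(4,3,5) x] .
    have "{e\<in>F. x \<in> e} = {e\<in>E. x \<in> e} \<inter> {e. c e \<in> {s, q}} - {e\<in>cyc xs. x \<in> e}"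
      by (auto simp: F_def)
    also have "\<dots> = {g}"
    proof -
      have "g \<notin> {e\<in>cyc xs. x \<in> e}" using at(3) by simp
      then show ?thesis unfolding at(1) at(2) using \<open>c g = s\<close> by blast
    qed
    finally show ?thesis by (simp add: degree_def)
  qed
  have odd: "odd (card (set xs))" using ringD(1,2)[OF r] by (simp add: distinct_card)
  obtain z0 K where K: "z0 \<in> set xs" "closed_under F (\<lambda>e. e) K" "K \<inter> set xs = {z0}"
    using odd_escape[OF finF two deg finite_set odd deg1] by blast
  obtain x1 where x1: "{z0, x1} \<in> cyc xs" by (rule cyc_neighbour[OF ringD(1,3)[OF r] K(1)])
  then have "x1 \<in> set xs" using ringD(10)[OF r] by blast
  then obtain w y ys where w: "{x1, w} \<in> E" "w \<notin> set xs" "{w, y} \<in> E" "ring c p ys" "y \<in> set ys"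
    "w \<notin> set ys" "set ys \<inter> set xs = {}" using short by blast
  show False
    by (rule no_short_next_to_escape[OF c r w(4) cl w(7) x1 w(1,2,6,3,5) K(2)[unfolded F_def] K(3)])
qed

text \<open>Class \<open>s\<close> covers every vertex except those that miss \<open>s\<close>, and
  these lie on uncoloured edges. An uncoloured edge whose ring has another type has exactly one such
  end; for type \<open>s\<close> it has none.\<close>

lemma colour_class_count:
  assumes c: "opt c" and \<rho>: "\<And>e. e \<in> unc c \<Longrightarrow> ring c (\<tau> e) (\<rho> e) \<and> e \<in> cyc (\<rho> e)" and s: "s \<in> {1..3}"
  shows "card V + card {e\<in>unc c. \<tau> e = s} = 2 * card (colour_class c s) + card (unc c)"
proof -
  let ?M = "colour_class c s" and ?N = "{v\<in>V. miss c v s}" and ?R = "{e\<in>unc c. \<tau> e \<noteq> s}"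
  have fin: "finite (unc c)" "finite ?M" using finE by (auto simp: uncoloured_def)
  have "card (\<Union>e\<in>?M. e) = (\<Sum>e\<in>?M. card e)"
  proof (rule card_UN_disjoint[OF fin(2)])
    show "\<forall>e\<in>?M. finite e" using edgeD finV finite_subset by blast
    show "\<forall>e\<in>?M. \<forall>f\<in>?M. e \<noteq> f \<longrightarrow> e \<inter> f = {}"
    proof (intro ballI impI)
      fix e f assume ef: "e \<in> ?M" "f \<in> ?M" "e \<noteq> f"
      have "v \<notin> f" if "v \<in> e" for v
        using goodD[OF opt_good[OF c], of e f v] ef s that by auto
      then show "e \<inter> f = {}" by blast
    qed
  qed
  also have "\<dots> = (\<Sum>e\<in>?M. 2)" using edgeD by (intro sum.cong) auto
  finally have M: "card (\<Union>e\<in>?M. e) = 2 * card ?M" by simp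
  have VN: "V = (\<Union>e\<in>?M. e) \<union> ?N" using edgeD by (auto simp: miss_def)
  have dj: "(\<Union>e\<in>?M. e) \<inter> ?N = {}" by (auto simp: miss_def)
  have N: "?N = (\<Union>e\<in>?R. {v\<in>e. miss c v s})"
  proof (intro equalityI subsetI)
    fix v assume v: "v \<in> ?N"
    have "\<exists>e\<in>unc c. v \<in> e"
    proof (rule ccontr)
      assume no: "\<not> ?thesis"
      obtain a b where ab: "cols a b s" using cols_others s by blast
      have "degree {e\<in>E. v \<in> e} (\<lambda>e. e) v \<le> 2"
      proof (rule degree_two_colours[OF opt_good[OF c]])
        show "a \<in> {1..3}" "b \<in> {1..3}" using ab by (auto simp: cols_def)
        show "{e\<in>E. v \<in> e} \<subseteq> {e\<in>E. c e \<in> {a, b}}"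
        proof
          fix e assume e: "e \<in> {e\<in>E. v \<in> e}"
          then have "c e \<noteq> 0" "c e \<noteq> s" using no v by (auto simp: uncoloured_def miss_def)
          then show "e \<in> {e\<in>E. c e \<in> {a, b}}"
            using cols_le_cases[OF ab good_le[OF opt_good[OF c]], of e] e by auto
        qed
      qed
      then show False using cubic[of v] v by (simp add: degree_def)
    qed
    then obtain e where e: "e \<in> unc c" "v \<in> e" by blast
    have r: "ring c (\<tau> e) (\<rho> e)" "e \<in> cyc (\<rho> e)" using \<rho>[OF e(1)] by auto
    have vr: "v \<in> set (\<rho> e)" using ringD(10)[OF r] e(2) by blast
    obtain g where g: "g \<notin> cyc (\<rho> e)" "g \<in> E" "v \<in> g" by (rule ring_at[OF r(1) vr])
    have "c g = \<tau> e" by (rule ring_outer[OF c r(1) g(2,1,3) vr])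
    then have "\<tau> e \<noteq> s" using v g by (auto simp: miss_def)
    then show "v \<in> (\<Union>e\<in>?R. {v\<in>e. miss c v s})" using e v by blast
  next
    fix v assume "v \<in> (\<Union>e\<in>?R. {v\<in>e. miss c v s})"
    then show "v \<in> ?N" using edgeD by (auto simp: uncoloured_def)
  qed
  \<comment> \<open>The colours missing at the two ends are among \<open>s\<close> and
    \<open>k\<close>; they are distinct, since a common one could be given to
    \<open>e\<close>.\<close>
  have one: "card {v\<in>e. miss c v s} = 1" if e: "e \<in> ?R" for e
  proof -
    have r: "ring c (\<tau> e) (\<rho> e)" "e \<in> cyc (\<rho> e)" and ts: "\<tau> e \<noteq> s" and eu: "e \<in> unc c" using \<rho> e by auto
    obtain k where k: "cols s k (\<tau> e)" using cols_third[of s "\<tau> e"] s ts ringD(6)[OF r(1)] cols_swap by metis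
    have eE: "e \<in> E" "c e = 0" using eu by (auto simp: uncoloured_def)
    then obtain u v where uv: "e = {u, v}" "u \<noteq> v" using edgeD[of e] by (auto simp: card_2_iff)
    have miss: "\<exists>m\<in>{s, k}. miss c v m" if "v \<in> e" for v
    proof -
      have vr: "v \<in> set (\<rho> e)" using ringD(10)[OF r] that by blast
      obtain g where g: "g \<notin> cyc (\<rho> e)" "g \<in> E" "v \<in> g" by (rule ring_at[OF r(1) vr])
      have "c g = \<tau> e" by (rule ring_outer[OF c r(1) g(2,1,3) vr])
      then have "\<not> miss c v (\<tau> e)" using g by (auto simp: miss_def)
      then show ?thesis
        using misses_some[OF ring_vertex[OF r(1) vr] eu that] cols_cases[OF k] by blast
    qed
    have has: "\<not> miss c v s" if v: "v \<in> e" "miss c v k" for v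
    proof -
      obtain g h where gh: "{e\<in>E. v \<in> e} = {e, g, h}" "c g = s"
        by (rule unc_vertex[OF c eu v cols_swap(1)[OF k]])
      have "g \<in> {e\<in>E. v \<in> e}" unfolding gh(1) by simp
      then show ?thesis using gh(2) by (auto simp: miss_def)
    qed
    have not2: "\<not> (miss c u m \<and> miss c v m)" if "m \<in> {s, k}" for m
      using opt_no_common[OF c, of u v m] eE uv that k by (auto simp: cols_def)
    have "miss c u s \<and> \<not> miss c v s \<or> miss c v s \<and> \<not> miss c u s"
      using miss[of u] miss[of v] not2[of s] not2[of k] uv by auto
    then have "{v\<in>e. miss c v s} = {u} \<or> {v\<in>e. miss c v s} = {v}" using uv by auto
    then show ?thesis by auto
  qed
  have "card ?N = (\<Sum>e\<in>?R. card {v\<in>e. miss c v s})"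
    unfolding N
  proof (rule card_UN_disjoint)
    show "finite ?R" using fin by simp
    show "\<forall>e\<in>?R. finite {v\<in>e. miss c v s}" using one by (metis (no_types, lifting) card.infinite zero_neq_one)
    show "\<forall>e\<in>?R. \<forall>f\<in>?R. e \<noteq> f \<longrightarrow> {v\<in>e. miss c v s} \<inter> {v\<in>f. miss c v s} = {}"
      using unc_matching[OF c] by blast
  qed
  also have "\<dots> = card ?R" using one by simp
  finally have N': "card ?N = card ?R" .
  have "card V = card (\<Union>e\<in>?M. e) + card ?N"
    by (subst VN, rule card_Un_disjoint) (use dj finV VN in \<open>auto intro: finite_subset\<close>)
  moreover have "card (unc c) = card ?R + card {e\<in>unc c. \<tau> e = s}"
    using fin by (subst card_Un_disjoint[symmetric]) (auto intro: arg_cong[where f = card])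
  ultimately show ?thesis using M N' by simp
qed

end

section \<open>Discharging\<close>

text \<open>Indices run around a pentagon. If both flags hold at one vertex, its two neighbours have
  none, which yields 1/3 + 1 + 1, and the remaining two adjacent vertices add at least 1. Otherwise
  every term is at least 1/2, and some vertex has no flag, since different flags cannot be adjacent
  and neither flag holds everywhere; this gives at least 1 + 4/2.\<close>

lemma charge5:
  assumes "\<not> (b0 \<and> c1)" "\<not> (c0 \<and> b1)" "\<not> (b1 \<and> c2)" "\<not> (c1 \<and> b2)" "\<not> (b2 \<and> c3)" "\<not> (c2 \<and> b3)"
    "\<not> (b3 \<and> c4)" "\<not> (c3 \<and> b4)" "\<not> (b4 \<and> c0)" "\<not> (c4 \<and> b0)"
    "\<not> (b0 \<and> b1 \<and> b2 \<and> b3 \<and> b4)" "\<not> (c0 \<and> c1 \<and> c2 \<and> c3 \<and> c4)"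
  shows "(3::real) \<le> 1 / (1 + of_bool b0 + of_bool c0) + 1 / (1 + of_bool b1 + of_bool c1) +
    1 / (1 + of_bool b2 + of_bool c2) + 1 / (1 + of_bool b3 + of_bool c3) + 1 / (1 + of_bool b4 + of_bool c4)"
  using assms
  by (cases b0; cases c0; simp; cases b1; cases c1; simp; cases b2; cases c2; simp; cases b3; cases c3; simp;
      cases b4; cases c4; simp)

text \<open>After exchanging the sums, \<open>w\<close> is counted once for each \<open>e\<close>
  with \<open>w\<close> in \<open>N e\<close>, every time with the reciprocal of that
  number.\<close>

lemma sum_reciprocal_multiplicity:
  assumes "finite U" "\<And>e. e \<in> U \<Longrightarrow> finite (N e)"
  shows "(\<Sum>e\<in>U. \<Sum>w\<in>N e. 1 / real (card {f\<in>U. w \<in> N f})) = real (card (\<Union>e\<in>U. N e))"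
proof -
  let ?W = "\<Union>e\<in>U. N e"
  have W: "finite ?W" using assms by auto
  have "(\<Sum>e\<in>U. \<Sum>w\<in>N e. 1 / real (card {f\<in>U. w \<in> N f})) =
      (\<Sum>e\<in>U. \<Sum>w\<in>{w\<in>?W. w \<in> N e}. 1 / real (card {f\<in>U. w \<in> N f}))"
    by (intro sum.cong) auto
  also have "\<dots> = (\<Sum>w\<in>?W. \<Sum>e\<in>{e\<in>U. w \<in> N e}. 1 / real (card {f\<in>U. w \<in> N f}))"
    by (rule sum.swap_restrict[OF assms(1) W])
  also have "\<dots> = (\<Sum>w\<in>?W. 1)"
  proof (rule sum.cong[OF refl])
    fix w assume "w \<in> ?W"
    then have "card {e\<in>U. w \<in> N e} \<noteq> 0" using assms(1) by auto
    then show "(\<Sum>e\<in>{e\<in>U. w \<in> N e}. 1 / real (card {f\<in>U. w \<in> N f})) = 1" by simp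
  qed
  finally show ?thesis by simp
qed

context cubic_graph
begin

lemma card_edges: "3 * card V = 2 * card E"
proof -
  have "3 * card V = (\<Sum>e\<in>E. card (e \<inter> V))" by (rule handshake[OF finE finV cubic])
  also have "\<dots> = (\<Sum>e\<in>E. 2)" using edgeD by (intro sum.cong) (auto simp: Int_absorb2)
  finally show ?thesis by simp
qed

definition outnb :: "'v list \<Rightarrow> 'v set" where
  "outnb xs = {w\<in>V - set xs. \<exists>x\<in>set xs. {x, w} \<in> E}"

lemma finite_outnb: "finite (outnb xs)"
  using finV by (simp add: outnb_def)

lemma outer_colour:
  assumes "opt c" "ring c s xs" "x \<in> set xs" "w \<notin> set xs" "{x, w} \<in> E"
  shows "c {x, w} = s"
proof -
  have "{x, w} \<notin> cyc xs" using ringD(10)[OF assms(2), of "{x, w}"] assms(4) by blast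
  then show ?thesis using ring_outer[OF assms(1,2,5)] assms(3) by blast
qed

lemma same_colour_edge:
  assumes "good c" "{x, w} \<in> E" "{y, w} \<in> E" "c {x, w} = s" "c {y, w} = s" "s \<noteq> 0"
  shows "x = y"
proof -
  have "{x, w} = {y, w}" using goodD[OF assms(1-3), of w] assms(4-6) by auto
  then show ?thesis by (auto simp: doubleton_eq_iff)
qed

text \<open>By parity an odd number of edges leaves an odd ring, and bridgelessness excludes a
  single one. They all have colour \<open>s\<close>, so their outer ends are distinct.\<close>

lemma outnb_card:
  assumes c: "opt c" and r: "ring c s xs"
  shows "3 \<le> card (outnb xs)"
proof -
  let ?S = "set xs" let ?C = "{e\<in>E. card (e \<inter> ?S) = 1}"
  have S: "?S \<subseteq> V" using ring_vertex[OF r] by blast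
  have s0: "s \<noteq> 0" using ringD(6)[OF r] by auto
  have "odd (3 * card ?S)" using ringD(1,2)[OF r] by (simp add: distinct_card)
  moreover have "3 * card ?S = (\<Sum>e\<in>E. card (e \<inter> ?S))" by (rule handshake[OF finE]) (use cubic S in auto)
  ultimately have "odd (\<Sum>e\<in>E. card (e \<inter> ?S))" by presburger
  then have "odd (card {e\<in>E. odd (card (e \<inter> ?S))})" using even_sum_iff[OF finE] by blast
  moreover have "odd (card (e \<inter> ?S)) \<longleftrightarrow> card (e \<inter> ?S) = 1" if "e \<in> E" for e
  proof -
    have "card (e \<inter> ?S) \<le> 2" using edgeD[OF that] finV by (metis card_mono finite_subset inf_le1)
    moreover have "n \<le> 2 \<Longrightarrow> odd n \<longleftrightarrow> n = 1" for n :: nat by (auto simp: numeral_2_eq_2 le_Suc_eq)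
    ultimately show ?thesis by blast
  qed
  then have "{e\<in>E. odd (card (e \<inter> ?S))} = ?C" by blast
  ultimately have "odd (card ?C)" by simp
  moreover have "card ?C \<noteq> 1" using cutb S by (auto simp: cut_bridgeless_def)
  ultimately have "3 \<le> card ?C" by (auto elim!: oddE)
  \<comment> \<open>On the outer end of a cut edge this recovers the edge, the only one of colour
    \<open>s\<close> there.\<close>
  define h where "h w = (THE e. e \<in> E \<and> w \<in> e \<and> c e = s)" for w
  have "?C \<subseteq> h ` outnb xs"
  proof
    fix e assume e: "e \<in> ?C"
    then obtain x where x: "e \<inter> ?S = {x}" by (auto simp: card_1_singleton_iff)
    have eE: "e \<in> E" "x \<in> e" "x \<in> ?S" using e x by auto
    obtain w where w: "e = {x, w}" "x \<noteq> w" by (rule edge_other[OF eE(1,2)])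
    have wS: "w \<notin> ?S" using x w by auto
    have cs: "c e = s" using outer_colour[OF c r eE(3) wS] eE(1) w by simp
    have "h w = e" unfolding h_def
    proof (rule the_equality)
      show "e \<in> E \<and> w \<in> e \<and> c e = s" using eE cs w by simp
      show "f = e" if "f \<in> E \<and> w \<in> f \<and> c f = s" for f
        using goodD[OF opt_good[OF c], of f e w] that eE cs w s0 by auto
    qed
    moreover have "w \<in> outnb xs" unfolding outnb_def using eE w wS edge_V(2)[of x w] by auto
    ultimately show "e \<in> h ` outnb xs" by blast
  qed
  then have "card ?C \<le> card (outnb xs)" by (rule surj_card_le[OF finite_outnb])
  with \<open>3 \<le> card ?C\<close> show ?thesis by simp
qed

lemma ring_length:
  assumes r: "ring c s xs"
  shows "length xs = 5 \<or> length xs = 7 \<or> 8 \<le> length xs"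
proof -
  have "length xs \<noteq> 3"
  proof
    assume "length xs = 3"
    then obtain x y z where xs: "xs = [x, y, z]" by (auto simp: length_Suc_conv numeral_3_eq_3)
    have "{x, y} \<in> cyc xs" "{y, z} \<in> cyc xs" "{x, z} \<in> cyc xs" by (auto simp: xs cyc_def)
    then have "{x, y} \<in> E" "{y, z} \<in> E" "{x, z} \<in> E" using ringD(5)[OF r] by blast+
    then show False by (rule triangle_free)
  qed
  moreover have "length xs \<noteq> 4" "length xs \<noteq> 6" using ringD(2)[OF r] by auto
  ultimately show ?thesis using ringD(3)[OF r] by linarith
qed

text \<open>Any chord of a pentagon cuts off a triangle.\<close>

lemma pentagon_chordless:
  assumes r: "ring c s xs" and len: "length xs = 5" and x: "x \<in> set xs" "w \<in> set xs" "{x, w} \<in> E"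
  shows "{x, w} \<in> cyc xs"
proof -
  obtain x0 x1 x2 x3 x4 where xs: "xs = [x0, x1, x2, x3, x4]"
    using len by (auto simp: length_Suc_conv eval_nat_numeral)
  have C: "{x0, x1} \<in> cyc xs" "{x1, x2} \<in> cyc xs" "{x2, x3} \<in> cyc xs" "{x3, x4} \<in> cyc xs" "{x4, x0} \<in> cyc xs"
    by (auto simp: xs cyc_def)
  then have E: "{x0, x1} \<in> E" "{x1, x2} \<in> E" "{x2, x3} \<in> E" "{x3, x4} \<in> E" "{x4, x0} \<in> E"
    using ringD(5)[OF r] by blast+
  have no: "{x0, x2} \<notin> E" "{x1, x3} \<notin> E" "{x2, x4} \<notin> E" "{x3, x0} \<notin> E" "{x4, x1} \<notin> E"
    using triangle_free[OF E(1,2)] triangle_free[OF E(2,3)] triangle_free[OF E(3,4)]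
      triangle_free[OF E(4,5)] triangle_free[OF E(5,1)] by blast+
  have no': "{x2, x0} \<notin> E" "{x3, x1} \<notin> E" "{x4, x2} \<notin> E" "{x0, x3} \<notin> E" "{x1, x4} \<notin> E"
    using no by (simp_all add: insert_commute)
  have C': "{x1, x0} \<in> cyc xs" "{x2, x1} \<in> cyc xs" "{x3, x2} \<in> cyc xs" "{x4, x3} \<in> cyc xs" "{x0, x4} \<in> cyc xs"
    using C by (simp_all add: insert_commute)
  have "x \<noteq> w" using edge_neq[OF x(3)] .
  moreover have "x = x0 \<or> x = x1 \<or> x = x2 \<or> x = x3 \<or> x = x4" "w = x0 \<or> w = x1 \<or> w = x2 \<or> w = x3 \<or> w = x4"
    using x(1,2) xs by auto
  ultimately show ?thesis using x(3) C C' no no' by metis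
qed

text \<open>A ring is charged one unit by each of its vertices, and each outside vertex splits one unit
  evenly among the rings it is adjacent to.\<close>

lemma ring_charge:
  assumes c: "opt c" and finU: "finite U" and \<rho>: "\<And>e. e \<in> U \<Longrightarrow> ring c (\<tau> e) (\<rho> e)"
    and dis: "\<And>e f. e \<in> U \<Longrightarrow> f \<in> U \<Longrightarrow> e \<noteq> f \<Longrightarrow> set (\<rho> e) \<inter> set (\<rho> f) = {}"
    and indep: "\<And>e f w. e \<in> U \<Longrightarrow> f \<in> U \<Longrightarrow> w \<in> outnb (\<rho> e) \<Longrightarrow> w \<notin> set (\<rho> f)"
    and e: "e \<in> U"
  shows "8 \<le> real (length (\<rho> e)) + (\<Sum>w\<in>outnb (\<rho> e). 1 / real (card {f\<in>U. w \<in> outnb (\<rho> f)}))"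
proof -
  let ?xs = "\<rho> e" and ?s = "\<tau> e"
  note r = \<rho>[OF e]
  define T where "T w = \<tau> ` {f\<in>U. w \<in> outnb (\<rho> f)}" for w
  have \<tau>: "\<tau> f \<in> {1..3}" if "f \<in> U" for f using ringD(6)[OF \<rho>[OF that]] .
  \<comment> \<open>A vertex meets each colour at most once, so the rings adjacent to
    \<open>w\<close> have different types and there are at most three of them.\<close>
  have "inj_on \<tau> {f\<in>U. w \<in> outnb (\<rho> f)}" for w
  proof (rule inj_onI)
    fix f g assume f: "f \<in> {f\<in>U. w \<in> outnb (\<rho> f)}" and g: "g \<in> {f\<in>U. w \<in> outnb (\<rho> f)}" and fg: "\<tau> f = \<tau> g"
    obtain x where x: "x \<in> set (\<rho> f)" "{x, w} \<in> E" "w \<notin> set (\<rho> f)" using f by (auto simp: outnb_def)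
    obtain y where y: "y \<in> set (\<rho> g)" "{y, w} \<in> E" "w \<notin> set (\<rho> g)" using g by (auto simp: outnb_def)
    have "x = y"
      using same_colour_edge[OF opt_good[OF c] x(2) y(2) outer_colour[OF c \<rho> x(1,3,2)]]
        outer_colour[OF c \<rho> y(1,3,2)] \<tau>[of f] f g fg by auto
    then show "f = g" using dis[of f g] f g x y by auto
  qed
  then have k: "card {f\<in>U. w \<in> outnb (\<rho> f)} = card (T w)" for w by (simp add: T_def card_image)
  have T3: "T w \<subseteq> {1..3}" for w using \<tau> by (auto simp: T_def)
  have T0: "?s \<in> T w" if "w \<in> outnb ?xs" for w using that e by (auto simp: T_def)
  consider "length ?xs = 5" | "length ?xs = 7" | "8 \<le> length ?xs" using ring_length[OF r] by blast
  then show ?thesis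
  proof cases
    case 3
    have "0 \<le> (\<Sum>w\<in>outnb ?xs. 1 / real (card {f\<in>U. w \<in> outnb (\<rho> f)}))" by (intro sum_nonneg) simp
    then show ?thesis using 3 by linarith
  next
    case 2
    \<comment> \<open>Three outer neighbours, each giving at least 1/3, raise 7 to 8.\<close>
    have "1 / 3 \<le> 1 / real (card {f\<in>U. w \<in> outnb (\<rho> f)})" if w: "w \<in> outnb ?xs" for w
    proof -
      have "card (T w) \<le> card {1..3::nat}" by (rule card_mono) (use T3 in auto)
      moreover have "card (T w) > 0" using T0[OF w] finite_subset[OF T3] by (auto simp: card_gt_0_iff)
      ultimately show ?thesis unfolding k by (intro divide_left_mono) auto
    qed
    then have "(\<Sum>w\<in>outnb ?xs. 1 / 3) \<le> (\<Sum>w\<in>outnb ?xs. 1 / real (card {f\<in>U. w \<in> outnb (\<rho> f)}))"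
      by (rule sum_mono)
    moreover have "3 \<le> real (card (outnb ?xs))" using outnb_card[OF c r] by simp
    ultimately show ?thesis using 2 by simp
  next
    case 1
    obtain p q where cl: "cols p q ?s" using cols_others \<tau>[OF e] by blast
    have s0: "?s \<noteq> 0" and pq: "p \<noteq> q" "p \<noteq> ?s" "q \<noteq> ?s" using cl by (auto simp: cols_def)
    have "\<exists>w. {x, w} \<in> E \<and> w \<notin> set ?xs" if x: "x \<in> set ?xs" for x
    proof -
      obtain g where g: "g \<notin> cyc ?xs" "g \<in> E" "x \<in> g" by (rule ring_at[OF r x])
      obtain w where w: "g = {x, w}" by (rule edge_other[OF g(2,3)])
      then show ?thesis using pentagon_chordless[OF r 1 x, of w] g by blast
    qed
    then obtain nb where nb: "\<And>x. x \<in> set ?xs \<Longrightarrow> {x, nb x} \<in> E" "\<And>x. x \<in> set ?xs \<Longrightarrow> nb x \<notin> set ?xs"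
      by metis
    have ns: "c {x, nb x} = ?s" if "x \<in> set ?xs" for x by (rule outer_colour[OF c r that nb(2,1)[OF that]])
    have nin: "nb x \<in> outnb ?xs" if "x \<in> set ?xs" for x
      using nb[OF that] that edge_V(2) by (auto simp: outnb_def)
    have inj: "inj_on nb (set ?xs)"
    proof (rule inj_onI)
      fix x y assume "x \<in> set ?xs" "y \<in> set ?xs" "nb x = nb y"
      then show "x = y" using same_colour_edge[OF opt_good[OF c], of x "nb x" y ?s] nb ns s0 by metis
    qed
    have "outnb ?xs = nb ` set ?xs"
    proof (intro equalityI subsetI)
      fix w assume "w \<in> outnb ?xs"
      then obtain x where x: "x \<in> set ?xs" "{x, w} \<in> E" "w \<notin> set ?xs" by (auto simp: outnb_def)
      have "w = nb x"
        using same_colour_edge[OF opt_good[OF c], of w x "nb x" ?s] outer_colour[OF c r x(1,3,2)] x(2)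
          nb(1)[OF x(1)] ns[OF x(1)] s0 by (simp add: insert_commute)
      then show "w \<in> nb ` set ?xs" using x(1) by blast
    qed (use nin in blast)
    then have sum: "(\<Sum>w\<in>outnb ?xs. 1 / real (card {f\<in>U. w \<in> outnb (\<rho> f)})) = (\<Sum>x\<in>set ?xs. 1 / real (card (T (nb x))))"
      by (simp add: sum.reindex[OF inj] k)
    \<comment> \<open>The share of the outer neighbour of \<open>x\<close> depends only on which of
      the two other types it sees, as it always sees \<open>?s\<close>.\<close>
    define b where "b x \<longleftrightarrow> p \<in> T (nb x)" for x
    define d where "d x \<longleftrightarrow> q \<in> T (nb x)" for x
    have val: "1 / real (card (T (nb x))) = 1 / (1 + of_bool (b x) + of_bool (d x))" if x: "x \<in> set ?xs" for x
    proof -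
      have "T (nb x) = {?s} \<union> (if b x then {p} else {}) \<union> (if d x then {q} else {})"
      proof (intro equalityI subsetI)
        fix t assume t: "t \<in> T (nb x)"
        then have "t \<in> {1..3}" using T3 by blast
        then show "t \<in> {?s} \<union> (if b x then {p} else {}) \<union> (if d x then {q} else {})"
          using cols_cases[OF cl] t by (auto simp: b_def d_def)
      qed (use T0[OF nin[OF x]] in \<open>auto simp: b_def d_def split: if_splits\<close>)
      then show ?thesis using pq by simp
    qed
    have wit: "\<exists>f y. f \<in> U \<and> ring c t (\<rho> f) \<and> {nb x, y} \<in> E \<and> y \<in> set (\<rho> f) \<and> nb x \<notin> set (\<rho> f) \<and> f \<noteq> e"
      if t: "t \<in> T (nb x)" "t \<noteq> ?s" and x: "x \<in> set ?xs" for t x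
    proof -
      obtain f where f: "f \<in> U" "t = \<tau> f" "nb x \<in> outnb (\<rho> f)" using t(1) by (auto simp: T_def)
      then obtain y where "y \<in> set (\<rho> f)" "{y, nb x} \<in> E" "nb x \<notin> set (\<rho> f)" by (auto simp: outnb_def)
      then show ?thesis using f t(2) \<rho>[OF f(1)] by (auto simp: insert_commute)
    qed
    \<comment> \<open>An instance of \<open>two_short\<close>; \<open>dis\<close> and
      \<open>indep\<close> keep the rings and the connecting vertices apart.\<close>
    have rule: "\<not> (b x \<and> d y)" if xy: "{x, y} \<in> cyc ?xs" for x y
    proof
      assume bd: "b x \<and> d y"
      have x: "x \<in> set ?xs" "y \<in> set ?xs" using ringD(10)[OF r xy] by auto
      obtain f u where f: "f \<in> U" "ring c p (\<rho> f)" "{nb x, u} \<in> E" "u \<in> set (\<rho> f)" "f \<noteq> e"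
        using wit[OF _ pq(2) x(1)] bd by (auto simp: b_def)
      obtain g v where g: "g \<in> U" "ring c q (\<rho> g)" "{nb y, v} \<in> E" "v \<in> set (\<rho> g)" "g \<noteq> e"
        using wit[OF _ pq(3) x(2)] bd by (auto simp: d_def)
      \<comment> \<open>The type of a ring is the colour of its outer edges, so one ring cannot have
        both types.\<close>
      have "f \<noteq> g"
      proof
        assume "f = g"
        obtain z where z: "{u, z} \<in> cyc (\<rho> f)" by (rule cyc_neighbour[OF ringD(1,3)[OF f(2)] f(4)])
        obtain h where h: "h \<notin> cyc (\<rho> f)" "h \<in> E" "u \<in> h" by (rule ring_at[OF f(2,4)])
        show False using ring_outer[OF c f(2) h(2,1,3) f(4)] ring_outer[OF c g(2) h(2) _ h(3)] h(1) f(4) \<open>f = g\<close> pq by simp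
      qed
      show False
      proof (rule two_short[OF c r f(2) g(2) cl _ _ _ xy nb(1)[OF x(1)] _ f(3,4) nb(1)[OF x(2)] _ g(3,4)])
        show "set ?xs \<inter> set (\<rho> f) = {}" "set ?xs \<inter> set (\<rho> g) = {}" "set (\<rho> f) \<inter> set (\<rho> g) = {}"
          using dis e f g \<open>f \<noteq> g\<close> by auto
        show "nb x \<notin> set ?xs \<union> set (\<rho> f) \<union> set (\<rho> g)" "nb y \<notin> set ?xs \<union> set (\<rho> f) \<union> set (\<rho> g)"
          using indep[OF e _ nin] x e f(1) g(1) by auto
      qed
    qed
    have notall: "\<not> (\<forall>x\<in>set ?xs. t \<in> T (nb x))" if t: "cols t t' ?s" for t t'
    proof
      assume all: "\<forall>x\<in>set ?xs. t \<in> T (nb x)"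
      have ts: "t \<noteq> ?s" using t by (simp add: cols_def)
      show False
      proof (rule all_short[OF c r t])
        fix x assume x: "x \<in> set ?xs"
        obtain f y where f: "f \<in> U" "ring c t (\<rho> f)" "{nb x, y} \<in> E" "y \<in> set (\<rho> f)" "nb x \<notin> set (\<rho> f)" "f \<noteq> e"
          using wit[OF _ ts x] all x by blast
        then show "\<exists>w y ys. {x, w} \<in> E \<and> w \<notin> set ?xs \<and> {w, y} \<in> E \<and>
            ring c t ys \<and> y \<in> set ys \<and> w \<notin> set ys \<and> set ys \<inter> set ?xs = {}"
          using nb[OF x] dis[OF f(1) e f(6)] by blast
      qed
    qed
    obtain x0 x1 x2 x3 x4 where xs: "?xs = [x0, x1, x2, x3, x4]"
      using 1 by (auto simp: length_Suc_conv eval_nat_numeral)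
    have C: "{x0, x1} \<in> cyc ?xs" "{x1, x2} \<in> cyc ?xs" "{x2, x3} \<in> cyc ?xs" "{x3, x4} \<in> cyc ?xs" "{x4, x0} \<in> cyc ?xs"
      by (auto simp: xs cyc_def)
    have C': "{x1, x0} \<in> cyc ?xs" "{x2, x1} \<in> cyc ?xs" "{x3, x2} \<in> cyc ?xs" "{x4, x3} \<in> cyc ?xs" "{x0, x4} \<in> cyc ?xs"
      using C by (simp_all add: insert_commute)
    have nb': "\<not> (b x0 \<and> b x1 \<and> b x2 \<and> b x3 \<and> b x4)" using notall[OF cl] by (auto simp: xs b_def)
    have nd': "\<not> (d x0 \<and> d x1 \<and> d x2 \<and> d x3 \<and> d x4)" using notall[OF cols_swap(1)[OF cl]] by (auto simp: xs d_def)
    have "distinct [x0, x1, x2, x3, x4]" using ringD(1)[OF r] xs by simp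
    then have "(\<Sum>x\<in>set ?xs. 1 / real (card (T (nb x)))) = 1 / real (card (T (nb x0))) + 1 / real (card (T (nb x1))) +
        1 / real (card (T (nb x2))) + 1 / real (card (T (nb x3))) + 1 / real (card (T (nb x4)))"
      unfolding xs by simp
    moreover have "3 \<le> 1 / (1 + of_bool (b x0) + of_bool (d x0)) + 1 / (1 + of_bool (b x1) + of_bool (d x1)) +
        1 / (1 + of_bool (b x2) + of_bool (d x2)) + 1 / (1 + of_bool (b x3) + of_bool (d x3)) +
        (1 / (1 + of_bool (b x4) + of_bool (d x4)) :: real)"
      by (rule charge5[OF rule[OF C(1)] _ rule[OF C(2)] _ rule[OF C(3)] _ rule[OF C(4)] _ rule[OF C(5)] _ nb' nd'])
        (use rule[OF C'(1)] rule[OF C'(2)] rule[OF C'(3)] rule[OF C'(4)] rule[OF C'(5)] in blast)+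
    moreover have "x0 \<in> set ?xs" "x1 \<in> set ?xs" "x2 \<in> set ?xs" "x3 \<in> set ?xs" "x4 \<in> set ?xs" by (simp_all add: xs)
    ultimately have "3 \<le> (\<Sum>x\<in>set ?xs. 1 / real (card (T (nb x))))" by (simp only: val)
    then show ?thesis using 1 sum by simp
  qed
qed

section \<open>The bound for reduced graphs\<close>

lemma nu2_ge:
  assumes c: "good c" and s: "s \<in> {1..3}"
  shows "card E \<le> nu 2 E (\<lambda>e. e) + card (unc c) + card (colour_class c s)"
proof -
  let ?F = "{e\<in>E. c e \<noteq> 0 \<and> c e \<noteq> s}"
  obtain a b where ab: "cols a b s" using cols_others s by blast
  have "k_edge_colorable 2 ?F (\<lambda>e. e)"
    unfolding k_edge_colorable_def
  proof (intro exI[of _ "\<lambda>e. if c e = a then 0 else 1"] conjI ballI impI)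
    fix e assume e: "e \<in> ?F"
    fix f assume f: "f \<in> ?F" and "e \<noteq> f \<and> e \<inter> f \<noteq> {}"
    then obtain v where v: "v \<in> e" "v \<in> f" "e \<noteq> f" by blast
    have "c e \<noteq> c f" using goodD[OF c _ _ v(3,1,2)] e f by auto
    moreover have "c e = a \<or> c e = b" "c f = a \<or> c f = b"
      using cols_le_cases[OF ab good_le[OF c, of e]] cols_le_cases[OF ab good_le[OF c, of f]] e f by auto
    ultimately show "(if c e = a then 0 else 1) \<noteq> (if c f = a then 0 else 1 :: nat)" by auto
  qed auto
  then have "card ?F \<le> nu 2 E (\<lambda>e. e)" by (intro nu_ge[OF finE]) auto
  moreover have "card E = card (?F \<union> unc c \<union> colour_class c s)"
    by (rule arg_cong[where f = card]) (auto simp: uncoloured_def)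
  moreover have "card (?F \<union> unc c \<union> colour_class c s) \<le> card ?F + card (unc c) + card (colour_class c s)"
    by (meson add_le_mono1 card_Un_le le_trans)
  ultimately show ?thesis by linarith
qed

text \<open>The result is 47/2 times the sum of the three instances of \<open>sU\<close>, rewritten
  with \<open>card_edges\<close>, combined with three times the vertex count
  \<open>n\<close>.\<close>

lemma core_bound:
  "141 * card V + 70 * nu 3 E (\<lambda>e. e) \<le> 141 * nu 2 E (\<lambda>e. e) + 3 * card V + 70 * card E"
proof -
  obtain c where c: "opt c" using opt_exists by blast
  define R where "R = unc c"
  have finR: "finite R" using finE by (simp add: R_def uncoloured_def)
  have RE: "R \<subseteq> E" by (auto simp: R_def uncoloured_def)
  have nu3: "card E = nu 3 E (\<lambda>e. e) + card R"
  proof -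
    obtain c0 where c0: "good c0" "card E = nu 3 E (\<lambda>e. e) + card (unc c0)"
      by (rule nu3_colouring[OF finE])
    then have "card R \<le> card (unc c0)" using c by (simp add: opt_def R_def)
    then show ?thesis using colouring_le_nu3[OF finE opt_good[OF c]] c0(2) by (simp add: R_def)
  qed
  have "\<forall>e\<in>R. \<exists>p. ring c (fst p) (snd p) \<and> e \<in> cyc (snd p)"
    unfolding R_def using ring_exists[OF c] by (metis fst_conv snd_conv)
  then obtain P where P: "\<And>e. e \<in> R \<Longrightarrow> ring c (fst (P e)) (snd (P e)) \<and> e \<in> cyc (snd (P e))"
    by metis
  define \<tau> where "\<tau> e = fst (P e)" for e
  define \<rho> where "\<rho> e = snd (P e)" for e
  define Q where "Q e = set (\<rho> e)" for e
  have ring: "ring c (\<tau> e) (\<rho> e)" "e \<in> cyc (\<rho> e)" if "e \<in> R" for e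
    using P[OF that] by (simp_all add: \<tau>_def \<rho>_def)
  have R0: "c e = 0" if "e \<in> R" for e using that by (simp add: R_def uncoloured_def)
  have dis: "Q e \<inter> Q f = {}" if "e \<in> R" "f \<in> R" "e \<noteq> f" for e f
    unfolding Q_def
    by (rule rings_disjoint[OF c ring(1)[OF that(1)] ring(1)[OF that(2)] ring(2)[OF that(1)] R0[OF that(1)]
          ring(2)[OF that(2)] R0[OF that(2)] that(3)])
  have uniq: "e = f" if "e \<in> R" "f \<in> R" "v \<in> Q e" "v \<in> Q f" for e f v using dis that by blast
  \<comment> \<open>\<open>X\<close> is a maximal set of edges joining two rings such that no ring is used twice, and \<open>U\<close> is the
    set of rings (named by their uncoloured edges) that are left over.\<close>
  define touch where "touch g = {e\<in>R. g \<inter> Q e \<noteq> {}}" for g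
  define valid where "valid X \<longleftrightarrow> X \<subseteq> {g\<in>E. card (touch g) = 2} \<and>
    (\<forall>g\<in>X. \<forall>h\<in>X. g \<noteq> h \<longrightarrow> touch g \<inter> touch h = {})" for X
  have "finite {X. valid X}"
    by (rule finite_subset[of _ "Pow E"]) (use finE in \<open>auto simp: valid_def\<close>)
  moreover have "{} \<in> {X. valid X}" by (simp add: valid_def)
  ultimately obtain X where X: "valid X" "\<And>X'. valid X' \<Longrightarrow> X \<subseteq> X' \<Longrightarrow> X = X'"
    using finite_has_maximal[of "{X. valid X}"] by auto
  have XE: "X \<subseteq> E" and X2: "\<And>g. g \<in> X \<Longrightarrow> card (touch g) = 2"
    and Xd: "\<And>g h. g \<in> X \<Longrightarrow> h \<in> X \<Longrightarrow> g \<noteq> h \<Longrightarrow> touch g \<inter> touch h = {}"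
    using X(1) by (auto simp: valid_def)
  have finX: "finite X" using XE finE finite_subset by blast
  define U where "U = R - (\<Union>g\<in>X. touch g)"
  have UR: "U \<subseteq> R" and finU: "finite U" using finR by (auto simp: U_def)
  have fint: "finite (touch g)" for g using finR by (simp add: touch_def)
  \<comment> \<open>An edge between two rings is an outer edge of both, so their types
    agree.\<close>
  have joint: "touch {x, w} = {e, f} \<and> c {x, w} = \<tau> e \<and> c {x, w} = \<tau> f"
    if "e \<in> R" "f \<in> R" "e \<noteq> f" "x \<in> Q e" "w \<in> Q f" "{x, w} \<in> E" for e f x w
  proof -
    have n: "w \<notin> Q e" "x \<notin> Q f" using dis that by blast+
    have "touch {x, w} = {e, f}" using that uniq unfolding touch_def by blast
    moreover have "c {x, w} = \<tau> e" using outer_colour[OF c ring(1)[OF that(1)], of x w] that n by (simp add: Q_def)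
    moreover have "c {w, x} = \<tau> f" using outer_colour[OF c ring(1)[OF that(2)], of w x] that n by (simp add: Q_def insert_commute)
    ultimately show ?thesis by (simp add: insert_commute)
  qed
  have Xform: "\<exists>e f x w. e \<in> R \<and> f \<in> R \<and> e \<noteq> f \<and> x \<in> Q e \<and> w \<in> Q f \<and> g = {x, w} \<and> touch g = {e, f} \<and>
      c g = \<tau> e \<and> c g = \<tau> f" if g: "g \<in> X" for g
  proof -
    obtain e f where ef: "touch g = {e, f}" "e \<noteq> f" using X2[OF g] by (auto simp: card_2_iff)
    then have "e \<in> touch g" "f \<in> touch g" by auto
    then obtain x w where xw: "e \<in> R" "f \<in> R" "x \<in> g" "x \<in> Q e" "w \<in> g" "w \<in> Q f" by (auto simp: touch_def)
    have "x \<noteq> w" using uniq xw ef(2) by blast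
    have gE: "g \<in> E" using g XE by blast
    obtain w' where "g = {x, w'}" by (rule edge_other[OF gE xw(3)])
    then have gx: "g = {x, w}" using xw(5) \<open>x \<noteq> w\<close> by auto
    have "touch g = {e, f} \<and> c g = \<tau> e \<and> c g = \<tau> f"
      unfolding gx by (rule joint[OF xw(1,2) ef(2) xw(4,6)]) (use gE gx in simp)
    then show ?thesis
      using xw(1,2,4,6) ef(2) gx by (intro exI[of _ e] exI[of _ f] exI[of _ x] exI[of _ w] conjI) simp_all
  qed
  \<comment> \<open>An edge between two leftover rings could be added to \<open>X\<close>, against
    maximality.\<close>
  have indep: "w \<notin> Q f" if "e \<in> U" "f \<in> U" "w \<in> outnb (\<rho> e)" for e f w
  proof
    assume wf: "w \<in> Q f"
    from that(3) obtain x where x: "x \<in> Q e" "{x, w} \<in> E" "w \<notin> Q e" by (auto simp: outnb_def Q_def)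
    have "e \<noteq> f" using x wf by auto
    have ef: "e \<in> R" "f \<in> R" using that UR by auto
    have t: "touch {x, w} = {e, f}" using joint[OF ef \<open>e \<noteq> f\<close> x(1) wf x(2)] by simp
    have no: "touch {x, w} \<inter> touch g = {}" if "g \<in> X" for g
      unfolding t using \<open>e \<in> U\<close> \<open>f \<in> U\<close> that by (auto simp: U_def)
    have "valid (insert {x, w} X)"
      unfolding valid_def
    proof (intro conjI ballI impI)
      show "insert {x, w} X \<subseteq> {g\<in>E. card (touch g) = 2}"
        using x(2) t \<open>e \<noteq> f\<close> XE X2 by auto
      fix g h assume "g \<in> insert {x, w} X" "h \<in> insert {x, w} X" "g \<noteq> h"
      then show "touch g \<inter> touch h = {}" using no Xd by (metis Int_commute insertE)
    qed
    then have "{x, w} \<in> X" using X(2) by blast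
    then show False using no t by blast
  qed
  have disU: "set (\<rho> e) \<inter> set (\<rho> f) = {}" if "e \<in> U" "f \<in> U" "e \<noteq> f" for e f
    using dis[of e f] that UR by (auto simp: Q_def)
  have charge: "8 \<le> real (length (\<rho> e)) + (\<Sum>w\<in>outnb (\<rho> e). 1 / real (card {f\<in>U. w \<in> outnb (\<rho> f)}))"
    if "e \<in> U" for e
    by (rule ring_charge[OF c finU ring(1) disU _ that]) (use UR indep in \<open>auto simp: Q_def\<close>)
  define A where "A = (\<Union>e\<in>U. Q e)"
  define B where "B = (\<Union>e\<in>U. outnb (\<rho> e))"
  have QV: "Q e \<subseteq> V" if "e \<in> R" for e using ring_vertex[OF ring(1)[OF that]] by (auto simp: Q_def)
  have AV: "A \<subseteq> V" using QV UR by (auto simp: A_def)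
  have BV: "B \<subseteq> V" by (auto simp: B_def outnb_def)
  have XV: "\<Union>X \<subseteq> V" using XE edgeD by blast
  have finABX: "finite A" "finite B" "finite (\<Union>X)" using AV BV XV finV finite_subset by blast+
  have "card A = (\<Sum>e\<in>U. card (Q e))"
    unfolding A_def by (rule card_UN_disjoint[OF finU]) (use dis UR in \<open>auto simp: Q_def\<close>)
  also have "\<dots> = (\<Sum>e\<in>U. length (\<rho> e))"
    using ringD(1)[OF ring(1)] UR by (intro sum.cong) (auto simp: Q_def distinct_card)
  finally have cA: "card A = (\<Sum>e\<in>U. length (\<rho> e))" .
  have "8 * real (card U) = (\<Sum>e\<in>U. 8)" by simp
  also have "\<dots> \<le> (\<Sum>e\<in>U. real (length (\<rho> e)) + (\<Sum>w\<in>outnb (\<rho> e). 1 / real (card {f\<in>U. w \<in> outnb (\<rho> f)})))"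
    by (rule sum_mono) (rule charge)
  also have "\<dots> = real (card A) + real (card B)"
    unfolding sum.distrib cA B_def using sum_reciprocal_multiplicity[OF finU, of "\<lambda>e. outnb (\<rho> e)"] finite_outnb by simp
  finally have AB: "8 * card U \<le> card A + card B" by linarith
  have touched: "\<exists>e\<in>touch g. v \<in> Q e" if gv: "g \<in> X" "v \<in> g" for g v
  proof -
    from Xform[OF gv(1)] obtain e f x w where *: "x \<in> Q e" "w \<in> Q f" "g = {x, w}" "touch g = {e, f}"
      by (elim exE conjE) (rule that)
    have "v = x \<or> v = w" using gv(2) *(3) by simp
    moreover have "e \<in> touch g" "f \<in> touch g" using *(4) by simp_all
    ultimately show ?thesis using *(1,2) by blast
  qed
  have Xdisj: "g \<inter> h = {}" if "g \<in> X" "h \<in> X" "g \<noteq> h" for g h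
  proof (rule ccontr)
    assume "g \<inter> h \<noteq> {}"
    then obtain v where v: "v \<in> g" "v \<in> h" by blast
    from touched[OF that(1) v(1)] obtain e where e: "e \<in> touch g" "v \<in> Q e" by blast
    then have "e \<in> touch h" using v by (auto simp: touch_def)
    then show False using e Xd[OF that] by blast
  qed
  have "card (\<Union>g\<in>X. g) = (\<Sum>g\<in>X. card g)"
  proof (rule card_UN_disjoint[OF finX])
    have "finite g" if "g \<in> X" for g using edgeD[of g] that XE finV finite_subset by blast
    then show "\<forall>g\<in>X. finite g" by blast
  qed (use Xdisj in blast)
  also have "\<dots> = (\<Sum>g\<in>X. 2)" using XE edgeD by (intro sum.cong) auto
  finally have cX: "card (\<Union>X) = 2 * card X" by simp
  have AX: "A \<inter> \<Union>X = {}"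
  proof (rule ccontr)
    assume "A \<inter> \<Union>X \<noteq> {}"
    then obtain v e g where v: "e \<in> U" "v \<in> Q e" "g \<in> X" "v \<in> g" by (auto simp: A_def)
    then have "e \<in> touch g" using UR by (auto simp: touch_def)
    then show False using v by (auto simp: U_def)
  qed
  have AB0: "A \<inter> B = {}" using indep by (auto simp: A_def B_def)
  \<comment> \<open>A vertex \<open>v\<close> in both sets lies on a paired ring and has just one
    edge of the colour of its type. Both \<open>{x, v}\<close> and \<open>g\<close> have this
    colour, so they coincide, and then \<open>g\<close> touches the unpaired ring of
    \<open>e\<close>.\<close>
  have BX: "B \<inter> \<Union>X = {}"
  proof (rule ccontr)
    assume "B \<inter> \<Union>X \<noteq> {}"
    then obtain v e g where v: "e \<in> U" "v \<in> outnb (\<rho> e)" "g \<in> X" "v \<in> g" by (auto simp: B_def)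
    obtain x where x: "x \<in> Q e" "{x, v} \<in> E" using v(2) by (auto simp: outnb_def Q_def)
    obtain f where f: "f \<in> touch g" "v \<in> Q f" using touched[OF v(3,4)] by blast
    have fR: "f \<in> R" using f by (simp add: touch_def)
    have eR: "e \<in> R" using v(1) UR by blast
    have "f \<noteq> e" using f v by (auto simp: U_def)
    have cx: "c {x, v} = \<tau> f" using joint[OF eR fR _ x(1) f(2) x(2)] \<open>f \<noteq> e\<close> by simp
    have "c g = \<tau> f" using Xform[OF v(3)] f(1) by auto
    moreover have "\<tau> f \<noteq> 0" using ringD(6)[OF ring(1)[OF fR]] by auto
    ultimately have "{x, v} = g" using goodD[OF opt_good[OF c] x(2) _ _ _ v(4)] cx v(3) XE by auto
    then have "e \<in> touch g" using x(1) eR by (auto simp: touch_def)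
    then show False using v(1,3) by (auto simp: U_def)
  qed
  have "card A + card B + card (\<Union>X) = card (A \<union> B \<union> \<Union>X)"
    using finABX AX AB0 BX by (simp add: card_Un_disjoint Int_Un_distrib2)
  also have "\<dots> \<le> card V" by (rule card_mono[OF finV]) (use AV BV XV in blast)
  finally have n: "8 * card U + 2 * card X \<le> card V" using AB cX by linarith
  \<comment> \<open>A shift along an edge of \<open>X\<close> of colour \<open>s\<close> removes one
    edge from the class, cancelling the contribution of its two rings to
    \<open>colour_class_count\<close>. Only the unpaired rings of type \<open>s\<close>
    remain.\<close>
  have sU: "s \<in> {1..3} \<Longrightarrow> 2 * card E + card R \<le> 2 * nu 2 E (\<lambda>e. e) + card V + card {e\<in>U. \<tau> e = s} + 2 * card R" for s
  proof -
    assume s: "s \<in> {1..3}"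
    let ?X = "{g\<in>X. c g = s}" and ?U = "{e\<in>U. \<tau> e = s}"
    have fX: "finite ?X" using finX by simp
    have tX: "\<tau> e = c g" if "e \<in> touch g" "g \<in> X" for e g using Xform[OF that(2)] that(1) by auto
    have "{e\<in>R. \<tau> e = s} = ?U \<union> (\<Union>g\<in>?X. touch g)"
    proof (intro equalityI subsetI)
      fix e assume e: "e \<in> {e\<in>R. \<tau> e = s}"
      show "e \<in> ?U \<union> (\<Union>g\<in>?X. touch g)"
      proof (cases "e \<in> U")
        case False
        then obtain g where "g \<in> X" "e \<in> touch g" using e by (auto simp: U_def)
        then show ?thesis using tX[of e g] e by auto
      qed (use e in simp)
    next
      fix e assume "e \<in> ?U \<union> (\<Union>g\<in>?X. touch g)"
      then show "e \<in> {e\<in>R. \<tau> e = s}" using UR tX by (auto simp: touch_def)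
    qed
    moreover have "?U \<inter> (\<Union>g\<in>?X. touch g) = {}" by (auto simp: U_def)
    moreover have "card (\<Union>g\<in>?X. touch g) = (\<Sum>g\<in>?X. card (touch g))"
      by (rule card_UN_disjoint[OF fX]) (use fint Xd in auto)
    then have "card (\<Union>g\<in>?X. touch g) = 2 * card ?X" using X2 by simp
    moreover have "finite (\<Union>g\<in>?X. touch g)" using fX fint by blast
    ultimately have t: "card {e\<in>R. \<tau> e = s} = card ?U + 2 * card ?X"
      using finU by (simp add: card_Un_disjoint)
    have cnt: "card V + card {e\<in>R. \<tau> e = s} = 2 * card (colour_class c s) + card R"
      unfolding R_def by (rule colour_class_count[OF c _ s]) (use ring in \<open>auto simp: R_def\<close>)
    have "\<forall>g\<in>?X. \<exists>p. touch g = {fst p, snd p} \<and> fst p \<noteq> snd p"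
      using X2 by (auto simp: card_2_iff)
    then obtain D where D: "\<And>g. g \<in> ?X \<Longrightarrow> touch g = {fst (D g), snd (D g)} \<and> fst (D g) \<noteq> snd (D g)"
      by metis
    have D': "fst (D g) \<in> touch g" "snd (D g) \<in> touch g" "fst (D g) \<noteq> snd (D g)" if "g \<in> ?X" for g using D[OF that] by auto
    have "\<exists>c'. opt c' \<and> card (colour_class c' s) + card ?X = card (colour_class c s)"
    proof (rule multishift[OF fX c])
      fix g assume g: "g \<in> ?X"
      have gR: "fst (D g) \<in> R" "snd (D g) \<in> R" "g \<inter> Q (fst (D g)) \<noteq> {}" "g \<inter> Q (snd (D g)) \<noteq> {}"
        using D'(1,2)[OF g] by (auto simp: touch_def)
      have "\<tau> (fst (D g)) = s" "\<tau> (snd (D g)) = s" using tX[of _ g] D'[OF g] g by auto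
      then show "g \<in> E \<and> ring c s (\<rho> (fst (D g))) \<and> ring c s (\<rho> (snd (D g))) \<and>
          set (\<rho> (fst (D g))) \<inter> set (\<rho> (snd (D g))) = {} \<and>
          g \<inter> set (\<rho> (fst (D g))) \<noteq> {} \<and> g \<inter> set (\<rho> (snd (D g))) \<noteq> {}"
        using ring(1)[OF gR(1)] ring(1)[OF gR(2)] dis[OF gR(1,2) D'(3)[OF g]] gR(3,4) g XE
        by (auto simp: Q_def)
    next
      fix g h assume gh: "g \<in> ?X" "h \<in> ?X" "g \<noteq> h"
      have "Q e \<inter> Q f = {}" if "e \<in> touch g" "f \<in> touch h" for e f
      proof (rule dis)
        show "e \<in> R" "f \<in> R" using that by (auto simp: touch_def)
        show "e \<noteq> f" using that Xd[of g h] gh by blast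
      qed
      then show "(set (\<rho> (fst (D g))) \<union> set (\<rho> (snd (D g)))) \<inter> (set (\<rho> (fst (D h))) \<union> set (\<rho> (snd (D h)))) = {}"
        using D'(1,2)[OF gh(1)] D'(1,2)[OF gh(2)] unfolding Q_def by blast
    qed
    then obtain c' where c': "opt c'" "card (colour_class c' s) + card ?X = card (colour_class c s)" by blast
    have "card (unc c') = card R" using c c'(1) unfolding opt_def R_def by (meson le_antisym)
    then show "2 * card E + card R \<le> 2 * nu 2 E (\<lambda>e. e) + card V + card ?U + 2 * card R"
      using nu2_ge[OF opt_good[OF c'(1)] s] c'(2) cnt t by linarith
  qed
  have "card U = card {e\<in>U. \<tau> e = 1} + card {e\<in>U. \<tau> e = 2} + card {e\<in>U. \<tau> e = 3}"
  proof -
    have "\<tau> e \<in> {1..3}" if "e \<in> U" for e using ringD(6)[OF ring(1)] that UR by blast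
    then have "\<tau> e = 1 \<or> \<tau> e = 2 \<or> \<tau> e = 3" if "e \<in> U" for e using that by force
    then have "U = {e\<in>U. \<tau> e = 1} \<union> {e\<in>U. \<tau> e = 2} \<union> {e\<in>U. \<tau> e = 3}" by blast
    then have "card U = card ({e\<in>U. \<tau> e = 1} \<union> {e\<in>U. \<tau> e = 2} \<union> {e\<in>U. \<tau> e = 3})" by simp
    then show ?thesis using finU by (simp add: card_Un_disjoint disjoint_iff)
  qed
  moreover have "card R = card U + 2 * card X"
  proof -
    have "card (\<Union>g\<in>X. touch g) = (\<Sum>g\<in>X. card (touch g))"
      by (rule card_UN_disjoint[OF finX]) (use fint Xd in auto)
    also have "\<dots> = 2 * card X" using X2 by simp
    finally have "card (\<Union>g\<in>X. touch g) = 2 * card X" .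
    moreover have "R = U \<union> (\<Union>g\<in>X. touch g)" by (auto simp: U_def touch_def)
    moreover have "U \<inter> (\<Union>g\<in>X. touch g) = {}" by (auto simp: U_def)
    ultimately show ?thesis using finU finX fint by (metis card_Un_disjoint finite_UN)
  qed
  ultimately show ?thesis
    using sU[of 1] sU[of 2] sU[of 3] n nu3 card_edges by simp
qed

end

section \<open>Reductions\<close>

definition in_digon :: "'e set \<Rightarrow> ('e \<Rightarrow> 'v set) \<Rightarrow> 'v \<Rightarrow> bool" where
  "in_digon E inc v \<longleftrightarrow> (\<exists>e\<in>E. \<exists>f\<in>E. e \<noteq> f \<and> inc e = inc f \<and> v \<in> inc e)"

text \<open>In a multigraph without loops the three vertices are automatically distinct.\<close>

definition in_triangle :: "'e set \<Rightarrow> ('e \<Rightarrow> 'v set) \<Rightarrow> 'v \<Rightarrow> bool" where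
  "in_triangle E inc v \<longleftrightarrow> (\<exists>s t. adj E inc v s \<and> adj E inc s t \<and> adj E inc t v)"

text \<open>Weights record how many vertices of the original graph a vertex stands for.  A vertex of
  weight below three can still be absorbed by a reduction.\<close>

definition reducible_weights :: "'v set \<Rightarrow> 'e set \<Rightarrow> ('e \<Rightarrow> 'v set) \<Rightarrow> ('v \<Rightarrow> nat) \<Rightarrow> bool" where
  "reducible_weights V E inc w \<longleftrightarrow> multigraph V E inc \<and> cubic V E inc \<and> cut_bridgeless V E inc \<and>
    (\<forall>v\<in>V. 1 \<le> w v \<and> (3 \<le> w v \<or> in_digon E inc v \<or> in_triangle E inc v))"

text \<open>This is \<open>141 (n - \<nu>\<^sub>2) \<le> W + 70 (|E| - \<nu>\<^sub>3)\<close> without truncated subtraction.\<close>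

definition weighted_bound :: "'v set \<Rightarrow> 'e set \<Rightarrow> ('e \<Rightarrow> 'v set) \<Rightarrow> ('v \<Rightarrow> nat) \<Rightarrow> bool" where
  "weighted_bound V E inc w \<longleftrightarrow>
    141 * card V + 70 * nu 3 E inc \<le> 141 * nu 2 E inc + (\<Sum>v\<in>V. w v) + 70 * card E"

text \<open>All three reductions remove two vertices and three edges. Regaining two edges for
  \<open>nu 2\<close> keeps \<open>n - nu 2\<close> of the larger graph from exceeding that of the
  smaller one, and transferring partial colourings does the opposite for
  \<open>|E| - nu 3\<close>.\<close>

lemma weighted_bound_lift:
  assumes "finite E" "finite E'" "card V = card V' + 2" "card E = card E' + 3"
    and "(\<Sum>v\<in>V'. w' v) \<le> (\<Sum>v\<in>V. w v)"
    and two: "\<And>F'. F' \<subseteq> E' \<Longrightarrow> k_edge_colorable 2 F' inc' \<Longrightarrow>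
      \<exists>F\<subseteq>E. k_edge_colorable 2 F inc \<and> card F = card F' + 2"
    and three: "\<And>c. partial_colouring E inc c \<Longrightarrow>
      \<exists>c'. partial_colouring E' inc' c' \<and> card (uncoloured E' c') \<le> card (uncoloured E c)"
    and "weighted_bound V' E' inc' w'"
  shows "weighted_bound V E inc w"
proof -
  obtain F' where F': "F' \<subseteq> E'" "k_edge_colorable 2 F' inc'" "card F' = nu 2 E' inc'"
    by (rule nu_attained[OF assms(2)])
  obtain F where F: "F \<subseteq> E" "k_edge_colorable 2 F inc" "card F = card F' + 2" using two[OF F'(1,2)] by blast
  have 2: "nu 2 E' inc' + 2 \<le> nu 2 E inc" using nu_ge[OF assms(1) F(1,2)] F(3) F'(3) by simp
  obtain c where c: "partial_colouring E inc c" "card E = nu 3 E inc + card (uncoloured E c)"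
    by (rule nu3_colouring[OF assms(1)])
  obtain c' where c': "partial_colouring E' inc' c'" "card (uncoloured E' c') \<le> card (uncoloured E c)"
    using three[OF c(1)] by blast
  have "nu 3 E inc \<le> nu 3 E' inc' + 3" using colouring_le_nu3[OF assms(2) c'(1)] c(2) c'(2) assms(4) by linarith
  then show ?thesis using 2 assms(3-5,8) unfolding weighted_bound_def by linarith
qed

lemma multigraphD:
  assumes "multigraph V E inc"
  shows "finite V" "finite E" "e \<in> E \<Longrightarrow> inc e \<subseteq> V" "e \<in> E \<Longrightarrow> card (inc e) = 2"
  using assms by (auto simp: multigraph_def)

lemma cubicD: "cubic V E inc \<Longrightarrow> v \<in> V \<Longrightarrow> card {e\<in>E. v \<in> inc e} = 3"
  by (simp add: cubic_def degree_def)

lemma edge_ends: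
  assumes "multigraph V E inc" "e \<in> E" "x \<in> inc e"
  obtains y where "inc e = {x, y}" "x \<noteq> y" "y \<in> V"
proof -
  obtain a b where ab: "inc e = {a, b}" "a \<noteq> b" using multigraphD(4)[OF assms(1,2)] by (auto simp: card_2_iff)
  then have "a \<in> V" "b \<in> V" using multigraphD(3)[OF assms(1,2)] by auto
  then show thesis using that ab assms(3) by (auto simp: insert_commute)
qed

lemma edges_at:
  assumes "multigraph V E inc" "cubic V E inc" "v \<in> V" "D \<subseteq> {e\<in>E. v \<in> inc e}" "card D = 3"
  shows "{e\<in>E. v \<in> inc e} = D"
  using card_seteq[OF _ assms(4)] cubicD[OF assms(2,3)] assms(5) multigraphD(2)[OF assms(1)] by auto

lemma third_edge:
  assumes g: "multigraph V E inc" "cubic V E inc" "v \<in> V"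
    and e: "e \<in> E" "f \<in> E" "v \<in> inc e" "v \<in> inc f" "e \<noteq> f"
  obtains h where "{k\<in>E. v \<in> inc k} = {e, f, h}" "h \<in> E" "v \<in> inc h" "h \<noteq> e" "h \<noteq> f"
proof -
  let ?D = "{k\<in>E. v \<in> inc k}"
  have "card (?D - {e, f}) = 1"
    using cubicD[OF g(2,3)] e by (simp add: card_Diff_subset)
  then obtain h where h: "?D - {e, f} = {h}" by (auto simp: card_1_singleton_iff)
  then have "h \<in> ?D - {e, f}" by simp
  moreover then have "{e, f, h} \<subseteq> ?D" using e by auto
  then have "?D = {e, f, h}"
    by (rule edges_at[OF g]) (use e calculation in auto)
  ultimately show thesis using that by blast
qed

text \<open>Common to all reductions: the vertex \<open>t0\<close> is free, and the two new edges
  there take different colours. For parallel edges \<open>t1\<close> and \<open>t2\<close>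
  coincide.\<close>

lemma two_edge_extension:
  assumes col: "\<And>k. k \<in> F \<Longrightarrow> col k < (2::nat)"
    "\<And>k l. k \<in> F \<Longrightarrow> l \<in> F \<Longrightarrow> k \<noteq> l \<Longrightarrow> inc k \<inter> inc l \<noteq> {} \<Longrightarrow> col k \<noteq> col l"
    and F: "F \<subseteq> E" "finite E" "e1 \<in> E" "e2 \<in> E"
    and e: "e1 \<notin> F" "e2 \<notin> F" "e1 \<noteq> e2" "inc e1 = {t1, t0}" "inc e2 = {t2, t0}"
    and t0: "\<And>k. k \<in> F \<Longrightarrow> t0 \<notin> inc k" and i: "i < 2"
    and t1: "\<And>k. k \<in> F \<Longrightarrow> t1 \<in> inc k \<Longrightarrow> col k \<noteq> i"
    and t2: "\<And>k. k \<in> F \<Longrightarrow> t2 \<in> inc k \<Longrightarrow> col k \<noteq> 1 - i"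
  shows "\<exists>H\<subseteq>E. k_edge_colorable 2 H inc \<and> card H = card F + 2"
proof (intro exI[of _ "insert e1 (insert e2 F)"] conjI)
  show "insert e1 (insert e2 F) \<subseteq> E" using F by blast
  show "card (insert e1 (insert e2 F)) = card F + 2"
    using finite_subset[OF F(1,2)] e(1-3) by simp
  define c where "c = col(e1 := i, e2 := 1 - i)"
  have ce: "c e1 = i" "c e2 = 1 - i" using e(3) by (auto simp: c_def)
  have cF: "c k = col k" if "k \<in> F" for k using that e by (auto simp: c_def)
  have mixed: "c k \<noteq> c l" if "k \<in> {e1, e2}" "l \<in> F" "inc k \<inter> inc l \<noteq> {}" for k l
    using that t0[OF that(2)] t1[OF that(2)] t2[OF that(2)] e(4,5) ce cF[OF that(2)] by auto
  have both: "c e1 \<noteq> c e2" using ce i by arith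
  show "k_edge_colorable 2 (insert e1 (insert e2 F)) inc"
    unfolding k_edge_colorable_def
  proof (intro exI[of _ c] conjI ballI impI)
    fix k assume k: "k \<in> insert e1 (insert e2 F)"
    then show "c k < 2" using ce cF col(1) i by auto
    fix l assume l: "l \<in> insert e1 (insert e2 F)" and kl: "k \<noteq> l \<and> inc k \<inter> inc l \<noteq> {}"
    consider "k \<in> {e1, e2}" "l \<in> {e1, e2}" | "k \<in> {e1, e2}" "l \<in> F" | "l \<in> {e1, e2}" "k \<in> F" | "k \<in> F" "l \<in> F"
      using k l by blast
    then show "c k \<noteq> c l"
    proof cases
      case 1 then show ?thesis using kl both by auto
    next
      case 2 then show ?thesis using mixed kl by blast
    next
      case 3 then show ?thesis using mixed[of l k] kl by (metis Int_commute)
    next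
      case 4 then show ?thesis using col(2)[OF 4] kl cF by simp
    qed
  qed
qed

text \<open>Three parallel edges exhaust the degree of both ends, which therefore form a component
  of their own; a 2-edge-colouring can use two of the three edges.\<close>

lemma reduce_triple_edge:
  fixes V :: "'v set" and E :: "'e set"
  assumes R: "reducible_weights V E inc w"
    and e: "e \<in> E" "f \<in> E" "g \<in> E" "e \<noteq> f" "e \<noteq> g" "f \<noteq> g" "inc f = inc e" "inc g = inc e"
  shows "\<exists>(V' :: 'v set) (E' :: 'e set) inc' w'. card V' < card V \<and> reducible_weights V' E' inc' w' \<and>
    (weighted_bound V' E' inc' w' \<longrightarrow> weighted_bound V E inc w)"
proof -
  have G: "multigraph V E inc" "cubic V E inc" "cut_bridgeless V E inc"
    and W: "\<And>v. v \<in> V \<Longrightarrow> 1 \<le> w v" "\<And>v. v \<in> V \<Longrightarrow> 3 \<le> w v \<or> in_digon E inc v \<or> in_triangle E inc v"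
    using R by (auto simp: reducible_weights_def)
  note fin = multigraphD(1,2)[OF G(1)]
  define V' where "V' = V - inc e"
  define E' where "E' = E - {e, f, g}"
  have i2: "inc e \<subseteq> V" "card (inc e) = 2" using multigraphD(3,4)[OF G(1) e(1)] by auto
  have cV: "card V = card V' + 2"
    using i2 fin card_mono[OF fin(1) i2(1)] by (simp add: V'_def card_Diff_subset finite_subset)
  have cE: "card E = card E' + 3"
    using e fin card_mono[of E "{e, f, g}"] by (simp add: E'_def card_Diff_subset)
  have at: "{k\<in>E. v \<in> inc k} = {e, f, g}" if "v \<in> inc e" for v
    by (rule edges_at[OF G(1,2)]) (use that i2 e in auto)
  have away: "inc k \<inter> inc e = {}" if "k \<in> E'" for k
  proof (rule ccontr)
    assume "inc k \<inter> inc e \<noteq> {}"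
    then obtain v where "v \<in> inc k" "v \<in> inc e" by blast
    then have "k \<in> {e, f, g}" using at[of v] that by (auto simp: E'_def)
    then show False using that by (simp add: E'_def)
  qed
  have E'E: "k \<in> E' \<longleftrightarrow> k \<in> E \<and> k \<noteq> e \<and> k \<noteq> f \<and> k \<noteq> g" for k by (auto simp: E'_def)
  have out: "k \<in> E'" if "k \<in> E" "v \<in> inc k" "v \<notin> inc e" for k v
    using that e by (auto simp: E'_def)
  have R': "reducible_weights V' E' inc w"
    unfolding reducible_weights_def
  proof (intro conjI ballI)
    show "multigraph V' E' inc"
      unfolding multigraph_def
    proof (intro conjI ballI)
      show "finite V'" "finite E'" using fin by (auto simp: V'_def E'_def)
      fix k assume k: "k \<in> E'"
      then show "card (inc k) = 2" "inc k \<subseteq> V'"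
        using multigraphD(3,4)[OF G(1), of k] away[OF k] by (auto simp: E'E V'_def)
    qed
    show "cubic V' E' inc"
      unfolding cubic_def degree_def
    proof
      fix v assume v: "v \<in> V'"
      then have "{k\<in>E'. v \<in> inc k} = {k\<in>E. v \<in> inc k}" using out by (auto simp: E'E V'_def)
      then show "card {k\<in>E'. v \<in> inc k} = 3" using cubicD[OF G(2), of v] v by (simp add: V'_def)
    qed
    show "cut_bridgeless V' E' inc"
      unfolding cut_bridgeless_def
    proof (intro allI impI)
      fix S assume S: "S \<subseteq> V'"
      then have "inc e \<inter> S = {}" by (auto simp: V'_def)
      then have "{k\<in>E'. card (inc k \<inter> S) = 1} = {k\<in>E. card (inc k \<inter> S) = 1}"
        using e(7,8) by (auto simp: E'E)
      moreover have "S \<subseteq> V" using S by (auto simp: V'_def)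
      ultimately show "card {k\<in>E'. card (inc k \<inter> S) = 1} \<noteq> 1" using G(3) by (simp add: cut_bridgeless_def)
    qed
    fix v assume v: "v \<in> V'"
    then have vV: "v \<in> V" "v \<notin> inc e" by (auto simp: V'_def)
    show "1 \<le> w v" by (rule W(1)[OF vV(1)])
    have "in_digon E' inc v" if "in_digon E inc v"
      using that out vV(2) unfolding in_digon_def by metis
    moreover have "in_triangle E' inc v" if tv: "in_triangle E inc v"
    proof -
      obtain s t k1 k2 k3 where k: "k1 \<in> E" "inc k1 = {v, s}" "k2 \<in> E" "inc k2 = {s, t}" "k3 \<in> E" "inc k3 = {t, v}"
        using tv unfolding in_triangle_def adj_def by blast
      have "k1 \<in> E'" "k3 \<in> E'" using out[of k1 v] out[of k3 v] k vV by auto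
      moreover have "s \<notin> inc e" using away[OF \<open>k1 \<in> E'\<close>] k by auto
      then have "k2 \<in> E'" using out[of k2 s] k by auto
      ultimately show ?thesis using k unfolding in_triangle_def adj_def by blast
    qed
    ultimately show "3 \<le> w v \<or> in_digon E' inc v \<or> in_triangle E' inc v" using W(2)[OF vV(1)] by blast
  qed
  have "weighted_bound V E inc w" if "weighted_bound V' E' inc w"
  proof (rule weighted_bound_lift[OF fin(2) _ cV cE _ _ _ that])
    show finE': "finite E'" using fin by (simp add: E'_def)
    show "sum w V' \<le> sum w V" by (rule sum_mono2) (use fin in \<open>auto simp: V'_def\<close>)
    show "\<exists>F\<subseteq>E. k_edge_colorable 2 F inc \<and> card F = card F' + 2"
      if F': "F' \<subseteq> E'" "k_edge_colorable 2 F' inc" for F'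
    proof -
      obtain col where col: "\<And>k. k \<in> F' \<Longrightarrow> col k < (2::nat)"
        "\<And>k l. k \<in> F' \<Longrightarrow> l \<in> F' \<Longrightarrow> k \<noteq> l \<Longrightarrow> inc k \<inter> inc l \<noteq> {} \<Longrightarrow> col k \<noteq> col l"
        using F'(2) unfolding k_edge_colorable_def by metis
      obtain u v where uv: "inc e = {v, u}" using i2(2) by (auto simp: card_2_iff)
      have aw: "u \<notin> inc k" "v \<notin> inc k" if "k \<in> F'" for k using away[of k] that F'(1) uv by auto
      show ?thesis
      proof (rule two_edge_extension[where F = F' and col = col and inc = inc and ?e1.0 = e and ?e2.0 = f
            and ?t0.0 = u and ?t1.0 = v and ?t2.0 = v and i = 0])
        show "col k \<noteq> col l" if "k \<in> F'" "l \<in> F'" "k \<noteq> l" "inc k \<inter> inc l \<noteq> {}" for k l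
          by (rule col(2)[OF that])
      qed (use col(1) F'(1) fin(2) aw uv e in \<open>auto simp: E'E\<close>)
    qed
    show "\<exists>c'. partial_colouring E' inc c' \<and> card (uncoloured E' c') \<le> card (uncoloured E c)"
      if c: "partial_colouring E inc c" for c
    proof (intro exI[of _ c] conjI)
      show "partial_colouring E' inc c" using c unfolding partial_colouring_def E'_def by blast
      show "card (uncoloured E' c) \<le> card (uncoloured E c)"
        by (rule card_mono) (use fin in \<open>auto simp: uncoloured_def E'E\<close>)
    qed
  qed
  then show ?thesis using R' cV by (intro exI[of _ V'] exI[of _ E'] exI[of _ inc] exI[of _ w]) auto
qed

text \<open>The passage from \<open>x\<close> through the digon to \<open>y\<close> becomes a single
  edge, which reuses the name \<open>h\<close>. Digons and triangles at the surviving vertices avoid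
  \<open>u\<close> and \<open>v\<close>, so vertices of small weight stay reducible.\<close>

lemma reduce_digon:
  fixes V :: "'v set" and E :: "'e set"
  assumes R: "reducible_weights V E inc w"
    and e: "e \<in> E" "f \<in> E" "e \<noteq> f" "inc f = inc e"
    and nt: "\<And>g. g \<in> E \<Longrightarrow> inc g = inc e \<Longrightarrow> g = e \<or> g = f"
  shows "\<exists>(V' :: 'v set) (E' :: 'e set) inc' w'. card V' < card V \<and> reducible_weights V' E' inc' w' \<and>
    (weighted_bound V' E' inc' w' \<longrightarrow> weighted_bound V E inc w)"
proof -
  have G: "multigraph V E inc" "cubic V E inc" "cut_bridgeless V E inc"
    and W: "\<And>v. v \<in> V \<Longrightarrow> 1 \<le> w v" "\<And>v. v \<in> V \<Longrightarrow> 3 \<le> w v \<or> in_digon E inc v \<or> in_triangle E inc v"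
    using R by (auto simp: reducible_weights_def)
  note fin = multigraphD(1,2)[OF G(1)]
  obtain u v where uv: "inc e = {u, v}" "u \<noteq> v" using multigraphD(4)[OF G(1) e(1)] by (auto simp: card_2_iff)
  then have V: "u \<in> V" "v \<in> V" using multigraphD(3)[OF G(1) e(1)] by auto
  obtain g where g: "{k\<in>E. u \<in> inc k} = {e, f, g}" "g \<in> E" "u \<in> inc g" "g \<noteq> e" "g \<noteq> f"
    by (rule third_edge[OF G(1,2) V(1) e(1,2) _ _ e(3)]) (use uv e in auto)
  obtain h where h: "{k\<in>E. v \<in> inc k} = {e, f, h}" "h \<in> E" "v \<in> inc h" "h \<noteq> e" "h \<noteq> f"
    by (rule third_edge[OF G(1,2) V(2) e(1,2) _ _ e(3)]) (use uv e in auto)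
  obtain x where x: "inc g = {u, x}" "u \<noteq> x" "x \<in> V" by (rule edge_ends[OF G(1) g(2,3)])
  obtain y where y: "inc h = {v, y}" "v \<noteq> y" "y \<in> V" by (rule edge_ends[OF G(1) h(2,3)])
  have xv: "x \<noteq> v" using nt[OF g(2)] g(4,5) x uv by auto
  have yu: "y \<noteq> u" using nt[OF h(2)] h(4,5) y uv by (auto simp: insert_commute)
  have gh: "g \<noteq> h" using x y xv uv by (auto simp: doubleton_eq_iff)
  have atu: "k = e \<or> k = f \<or> k = g" if "k \<in> E" "u \<in> inc k" for k
  proof -
    have "k \<in> {e, f, g}" using that by (simp flip: g(1))
    then show ?thesis by simp
  qed
  have atv: "k = e \<or> k = f \<or> k = h" if "k \<in> E" "v \<in> inc k" for k
  proof -
    have "k \<in> {e, f, h}" using that by (simp flip: h(1))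
    then show ?thesis by simp
  qed
  \<comment> \<open>If both outer edges ended in the same vertex \<open>x\<close>, the third edge at
    \<open>x\<close> would be the only one leaving \<open>{u, v, x}\<close>.\<close>
  have xy: "x \<noteq> y"
  proof
    assume xy: "x = y"
    obtain k where k: "{l\<in>E. x \<in> inc l} = {g, h, k}" "k \<in> E" "x \<in> inc k" "k \<noteq> g" "k \<noteq> h"
      by (rule third_edge[OF G(1,2) x(3) g(2) h(2) _ _ gh]) (use x y xy in auto)
    have ke: "k \<noteq> e" "k \<noteq> f" using k(3) uv e(4) x(2) xv by auto
    obtain z where z: "inc k = {x, z}" "x \<noteq> z" by (rule edge_ends[OF G(1) k(2,3)])
    have "u \<notin> inc k" "v \<notin> inc k" using atu[OF k(2)] atv[OF k(2)] ke k(4,5) by auto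
    then have kz: "inc k \<inter> {u, v, x} = {x}" using z by auto
    have "{l\<in>E. card (inc l \<inter> {u, v, x}) = 1} = {k}"
    proof (intro equalityI subsetI)
      fix l assume "l \<in> {l\<in>E. card (inc l \<inter> {u, v, x}) = 1}"
      then have l: "l \<in> E" "card (inc l \<inter> {u, v, x}) = 1" by auto
      have "l \<noteq> e" "l \<noteq> f" "l \<noteq> g" "l \<noteq> h" using l(2) uv e(4) x y xy by auto
      then have "u \<notin> inc l" "v \<notin> inc l" using atu[OF l(1)] atv[OF l(1)] by auto
      then have "x \<in> inc l" using l(2) by (cases "x \<in> inc l") auto
      then have "l \<in> {g, h, k}" using l(1) by (simp flip: k(1))
      then show "l \<in> {k}" using \<open>l \<noteq> g\<close> \<open>l \<noteq> h\<close> by simp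
    qed (use k(2) kz in simp)
    then have "card {l\<in>E. card (inc l \<inter> {u, v, x}) = 1} = 1" by simp
    moreover have "{u, v, x} \<subseteq> V" using V x by auto
    ultimately show False using G(3) unfolding cut_bridgeless_def by blast
  qed
  define V' where "V' = V - {u, v}"
  define E' where "E' = E - {e, f, g}"
  define inc' where "inc' = inc(h := {x, y})"
  have cV: "card V = card V' + 2"
    using V uv(2) fin card_mono[of V "{u, v}"] by (simp add: V'_def card_Diff_subset)
  have cE: "card E = card E' + 3"
    using e g fin card_mono[of E "{e, f, g}"] by (simp add: E'_def card_Diff_subset)
  have E'E: "k \<in> E' \<longleftrightarrow> k \<in> E \<and> k \<noteq> e \<and> k \<noteq> f \<and> k \<noteq> g" for k by (auto simp: E'_def)
  have hE': "h \<in> E'" using h gh by (auto simp: E'E)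
  have away: "u \<notin> inc k" "v \<notin> inc k" if "k \<in> E'" "k \<noteq> h" for k
    using atu[of k] atv[of k] that by (auto simp: E'E)
  have inc'k: "inc' k = inc k" if "k \<noteq> h" for k using that by (simp add: inc'_def)
  have inc'h: "inc' h = {x, y}" by (simp add: inc'_def)
  have nbu: "a = v \<or> a = x" if "k \<in> E" "inc k = {u, a}" for k a
    using atu[of k] that uv(1) e(4) x(1,2) uv(2) by (auto simp: doubleton_eq_iff)
  have nbv: "a = u \<or> a = y" if "k \<in> E" "inc k = {v, a}" for k a
    using atv[of k] that uv(1) e(4) y(1,2) uv(2) by (auto simp: doubleton_eq_iff)
  have R': "reducible_weights V' E' inc' w"
    unfolding reducible_weights_def
  proof (intro conjI ballI)
    show "multigraph V' E' inc'"
      unfolding multigraph_def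
    proof (intro conjI ballI)
      show "finite V'" "finite E'" using fin by (auto simp: V'_def E'_def)
      fix k assume k: "k \<in> E'"
      show "inc' k \<subseteq> V'"
      proof (cases "k = h")
        case True then show ?thesis using inc'h x y xv yu by (auto simp: V'_def)
      next
        case False
        then show ?thesis using inc'k[OF False] away[OF k False] multigraphD(3)[OF G(1), of k] k by (auto simp: V'_def E'E)
      qed
      show "card (inc' k) = 2"
        using inc'h xy inc'k[of k] multigraphD(4)[OF G(1), of k] k by (cases "k = h") (auto simp: E'E)
    qed
    show "cubic V' E' inc'"
      unfolding cubic_def degree_def
    proof
      fix z assume z: "z \<in> V'"
      then have z': "z \<in> V" "z \<noteq> u" "z \<noteq> v" by (auto simp: V'_def)
      show "card {k\<in>E'. z \<in> inc' k} = 3"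
      proof (cases "z = x")
        case True
        have "{k\<in>E'. z \<in> inc' k} = insert h ({k\<in>E. z \<in> inc k} - {g})"
        proof (rule set_eqI)
          fix k
          show "k \<in> {k\<in>E'. z \<in> inc' k} \<longleftrightarrow> k \<in> insert h ({k\<in>E. z \<in> inc k} - {g})"
            using True hE' inc'h inc'k[of k] uv e(4) z' by (cases "k = h") (auto simp: E'E)
        qed
        moreover have "h \<notin> {k\<in>E. z \<in> inc k}" using True y xy xv by auto
        moreover have "g \<in> {k\<in>E. z \<in> inc k}" using True g x by auto
        moreover have "finite {k\<in>E. z \<in> inc k}" using fin by simp
        ultimately have "card {k\<in>E'. z \<in> inc' k} = Suc (card ({k\<in>E. z \<in> inc k} - {g}))"
          "Suc (card ({k\<in>E. z \<in> inc k} - {g})) = card {k\<in>E. z \<in> inc k}"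
          by (simp_all only: card_insert_disjoint[of "{k\<in>E. z \<in> inc k} - {g}"] card_Suc_Diff1 Diff_iff finite_Diff simp_thms)
        then show ?thesis using cubicD[OF G(2) z'(1)] by simp
      next
        case False
        have "{k\<in>E'. z \<in> inc' k} = {k\<in>E. z \<in> inc k}"
        proof (rule Collect_cong)
          fix k
          show "k \<in> E' \<and> z \<in> inc' k \<longleftrightarrow> k \<in> E \<and> z \<in> inc k"
          proof (cases "k = h")
            case True then show ?thesis using hE' h(2) inc'h y z' \<open>z \<noteq> x\<close> by auto
          next
            case k: False
            then show ?thesis using inc'k[OF k] uv e(4) x z' False by (auto simp: E'E)
          qed
        qed
        then show ?thesis using cubicD[OF G(2) z'(1)] by simp
      qed
    qed
    show "cut_bridgeless V' E' inc'"
      unfolding cut_bridgeless_def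
    proof (intro allI impI)
      fix S assume S: "S \<subseteq> V'"
      \<comment> \<open>\<open>u\<close> and \<open>v\<close> join the side of \<open>x\<close>, so
        \<open>e\<close>, \<open>f\<close>, \<open>g\<close> do not cross and \<open>h\<close>
        crosses exactly when the new edge does.\<close>
      define S0 where "S0 = (if x \<in> S then S \<union> {u, v} else S)"
      have nS: "u \<notin> S" "v \<notin> S" using S by (auto simp: V'_def)
      have S0: "u \<in> S0 \<longleftrightarrow> x \<in> S" "v \<in> S0 \<longleftrightarrow> x \<in> S" "x \<in> S0 \<longleftrightarrow> x \<in> S" "y \<in> S0 \<longleftrightarrow> y \<in> S"
        using nS yu y(2) by (auto simp: S0_def)
      have card2: "card ({a, b} \<inter> A) = 1 \<longleftrightarrow> (a \<in> A) \<noteq> (b \<in> A)" if "a \<noteq> b" for a b :: 'v and A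
        using that by (cases "a \<in> A"; cases "b \<in> A") auto
      have "{k\<in>E'. card (inc' k \<inter> S) = 1} = {k\<in>E. card (inc k \<inter> S0) = 1}"
      proof (rule Collect_cong)
        fix k
        consider "k = h" | "k = e \<or> k = f" | "k = g" | "k \<noteq> h" "k \<noteq> e" "k \<noteq> f" "k \<noteq> g" by blast
        then show "k \<in> E' \<and> card (inc' k \<inter> S) = 1 \<longleftrightarrow> k \<in> E \<and> card (inc k \<inter> S0) = 1"
        proof cases
          case 1
          have "card (inc' h \<inter> S) = 1 \<longleftrightarrow> card (inc h \<inter> S0) = 1"
            unfolding y(1) inc'h card2[OF xy] card2[OF y(2)] using S0 by simp
          then show ?thesis using 1 hE' h(2) by simp
        next
          case 2
          then have ik: "inc k = {u, v}" using uv(1) e(4) by auto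
          have "card (inc k \<inter> S0) \<noteq> 1" unfolding ik card2[OF uv(2)] using S0 by simp
          then show ?thesis using 2 by (auto simp: E'E)
        next
          case 3
          have "card (inc g \<inter> S0) \<noteq> 1" unfolding x(1) card2[OF x(2)] using S0 by simp
          then show ?thesis using 3 by (auto simp: E'E)
        next
          case 4
          have "inc k \<inter> S0 = inc k \<inter> S" if "k \<in> E"
            using away[of k] 4 that by (auto simp: S0_def E'E)
          then show ?thesis using 4 inc'k[OF 4(1)] by (auto simp: E'E)
        qed
      qed
      moreover have "S0 \<subseteq> V" using S V by (auto simp: S0_def V'_def)
      ultimately show "card {k\<in>E'. card (inc' k \<inter> S) = 1} \<noteq> 1" using G(3) by (simp add: cut_bridgeless_def)
    qed
    fix z assume z: "z \<in> V'"
    then have z': "z \<in> V" "z \<noteq> u" "z \<noteq> v" by (auto simp: V'_def)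
    show "1 \<le> w z" by (rule W(1)[OF z'(1)])
    have keep: "k \<in> E' \<and> inc' k = inc k" if "k \<in> E" "u \<notin> inc k" "v \<notin> inc k" for k
      using that uv e(4) x(1) y(1) inc'k[of k] by (auto simp: E'E)
    have "in_digon E' inc' z" if dz: "in_digon E inc z"
    proof -
      obtain k l where kl: "k \<in> E" "l \<in> E" "k \<noteq> l" "inc k = inc l" "z \<in> inc k"
        using dz unfolding in_digon_def by blast
      have ne: "inc k \<noteq> {u, v}" using kl(5) z' by auto
      have "u \<notin> inc k"
      proof
        assume "u \<in> inc k"
        then have "k = g" "l = g" using atu[OF kl(1)] atu[OF kl(2)] kl(4) ne uv(1) e(4) by auto
        then show False using kl(3) by simp
      qed
      moreover have "v \<notin> inc k"
      proof
        assume "v \<in> inc k"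
        then have "k = h" "l = h" using atv[OF kl(1)] atv[OF kl(2)] kl(4) ne uv(1) e(4) by auto
        then show False using kl(3) by simp
      qed
      ultimately have "k \<in> E' \<and> inc' k = inc k" "l \<in> E' \<and> inc' l = inc l"
        using keep kl by auto
      then show ?thesis using kl unfolding in_digon_def by metis
    qed
    \<comment> \<open>A triangle through \<open>u\<close> would consist of \<open>u\<close>,
      \<open>v\<close>, \<open>x\<close> and make \<open>x\<close> a neighbour of \<open>v\<close>,
      hence equal to \<open>y\<close>; \<open>v\<close> is symmetric.\<close>
    moreover have "in_triangle E' inc' z" if tz: "in_triangle E inc z"
    proof -
      obtain s t k1 k2 k3 where k: "k1 \<in> E" "inc k1 = {z, s}" "k2 \<in> E" "inc k2 = {s, t}" "k3 \<in> E" "inc k3 = {t, z}"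
        using tz unfolding in_triangle_def adj_def by blast
      have k': "inc k1 = {s, z}" "inc k2 = {t, s}" "inc k3 = {z, t}" using k by auto
      have ne: "s \<noteq> t" "s \<noteq> z" "t \<noteq> z"
        using multigraphD(4)[OF G(1) k(1)] multigraphD(4)[OF G(1) k(3)] multigraphD(4)[OF G(1) k(5)] k by auto
      have "s \<noteq> u"
        using nbu[OF k(1), of z] nbu[OF k(3), of t] nbv[OF k(5), of z] k k' z' xv xy ne by auto
      moreover have "s \<noteq> v"
        using nbv[OF k(1), of z] nbv[OF k(3), of t] nbu[OF k(5), of z] k k' z' yu xy ne by auto
      moreover have "t \<noteq> u"
        using nbu[OF k(5), of z] nbu[OF k(3), of s] nbv[OF k(1), of z] k k' z' xv xy ne by auto
      moreover have "t \<noteq> v"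
        using nbv[OF k(5), of z] nbv[OF k(3), of s] nbu[OF k(1), of z] k k' z' yu xy ne by auto
      ultimately have "k1 \<in> E' \<and> inc' k1 = inc k1" "k2 \<in> E' \<and> inc' k2 = inc k2" "k3 \<in> E' \<and> inc' k3 = inc k3"
        using keep[OF k(1)] keep[OF k(3)] keep[OF k(5)] k z' by auto
      then show ?thesis using k unfolding in_triangle_def adj_def by metis
    qed
    ultimately show "3 \<le> w z \<or> in_digon E' inc' z \<or> in_triangle E' inc' z" using W(2)[OF z'(1)] by blast
  qed
  have share: "inc' k \<inter> inc' l \<noteq> {}" if "k \<in> E'" "l \<in> E'" "inc k \<inter> inc l \<noteq> {}" "k \<noteq> l" for k l
    using that away inc'k[of k] inc'k[of l] inc'h y(1) by (cases "k = h"; cases "l = h") auto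
  have share': "inc k \<inter> inc l \<noteq> {}" if "k \<in> E'" "l \<in> E'" "inc' k \<inter> inc' l \<noteq> {}" "k \<noteq> h" "l \<noteq> h" for k l
    using that inc'k by simp
  have share_h: "inc k \<inter> inc g \<noteq> {} \<or> inc k \<inter> inc h \<noteq> {}" if "k \<in> E'" "k \<noteq> h" "inc' k \<inter> inc' h \<noteq> {}" for k
    using that inc'k[of k] inc'h x y by auto
  have "weighted_bound V E inc w" if "weighted_bound V' E' inc' w"
  proof (rule weighted_bound_lift[OF fin(2) _ cV cE _ _ _ that])
    show finE': "finite E'" using fin by (simp add: E'_def)
    show "sum w V' \<le> sum w V" by (rule sum_mono2) (use fin in \<open>auto simp: V'_def\<close>)
    show "\<exists>F\<subseteq>E. k_edge_colorable 2 F inc \<and> card F = card F' + 2"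
      if F': "F' \<subseteq> E'" "k_edge_colorable 2 F' inc'" for F'
    proof -
      obtain col where col: "\<And>k. k \<in> F' \<Longrightarrow> col k < (2::nat)"
        "\<And>k l. k \<in> F' \<Longrightarrow> l \<in> F' \<Longrightarrow> k \<noteq> l \<Longrightarrow> inc' k \<inter> inc' l \<noteq> {} \<Longrightarrow> col k \<noteq> col l"
        using F'(2) unfolding k_edge_colorable_def by metis
      have nF: "e \<notin> F'" "f \<notin> F'" "g \<notin> F'" using F'(1) by (auto simp: E'E)
      have finF: "finite F'" using F'(1) finE' finite_subset by blast
      have FE: "k \<in> E'" if "k \<in> F'" for k using that F'(1) by blast
      have old: "col k \<noteq> col l" if "k \<in> F'" "l \<in> F'" "k \<noteq> l" "inc k \<inter> inc l \<noteq> {}" for k l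
        using col(2)[OF that(1-3)] share[OF FE[OF that(1)] FE[OF that(2)] that(4,3)] by simp
      show ?thesis
      proof (cases "h \<in> F'")
        case False
        have aw: "u \<notin> inc k" "v \<notin> inc k" if "k \<in> F'" for k using away[OF FE[OF that]] that False by auto
        show ?thesis
        proof (rule two_edge_extension[where F = F' and col = col and inc = inc and ?e1.0 = e and ?e2.0 = f
              and ?t0.0 = u and ?t1.0 = v and ?t2.0 = v and i = 0])
          show "col k \<noteq> col l" if "k \<in> F'" "l \<in> F'" "k \<noteq> l" "inc k \<inter> inc l \<noteq> {}" for k l
            by (rule old[OF that])
        qed (use col(1) F'(1) fin(2) aw uv(1) e nF in \<open>auto simp: E'E\<close>)
      next
        case True
        \<comment> \<open>\<open>h\<close> keeps its colour, \<open>e\<close> takes the other one,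
          and \<open>g\<close> repeats the colour of \<open>h\<close>. The latter is free at
          \<open>x\<close> because the new edge occupied it there.\<close>
        have at_x: "col k \<noteq> col h" if "k \<in> F'" "x \<in> inc k" for k
        proof -
          have "k \<noteq> h" using that(2) y(1) xv xy by auto
          moreover from this have "inc' k \<inter> inc' h \<noteq> {}" using that(2) inc'h inc'k by auto
          ultimately show ?thesis using col(2)[OF that(1) True] by simp
        qed
        have at_v: "k = h" if "k \<in> F'" "v \<in> inc k" for k using away(2)[OF FE[OF that(1)]] that(2) by blast
        have ch: "col h < 2" by (rule col(1)[OF True])
        show ?thesis
        proof (rule two_edge_extension[where F = F' and col = col and inc = inc and ?e1.0 = e and ?e2.0 = g
              and ?t0.0 = u and ?t1.0 = v and ?t2.0 = x and i = "1 - col h"])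
          show "col k \<noteq> col l" if "k \<in> F'" "l \<in> F'" "k \<noteq> l" "inc k \<inter> inc l \<noteq> {}" for k l
            by (rule old[OF that])
          show "F' \<subseteq> E" using F'(1) by (auto simp: E'E)
          show "inc e = {v, u}" "inc g = {x, u}" using uv(1) x(1) by auto
          show "u \<notin> inc k" if "k \<in> F'" for k
            using away(1)[OF FE[OF that]] y(1) uv(2) yu by (cases "k = h") auto
          show "1 - col h < 2" by simp
          show "col k \<noteq> 1 - col h" if "k \<in> F'" "v \<in> inc k" for k using at_v[OF that] ch by simp arith
          show "col k \<noteq> 1 - (1 - col h)" if "k \<in> F'" "x \<in> inc k" for k using at_x[OF that] ch by simp
        qed (use col(1) fin(2) e(1) g(2,4) nF in auto)
      qed
    qed
    show "\<exists>c'. partial_colouring E' inc' c' \<and> card (uncoloured E' c') \<le> card (uncoloured E c)"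
      if c: "partial_colouring E inc c" for c
    proof -
      have good: "c k = 0" if "k \<in> E" "l \<in> E" "k \<noteq> l" "inc k \<inter> inc l \<noteq> {}" "c k = c l" for k l
        using c that unfolding partial_colouring_def by blast
      have le3: "c k \<le> 3" if "k \<in> E" for k using c that unfolding partial_colouring_def by blast
      have finU: "finite (uncoloured E c)" using fin by (simp add: uncoloured_def)
      show ?thesis
      proof (cases "c g = c h")
        case True
        have "partial_colouring E' inc' c"
          unfolding partial_colouring_def
        proof (intro conjI ballI impI)
          show "c k \<le> 3" if "k \<in> E'" for k using that le3 by (simp add: E'E)
          have *: "c k = 0" if k: "k \<in> E'" "k \<noteq> h" "inc' k \<inter> inc' h \<noteq> {}" "c k = c h" for k
            using share_h[OF k(1-3)]
          proof
            assume "inc k \<inter> inc g \<noteq> {}"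
            then show ?thesis using good[of k g] k(1,4) g(2) True by (simp add: E'E)
          next
            assume "inc k \<inter> inc h \<noteq> {}"
            then show ?thesis using good[of k h] k(1,2,4) h(2) by (simp add: E'E)
          qed
          fix k l assume k: "k \<in> E'" and l: "l \<in> E'" and kl: "k \<noteq> l \<and> inc' k \<inter> inc' l \<noteq> {} \<and> c k = c l"
          show "c k = 0"
          proof (cases "k = h \<or> l = h")
            case True
            then consider "k = h" "l \<noteq> h" | "l = h" "k \<noteq> h" using kl by blast
            then show ?thesis
            proof cases
              case 1
              then have "inc' l \<inter> inc' h \<noteq> {}" "c l = c h" using kl by (auto simp only: Int_commute)
              then show ?thesis using *[OF l 1(2)] kl by simp
            next
              case 2
              then show ?thesis using *[OF k 2(2)] kl by simp
            qed
          next
            case False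
            then have "inc k \<inter> inc l \<noteq> {}" using share'[OF k l] kl by blast
            then show ?thesis using good[of k l] k l kl by (simp add: E'E)
          qed
        qed
        moreover have "card (uncoloured E' c) \<le> card (uncoloured E c)"
          by (rule card_mono[OF finU]) (auto simp: uncoloured_def E'E)
        ultimately show ?thesis by blast
      next
        case False
        \<comment> \<open>If \<open>e\<close>, \<open>f\<close>, \<open>g\<close>, \<open>h\<close>
          were all coloured, \<open>e\<close> and \<open>f\<close> would leave a single colour for
          both \<open>g\<close> and \<open>h\<close>. So one of these edges is already uncoloured
          and pays for uncolouring \<open>h\<close>.\<close>
        let ?c = "c(h := 0)"
        have "partial_colouring E' inc' ?c"
          unfolding partial_colouring_def
        proof (intro conjI ballI impI)
          show "?c k \<le> 3" if "k \<in> E'" for k using that le3 by (simp add: E'E)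
          fix k l assume k: "k \<in> E'" and l: "l \<in> E'" and kl: "k \<noteq> l \<and> inc' k \<inter> inc' l \<noteq> {} \<and> ?c k = ?c l"
          show "?c k = 0"
          proof (cases "k = h \<or> l = h")
            case True then show ?thesis using kl by auto
          next
            case False
            then have "inc k \<inter> inc l \<noteq> {}" using share'[OF k l] kl by blast
            then show ?thesis using good[of k l] k l kl False by (simp add: E'E)
          qed
        qed
        moreover have "card (uncoloured E' ?c) \<le> card (uncoloured E c)"
        proof -
          have "\<exists>k\<in>{e, f, g, h}. c k = 0"
          proof (rule ccontr)
            assume "\<not> ?thesis"
            then have nz: "c e \<noteq> 0" "c f \<noteq> 0" "c g \<noteq> 0" "c h \<noteq> 0" by auto
            have "c e \<noteq> c f" "c e \<noteq> c g" "c f \<noteq> c g" "c e \<noteq> c h" "c f \<noteq> c h"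
              using good[OF e(1,2,3)] good[OF e(1) g(2)] good[OF e(2) g(2)] good[OF e(1) h(2)] good[OF e(2) h(2)]
                nz g(4,5) h(4,5) uv(1) e(4) x(1) y(1) by auto
            moreover from this have "cols (c e) (c f) (c g)"
              using nz le3[OF e(1)] le3[OF e(2)] le3[OF g(2)] by (simp add: cols_def)
            then have "c h = c e \<or> c h = c f \<or> c h = c g"
              by (rule cols_cases) (use nz le3[OF h(2)] in simp)
            ultimately show False using False by auto
          qed
          then obtain k where k: "k \<in> {e, f, g, h}" "c k = 0" by blast
          have "k \<in> uncoloured E c" using k e g h by (auto simp: uncoloured_def)
          have "uncoloured E' ?c \<subseteq> insert h (uncoloured E c - {k})"
            using k by (auto simp: uncoloured_def E'E)
          then have "card (uncoloured E' ?c) \<le> card (insert h (uncoloured E c - {k}))"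
            by (rule card_mono[rotated]) (use finU in simp)
          also have "\<dots> \<le> Suc (card (uncoloured E c - {k}))" by (rule card_insert_le_m1) auto
          also have "\<dots> = card (uncoloured E c)" by (rule card_Suc_Diff1[OF finU \<open>k \<in> uncoloured E c\<close>])
          finally show ?thesis .
        qed
        ultimately show ?thesis by blast
      qed
    qed
  qed
  then show ?thesis using R' cV by (intro exI[of _ V'] exI[of _ E'] exI[of _ inc'] exI[of _ w]) auto
qed

text \<open>The triangle is contracted to \<open>x\<close>, which collects the weights of all three
  vertices and so reaches weight three. Simplicity ensures that the three edges leaving the triangle
  are distinct.\<close>

lemma reduce_triangle:
  fixes V :: "'v set" and E :: "'e set"
  assumes R: "reducible_weights V E inc w"
    and simple: "\<And>k l. k \<in> E \<Longrightarrow> l \<in> E \<Longrightarrow> inc k = inc l \<Longrightarrow> k = l"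
    and tri: "in_triangle E inc x"
  shows "\<exists>(V' :: 'v set) (E' :: 'e set) inc' w'. card V' < card V \<and> reducible_weights V' E' inc' w' \<and>
    (weighted_bound V' E' inc' w' \<longrightarrow> weighted_bound V E inc w)"
proof -
  have G: "multigraph V E inc" "cubic V E inc" "cut_bridgeless V E inc"
    and W: "\<And>v. v \<in> V \<Longrightarrow> 1 \<le> w v" "\<And>v. v \<in> V \<Longrightarrow> 3 \<le> w v \<or> in_digon E inc v \<or> in_triangle E inc v"
    using R by (auto simp: reducible_weights_def)
  note fin = multigraphD(1,2)[OF G(1)]
  obtain y z a b d where tri: "d \<in> E" "inc d = {x, y}" "a \<in> E" "inc a = {y, z}" "b \<in> E" "inc b = {z, x}"
    using tri unfolding in_triangle_def adj_def by blast
  have ne: "x \<noteq> y" "y \<noteq> z" "x \<noteq> z"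
    using multigraphD(4)[OF G(1) tri(1)] multigraphD(4)[OF G(1) tri(3)] multigraphD(4)[OF G(1) tri(5)] tri by auto
  have V: "x \<in> V" "y \<in> V" "z \<in> V"
    using multigraphD(3)[OF G(1) tri(1)] multigraphD(3)[OF G(1) tri(3)] tri by auto
  have abd: "a \<noteq> b" "a \<noteq> d" "b \<noteq> d" using tri ne by (auto simp: doubleton_eq_iff)
  define T where "T = {x, y, z}"
  define D where "D = {a, b, d}"
  have DE: "D \<subseteq> E" using tri by (auto simp: D_def)
  have T3: "card T = 3" using ne by (simp add: T_def)
  have side: "\<exists>k\<in>D. inc k = {p, q}" if "p \<in> T" "q \<in> T" "p \<noteq> q" for p q
    using that tri unfolding T_def D_def by (auto simp: insert_commute)
  have DT: "inc k \<subseteq> T" if "k \<in> D" for k using that tri by (auto simp: D_def T_def)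
  have "\<exists>g. g \<in> E \<and> g \<notin> D \<and> t \<in> inc g \<and> (\<forall>k\<in>E. k \<notin> D \<longrightarrow> t \<in> inc k \<longrightarrow> k = g)" if t: "t \<in> T" for t
  proof -
    have "\<exists>k l. k \<in> D \<and> l \<in> D \<and> k \<noteq> l \<and> t \<in> inc k \<and> t \<in> inc l \<and> (\<forall>m\<in>D. t \<in> inc m \<longrightarrow> m = k \<or> m = l)"
      using t unfolding T_def
    proof (elim insertE emptyE)
      assume "t = x" then show ?thesis
        by (intro exI[of _ d] exI[of _ b]) (use tri ne abd in \<open>auto simp: D_def\<close>)
    next
      assume "t = y" then show ?thesis
        by (intro exI[of _ d] exI[of _ a]) (use tri ne abd in \<open>auto simp: D_def\<close>)
    next
      assume "t = z" then show ?thesis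
        by (intro exI[of _ a] exI[of _ b]) (use tri ne abd in \<open>auto simp: D_def\<close>)
    qed
    then obtain k l where kl: "k \<in> D" "l \<in> D" "k \<noteq> l" "t \<in> inc k" "t \<in> inc l"
      "\<And>m. m \<in> D \<Longrightarrow> t \<in> inc m \<Longrightarrow> m = k \<or> m = l" by blast
    have tV: "t \<in> V" using t V by (auto simp: T_def)
    obtain h where h: "{m\<in>E. t \<in> inc m} = {k, l, h}" "h \<in> E" "t \<in> inc h" "h \<noteq> k" "h \<noteq> l"
      by (rule third_edge[OF G(1,2) tV _ _ kl(4,5,3)]) (use kl DE in blast)+
    have "h \<notin> D" using kl(6) h by blast
    moreover have "m = h" if m: "m \<in> E" "m \<notin> D" "t \<in> inc m" for m
    proof -
      have "m \<in> {k, l, h}" using m by (simp flip: h(1))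
      then show ?thesis using m(2) kl by auto
    qed
    ultimately show ?thesis using h by blast
  qed
  then obtain g where g: "\<And>t. t \<in> T \<Longrightarrow> g t \<in> E" "\<And>t. t \<in> T \<Longrightarrow> g t \<notin> D" "\<And>t. t \<in> T \<Longrightarrow> t \<in> inc (g t)"
    "\<And>t k. t \<in> T \<Longrightarrow> k \<in> E \<Longrightarrow> k \<notin> D \<Longrightarrow> t \<in> inc k \<Longrightarrow> k = g t"
    by metis
  \<comment> \<open>A further edge with two ends on the triangle would be parallel to a triangle
    edge.\<close>
  have single: "p = q" if k: "k \<in> E" "k \<notin> D" "p \<in> inc k" "q \<in> inc k" "p \<in> T" "q \<in> T" for k p q
  proof (rule ccontr)
    assume pq: "p \<noteq> q"
    obtain r where r: "inc k = {p, r}" by (rule edge_ends[OF G(1) k(1,3)])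
    then have "inc k = {p, q}" using k(4) pq by auto
    moreover obtain l where "l \<in> D" "inc l = {p, q}" using side[OF k(5,6) pq] by blast
    ultimately have "k = l" using simple[OF k(1), of l] DE by auto
    then show False using \<open>l \<in> D\<close> k(2) by simp
  qed
  have ginj: "s = t" if "s \<in> T" "t \<in> T" "g s = g t" for s t
    using single[of "g s" s t] g that by metis
  define V' where "V' = V - {y, z}"
  define E' where "E' = E - D"
  define f where "f v = (if v = y \<or> v = z then x else v)" for v
  define inc' where "inc' k = f ` inc k" for k
  define w' where "w' = w(x := w x + w y + w z)"
  have cV: "card V = card V' + 2"
    using V ne fin card_mono[of V "{y, z}"] by (simp add: V'_def card_Diff_subset)
  have cE: "card E = card E' + 3"
  proof -
    have "card D = 3" using abd by (simp add: D_def)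
    then show ?thesis using DE fin card_mono[of E D] by (simp add: E'_def card_Diff_subset finite_subset)
  qed
  have finE': "finite E'" using fin by (simp add: E'_def)
  have E'E: "k \<in> E' \<longleftrightarrow> k \<in> E \<and> k \<notin> D" for k by (auto simp: E'_def)
  have gE': "g t \<in> E'" if "t \<in> T" for t using g that by (simp add: E'E)
  have fT: "f v = x \<longleftrightarrow> v \<in> T" "v \<notin> T \<Longrightarrow> f v = v" for v using ne by (auto simp: f_def T_def)
  have fV: "f v \<in> V'" if "v \<in> V" for v using that V ne by (auto simp: f_def V'_def)
  have finj: "inj_on f (inc k)" if k: "k \<in> E'" for k
  proof (rule inj_onI)
    fix p q assume pq: "p \<in> inc k" "q \<in> inc k" "f p = f q"
    show "p = q"
    proof (cases "p \<in> T \<or> q \<in> T")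
      case True
      then have "p \<in> T" "q \<in> T" using pq(3) fT by metis+
      then show ?thesis using single[of k p q] k pq by (simp add: E'E)
    next
      case False then show ?thesis using pq(3) fT(2) by simp
    qed
  qed
  have in'x: "x \<in> inc' k \<longleftrightarrow> (\<exists>t\<in>T. t \<in> inc k)" for k
    unfolding inc'_def image_iff using fT(1) by metis
  have in'v: "v \<in> inc' k \<longleftrightarrow> v \<in> inc k" if "v \<notin> T" for v k
    unfolding inc'_def image_iff using that fT by (metis V'_def)
  have R': "reducible_weights V' E' inc' w'"
    unfolding reducible_weights_def
  proof (intro conjI ballI)
    show "multigraph V' E' inc'"
      unfolding multigraph_def
    proof (intro conjI ballI)
      show "finite V'" using fin by (simp add: V'_def)
      show "finite E'" by (rule finE')
      fix k assume k: "k \<in> E'"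
      show "inc' k \<subseteq> V'" using multigraphD(3)[OF G(1), of k] k fV by (auto simp: inc'_def E'E)
      show "card (inc' k) = 2"
        using card_image[OF finj[OF k]] multigraphD(4)[OF G(1), of k] k by (simp add: inc'_def E'E)
    qed
    show "cubic V' E' inc'"
      unfolding cubic_def degree_def
    proof
      fix v assume v: "v \<in> V'"
      show "card {k\<in>E'. v \<in> inc' k} = 3"
      proof (cases "v = x")
        case True
        have "{k\<in>E'. v \<in> inc' k} = g ` T"
        proof (intro equalityI subsetI)
          fix k assume "k \<in> {k\<in>E'. v \<in> inc' k}"
          then obtain t where t: "t \<in> T" "t \<in> inc k" "k \<in> E'" using in'x True by auto
          then show "k \<in> g ` T" using g(4)[OF t(1), of k] by (auto simp: E'E)
        next
          fix k assume "k \<in> g ` T"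
          then show "k \<in> {k\<in>E'. v \<in> inc' k}" using gE' g(3) in'x True by auto
        qed
        moreover have "inj_on g T" using ginj by (auto simp: inj_on_def)
        ultimately show ?thesis using T3 by (simp add: card_image)
      next
        case False
        then have vT: "v \<notin> T" using v by (auto simp: V'_def T_def)
        then have "{k\<in>E'. v \<in> inc' k} = {k\<in>E. v \<in> inc k}" using in'v[OF vT] DT by (auto simp: E'E)
        then show ?thesis using cubicD[OF G(2), of v] v by (simp add: V'_def)
      qed
    qed
    show "cut_bridgeless V' E' inc'"
      unfolding cut_bridgeless_def
    proof (intro allI impI)
      fix S assume S: "S \<subseteq> V'"
      define S0 where "S0 = {v\<in>V. f v \<in> S}"
      \<comment> \<open>\<open>S0\<close> is the preimage of \<open>S\<close> under the contraction:
        triangle edges never cross it, and the map is injective on all other edges.\<close>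
      have "{k\<in>E'. card (inc' k \<inter> S) = 1} = {k\<in>E. card (inc k \<inter> S0) = 1}"
      proof (rule Collect_cong)
        fix k
        show "k \<in> E' \<and> card (inc' k \<inter> S) = 1 \<longleftrightarrow> k \<in> E \<and> card (inc k \<inter> S0) = 1"
        proof (cases "k \<in> D")
          case True
          have kV: "inc k \<subseteq> V" using multigraphD(3)[OF G(1)] True DE by blast
          have fx: "f v = x" if "v \<in> inc k" for v using fT(1) DT[OF True] that by blast
          have "inc k \<inter> S0 = (if x \<in> S then inc k else {})"
            using fx kV by (auto simp: S0_def)
          then have "card (inc k \<inter> S0) \<noteq> 1" using multigraphD(4)[OF G(1), of k] True DE by auto
          then show ?thesis using True by (simp add: E'E)
        next
          case False
          show ?thesis
          proof (cases "k \<in> E")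
            case True
            then have k: "k \<in> E'" using False by (simp add: E'E)
            have "inc' k \<inter> S = f ` (inc k \<inter> S0)"
              using multigraphD(3)[OF G(1) True] by (auto simp: inc'_def S0_def)
            moreover have "inj_on f (inc k \<inter> S0)" using finj[OF k] by (rule inj_on_subset) auto
            ultimately show ?thesis using k True by (simp add: card_image)
          qed (simp add: E'E)
        qed
      qed
      moreover have "S0 \<subseteq> V" by (auto simp: S0_def)
      ultimately show "card {k\<in>E'. card (inc' k \<inter> S) = 1} \<noteq> 1" using G(3) by (simp add: cut_bridgeless_def)
    qed
    fix v assume v: "v \<in> V'"
    then have vV: "v \<in> V" "v \<noteq> y" "v \<noteq> z" by (auto simp: V'_def)
    show "1 \<le> w' v" using W(1)[OF vV(1)] by (auto simp: w'_def)
    show "3 \<le> w' v \<or> in_digon E' inc' v \<or> in_triangle E' inc' v"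
    proof (cases "v = x \<or> 3 \<le> w v")
      case True
      then show ?thesis using W(1)[OF V(1)] W(1)[OF V(2)] W(1)[OF V(3)] by (auto simp: w'_def)
    next
      case False
      then have vT: "v \<notin> T" using vV by (auto simp: T_def)
      have "\<not> in_digon E inc v" using simple unfolding in_digon_def by blast
      then have "in_triangle E inc v" using W(2)[OF vV(1)] False by blast
      then obtain s t k1 k2 k3 where k: "k1 \<in> E" "inc k1 = {v, s}" "k2 \<in> E" "inc k2 = {s, t}" "k3 \<in> E" "inc k3 = {t, v}"
        unfolding in_triangle_def adj_def by blast
      have kD: "k1 \<in> E'" "k3 \<in> E'" using k DT[of k1] DT[of k3] vT by (auto simp: E'E)
      have st: "s \<noteq> t" "s \<noteq> v" "t \<noteq> v"
        using multigraphD(4)[OF G(1) k(1)] multigraphD(4)[OF G(1) k(3)] multigraphD(4)[OF G(1) k(5)] k by auto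
      have k13: "k1 \<noteq> k3" using k st by (auto simp: doubleton_eq_iff)
      show ?thesis
      proof (cases "s \<in> T \<or> t \<in> T")
        case True
        \<comment> \<open>A triangle sharing just one vertex with \<open>T\<close> would need two
          edges leaving \<open>T\<close> there. Sharing two vertices, it becomes a digon.\<close>
        have "s \<in> T \<and> t \<in> T"
        proof (rule ccontr)
          assume n: "\<not> ?thesis"
          then have "k2 \<notin> D" using DT[of k2] k(4) by auto
          then have k2: "k2 \<in> E'" using k(3) by (simp add: E'E)
          have "k2 = k1" if "s \<in> T" using g(4)[OF that, of k2] g(4)[OF that, of k1] k2 kD k by (auto simp: E'E)
          moreover have "k2 = k3" if "t \<in> T" using g(4)[OF that, of k2] g(4)[OF that, of k3] k2 kD k by (auto simp: E'E)
          ultimately show False using True k st by (auto simp: doubleton_eq_iff)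
        qed
        then have "f s = x" "f t = x" "f v = v" using fT vT by auto
        then have "inc' k1 = {v, x}" "inc' k3 = {v, x}" using k by (auto simp: inc'_def)
        then show ?thesis using kD k13 unfolding in_digon_def by (metis insertI1)
      next
        case False
        then have "k2 \<in> E'" using k DT[of k2] by (auto simp: E'E)
        moreover have "f s = s" "f t = t" "f v = v" using fT vT False by auto
        then have "inc' k1 = {v, s}" "inc' k2 = {s, t}" "inc' k3 = {t, v}" using k by (auto simp: inc'_def)
        ultimately show ?thesis using kD unfolding in_triangle_def adj_def by blast
      qed
    qed
  qed
  have share: "inc' k \<inter> inc' l \<noteq> {}" if "inc k \<inter> inc l \<noteq> {}" for k l
    using that unfolding inc'_def by blast
  have share': "inc k \<inter> inc l \<noteq> {} \<or> k \<in> g ` T \<and> l \<in> g ` T" if kl: "k \<in> E'" "l \<in> E'" "inc' k \<inter> inc' l \<noteq> {}" for k l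
  proof -
    obtain p q where pq: "p \<in> inc k" "q \<in> inc l" "f p = f q" using kl(3) unfolding inc'_def by blast
    show ?thesis
    proof (cases "p \<in> T \<or> q \<in> T")
      case True
      then have "p \<in> T" "q \<in> T" using pq(3) fT by metis+
      then show ?thesis using g(4)[of p k] g(4)[of q l] kl pq by (auto simp: E'E)
    next
      case False then show ?thesis using pq fT(2) by auto
    qed
  qed
  have "weighted_bound V E inc w" if "weighted_bound V' E' inc' w'"
  proof (rule weighted_bound_lift[OF fin(2) finE' cV cE _ _ _ that])
    define Z where "Z = V - T"
    have Z: "finite Z" "x \<notin> Z" "y \<notin> Z" "z \<notin> Z" "V' = insert x Z" "V = insert x (insert y (insert z Z))"
      using fin V ne by (auto simp: Z_def T_def V'_def)
    have "sum w' Z = sum w Z" by (rule sum.cong) (use Z in \<open>auto simp: w'_def\<close>)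
    then have "sum w' V' = w x + w y + w z + sum w Z" using Z by (simp add: w'_def)
    also have "\<dots> = sum w V" using Z(1-4) ne unfolding Z(6) by simp
    finally show "sum w' V' \<le> sum w V" by simp
    show "\<exists>F\<subseteq>E. k_edge_colorable 2 F inc \<and> card F = card F' + 2"
      if F': "F' \<subseteq> E'" "k_edge_colorable 2 F' inc'" for F'
    proof -
      obtain col where col: "\<And>k. k \<in> F' \<Longrightarrow> col k < (2::nat)"
        "\<And>k l. k \<in> F' \<Longrightarrow> l \<in> F' \<Longrightarrow> k \<noteq> l \<Longrightarrow> inc' k \<inter> inc' l \<noteq> {} \<Longrightarrow> col k \<noteq> col l"
        using F'(2) unfolding k_edge_colorable_def by metis
      have gcol: "col (g s) \<noteq> col (g t)" if st: "s \<in> T" "t \<in> T" "s \<noteq> t" "g s \<in> F'" "g t \<in> F'" for s t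
      proof (rule col(2)[OF st(4,5)])
        show "g s \<noteq> g t" using ginj st by blast
        have "x \<in> inc' (g s)" "x \<in> inc' (g t)" using in'x g(3) st by auto
        then show "inc' (g s) \<inter> inc' (g t) \<noteq> {}" by blast
      qed
      \<comment> \<open>After the contraction the three outer edges meet in \<open>x\<close>, and
        two colours do not suffice for them.\<close>
      have "\<exists>t\<in>T. g t \<notin> F'"
      proof (rule ccontr)
        assume "\<not> ?thesis"
        then have "g x \<in> F'" "g y \<in> F'" "g z \<in> F'" by (auto simp: T_def)
        then show False using gcol[of x y] gcol[of y z] gcol[of x z] col(1)[of "g x"] col(1)[of "g y"] col(1)[of "g z"] ne
          by (auto simp: T_def less_2_cases_iff)
      qed
      then obtain t0 where t0: "t0 \<in> T" "g t0 \<notin> F'" by blast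
      obtain t1 t2 where t12: "t1 \<in> T" "t2 \<in> T" "t1 \<noteq> t0" "t2 \<noteq> t0" "t1 \<noteq> t2"
        using t0(1) ne unfolding T_def by auto
      obtain e1 where e1: "e1 \<in> D" "inc e1 = {t1, t0}" using side[OF t12(1) t0(1) t12(3)] by blast
      obtain e2 where e2: "e2 \<in> D" "inc e2 = {t2, t0}" using side[OF t12(2) t0(1) t12(4)] by blast
      have e12: "e1 \<noteq> e2" using e1 e2 t12 by (auto simp: doubleton_eq_iff)
      have nF: "e1 \<notin> F'" "e2 \<notin> F'" using e1 e2 F'(1) by (auto simp: E'E)
      have FE: "k \<in> E" "k \<notin> D" if "k \<in> F'" for k using that F'(1) by (auto simp: E'E)
      \<comment> \<open>\<open>i\<close> must avoid the colour of \<open>g t1\<close>, and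
        \<open>1 - i\<close> that of \<open>g t2\<close>. If both edges are present their colours
        differ, so one choice serves both.\<close>
      define i where "i = (if g t1 \<in> F' then 1 - col (g t1) else if g t2 \<in> F' then col (g t2) else 0)"
      have i: "i < 2" "g t1 \<in> F' \<Longrightarrow> col (g t1) \<noteq> i" "g t2 \<in> F' \<Longrightarrow> col (g t2) \<noteq> 1 - i"
        using col(1)[of "g t1"] col(1)[of "g t2"] gcol[OF t12(1,2,5)] by (auto simp: i_def less_2_cases_iff)
      show ?thesis
      proof (rule two_edge_extension[where F = F' and col = col and inc = inc and ?e1.0 = e1 and ?e2.0 = e2
            and ?t0.0 = t0 and ?t1.0 = t1 and ?t2.0 = t2 and i = i])
        show "col k \<noteq> col l" if "k \<in> F'" "l \<in> F'" "k \<noteq> l" "inc k \<inter> inc l \<noteq> {}" for k l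
          by (rule col(2)[OF that(1-3) share[OF that(4)]])
        show "F' \<subseteq> E" "e1 \<in> E" "e2 \<in> E" using FE(1) e1(1) e2(1) DE by auto
        show "t0 \<notin> inc k" if k: "k \<in> F'" for k using g(4)[OF t0(1) FE[OF k]] t0(2) k by blast
        show "col k \<noteq> i" if k: "k \<in> F'" "t1 \<in> inc k" for k using g(4)[OF t12(1) FE[OF k(1)] k(2)] k(1) i(2) by simp
        show "col k \<noteq> 1 - i" if k: "k \<in> F'" "t2 \<in> inc k" for k using g(4)[OF t12(2) FE[OF k(1)] k(2)] k(1) i(3) by simp
      qed (use col(1) fin(2) nF e12 e1(2) e2(2) i(1) in auto)
    qed
    show "\<exists>c'. partial_colouring E' inc' c' \<and> card (uncoloured E' c') \<le> card (uncoloured E c)"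
      if c: "partial_colouring E inc c" for c
    proof -
      have good: "c k = 0" if "k \<in> E" "l \<in> E" "k \<noteq> l" "v \<in> inc k" "v \<in> inc l" "c k = c l" for k l v
        using c that unfolding partial_colouring_def by blast
      have le3: "c k \<le> 3" if "k \<in> E" for k using c that unfolding partial_colouring_def by blast
      have finU: "finite (uncoloured E c)" using fin by (simp add: uncoloured_def)
      have cE': "partial_colouring E' inc c" using c unfolding partial_colouring_def E'_def by blast
      have lift: "partial_colouring E' inc' c1"
        if c1: "partial_colouring E' inc c1" "\<And>s t. s \<in> T \<Longrightarrow> t \<in> T \<Longrightarrow> s \<noteq> t \<Longrightarrow> c1 (g s) = c1 (g t) \<Longrightarrow> c1 (g s) = 0" for c1
        unfolding partial_colouring_def
      proof (intro conjI ballI impI)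
        show "c1 k \<le> 3" if "k \<in> E'" for k using c1(1) that unfolding partial_colouring_def by blast
        fix k l assume k: "k \<in> E'" and l: "l \<in> E'" and kl: "k \<noteq> l \<and> inc' k \<inter> inc' l \<noteq> {} \<and> c1 k = c1 l"
        show "c1 k = 0"
        proof (cases "inc k \<inter> inc l = {}")
          case False
          then show ?thesis using c1(1) k l kl unfolding partial_colouring_def by blast
        next
          case True
          then obtain s t where st: "s \<in> T" "t \<in> T" "k = g s" "l = g t" using share'[OF k l] kl by blast
          then have "s \<noteq> t" using kl by blast
          then show ?thesis using c1(2)[OF st(1,2)] st(3,4) kl by simp
        qed
      qed
      show ?thesis
      proof (cases "\<exists>s\<in>T. \<exists>t\<in>T. s \<noteq> t \<and> c (g s) = c (g t) \<and> c (g s) \<noteq> 0")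
        case False
        then have "partial_colouring E' inc' c" by (intro lift[OF cE']) blast
        moreover have "card (uncoloured E' c) \<le> card (uncoloured E c)"
          by (rule card_mono[OF finU]) (auto simp: uncoloured_def E'E)
        ultimately show ?thesis by blast
      next
        case True
        then obtain s t where st: "s \<in> T" "t \<in> T" "s \<noteq> t" "c (g s) = c (g t)" "c (g s) \<noteq> 0" by blast
        \<comment> \<open>A fully coloured triangle uses every colour, in particular the common one
          of \<open>g s\<close> and \<open>g t\<close>, on an edge meeting \<open>s\<close> or
          \<open>t\<close>.\<close>
        have "\<exists>k\<in>D. c k = 0"
        proof (rule ccontr)
          assume "\<not> ?thesis"
          then have nz: "c a \<noteq> 0" "c b \<noteq> 0" "c d \<noteq> 0" by (auto simp: D_def)
          have "c a \<noteq> c b" "c a \<noteq> c d" "c b \<noteq> c d"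
            using good[of a b z] good[of a d y] good[of b d x] tri abd nz by auto
          then have "cols (c a) (c b) (c d)"
            using nz le3[OF tri(1)] le3[OF tri(3)] le3[OF tri(5)] by (simp add: cols_def)
          then have "c (g s) = c a \<or> c (g s) = c b \<or> c (g s) = c d"
            by (rule cols_cases) (use st(5) le3[OF g(1)[OF st(1)]] in simp)
          then have "\<exists>k\<in>{a, b, d}. c k = c (g s)" by auto
          then obtain k where k: "k \<in> D" "c k = c (g s)" unfolding D_def by blast
          have kE: "k \<in> E" using k DE by blast
          have ks: "k \<noteq> g s" "k \<noteq> g t" using k g(2) st by auto
          have "s \<in> inc k \<or> t \<in> inc k" using k(1) tri st(1-3) by (auto simp: D_def T_def)
          then show False
            using good[OF kE g(1)[OF st(1)] ks(1) _ g(3)[OF st(1)]] good[OF kE g(1)[OF st(2)] ks(2) _ g(3)[OF st(2)]]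
              k st by auto
        qed
        then obtain m where m: "m \<in> D" "c m = 0" by blast
        \<comment> \<open>The uncoloured triangle edge \<open>m\<close> disappears, so one outer
          edge \<open>g r\<close> may be uncoloured in exchange; the other two have to
          differ.\<close>
        have "\<exists>c1 r. r \<in> T \<and> partial_colouring E' inc c1 \<and> uncoloured E' c1 = uncoloured E' c \<and>
          (\<forall>p\<in>T. \<forall>q\<in>T. p \<noteq> q \<and> p \<noteq> r \<and> q \<noteq> r \<longrightarrow> c1 (g p) \<noteq> c1 (g q))"
        proof (cases "\<forall>p\<in>T. c (g p) = c (g s)")
          case False
          have "\<forall>p\<in>T. \<forall>q\<in>T. p \<noteq> q \<and> p \<noteq> s \<and> q \<noteq> s \<longrightarrow> c (g p) \<noteq> c (g q)"
            using False st by (auto simp: T_def)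
          then show ?thesis using st(1) cE' by blast
        next
          case all: True
          let ?\<alpha> = "c (g s)"
          have \<alpha>: "?\<alpha> \<in> {1..3}" using le3[OF g(1)[OF st(1)]] st(5) by auto
          obtain \<beta> where \<beta>: "\<beta> \<in> {1..3}" "\<beta> \<noteq> ?\<alpha>" using cols_others[OF \<alpha>] by (auto simp: cols_def)
          \<comment> \<open>With the triangle deleted, each of its vertices is an end of a chain of
            the colours \<open>?\<alpha>\<close> and \<open>\<beta>\<close>. By
            \<open>odd_escape\<close> some chain avoids the other two vertices, and an exchange on
            it recolours exactly one of the three outer edges.\<close>
          define F where "F = {k\<in>E'. c k \<in> {?\<alpha>, \<beta>}}"
          have finF: "finite F" using finE' by (simp add: F_def)
          have two: "card (inc k) = 2" if "k \<in> F" for k using that multigraphD(4)[OF G(1)] by (auto simp: F_def E'E)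
          have deg: "degree F inc v \<le> 2" for v
            by (rule degree_two_colours[OF cE' \<alpha> \<beta>(1)]) (auto simp: F_def)
          have gF: "g p \<in> F" if "p \<in> T" for p using gE'[OF that] all that by (auto simp: F_def)
          have deg1: "degree F inc p = 1" if p: "p \<in> T" for p
          proof -
            have "{k\<in>F. p \<in> inc k} = {g p}"
            proof (intro equalityI subsetI)
              fix k assume "k \<in> {k\<in>F. p \<in> inc k}"
              then show "k \<in> {g p}" using g(4)[OF p, of k] by (auto simp: F_def E'E)
            qed (use gF[OF p] g(3)[OF p] in simp)
            then show ?thesis by (simp add: degree_def)
          qed
          have "finite T" "odd (card T)" using T3 by (auto simp: T_def)
          then obtain p K where K: "p \<in> T" "closed_under F inc K" "K \<inter> T = {p}"
            using odd_escape[OF finF two deg _ _ deg1] by blast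
          define c1 where "c1 = kempe inc ?\<alpha> \<beta> K c"
          have "partial_colouring E' inc c1"
            unfolding c1_def by (rule partial_colouring_kempe[OF cE' \<alpha> \<beta>(1)]) (use K(2) in \<open>simp add: F_def\<close>)
          moreover have "uncoloured E' c1 = uncoloured E' c"
            unfolding c1_def by (rule uncoloured_kempe) (use \<alpha> \<beta> in auto)
          moreover have cp: "c1 (g p) \<noteq> ?\<alpha>"
          proof -
            have "inc (g p) \<inter> K \<noteq> {}" using g(3)[OF K(1)] K(3) by blast
            then have "c1 (g p) = ?\<alpha> \<longleftrightarrow> c (g p) = \<beta>" unfolding c1_def by (rule kempe_inside)
            then show ?thesis using all K(1) \<beta>(2) by auto
          qed
          moreover have cq: "c1 (g q) = ?\<alpha>" if q: "q \<in> T" "q \<noteq> p" for q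
          proof -
            have "inc (g q) \<inter> K = {}"
            proof (rule ccontr)
              assume "inc (g q) \<inter> K \<noteq> {}"
              then have "inc (g q) \<subseteq> K" using K(2) gF[OF q(1)] by (auto simp: closed_under_def)
              then show False using g(3)[OF q(1)] q K(3) by blast
            qed
            then show ?thesis using all q by (simp add: c1_def kempe_def)
          qed
          moreover obtain r where r: "r \<in> T" "r \<noteq> p" using st(1-3) by metis
          have "c1 (g u) \<noteq> c1 (g v)" if uv: "u \<in> T" "v \<in> T" "u \<noteq> v" "u \<noteq> r" "v \<noteq> r" for u v
          proof -
            have "u = p \<or> v = p" using uv r K(1) by (auto simp: T_def)
            then show ?thesis using cp cq[OF uv(1)] cq[OF uv(2)] uv(3) by auto
          qed
          ultimately show ?thesis using r(1) by blast
        qed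
        then obtain c1 r where c1: "r \<in> T" "partial_colouring E' inc c1" "uncoloured E' c1 = uncoloured E' c"
          "\<And>p q. p \<in> T \<Longrightarrow> q \<in> T \<Longrightarrow> p \<noteq> q \<Longrightarrow> p \<noteq> r \<Longrightarrow> q \<noteq> r \<Longrightarrow> c1 (g p) \<noteq> c1 (g q)" by blast
        let ?c = "c1(g r := 0)"
        have "partial_colouring E' inc ?c" using c1(2) unfolding partial_colouring_def by auto
        moreover have "?c (g p) = 0" if pq: "p \<in> T" "q \<in> T" "p \<noteq> q" "?c (g p) = ?c (g q)" for p q
        proof (cases "p = r \<or> q = r")
          case True then show ?thesis using pq(4) by auto
        next
          case False
          then have "g p \<noteq> g r" "g q \<noteq> g r" using ginj pq c1(1) by blast+
          then show ?thesis using c1(4)[OF pq(1-3)] pq(4) False by simp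
        qed
        ultimately have "partial_colouring E' inc' ?c" by (rule lift)
        moreover have "card (uncoloured E' ?c) \<le> card (uncoloured E c)"
        proof -
          have mU: "m \<in> uncoloured E c" using m DE by (auto simp: uncoloured_def)
          have "uncoloured E' ?c \<subseteq> insert (g r) (uncoloured E' c1)" by (auto simp: uncoloured_def)
          also have "\<dots> \<subseteq> insert (g r) (uncoloured E c - {m})"
            unfolding c1(3) using m by (auto simp: uncoloured_def E'E)
          finally have "card (uncoloured E' ?c) \<le> card (insert (g r) (uncoloured E c - {m}))"
            by (rule card_mono[rotated]) (use finU in simp)
          also have "\<dots> \<le> Suc (card (uncoloured E c - {m}))" by (rule card_insert_le_m1) auto
          also have "\<dots> = card (uncoloured E c)" by (rule card_Suc_Diff1[OF finU mU])
          finally show ?thesis .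
        qed
        ultimately show ?thesis by blast
      qed
    qed
  qed
  then show ?thesis using R' cV by (intro exI[of _ V'] exI[of _ E'] exI[of _ inc'] exI[of _ w']) auto
qed

section \<open>Irreducible graphs and the conclusion\<close>

text \<open>Without parallel edges an edge is determined by its ends. This carries
  \<open>core_bound\<close>, which treats edges as vertex pairs, over to multigraphs.\<close>

lemma nu_image:
  assumes "finite E" "inj_on inc E"
  shows "nu k (inc ` E) (\<lambda>e. e) = nu k E inc"
proof (rule antisym)
  obtain F where F: "F \<subseteq> inc ` E" "k_edge_colorable k F (\<lambda>e. e)" "card F = nu k (inc ` E) (\<lambda>e. e)"
    by (rule nu_attained[OF finite_imageI[OF assms(1)]])
  obtain col where col: "\<forall>e\<in>F. col e < k" "\<forall>e\<in>F. \<forall>f\<in>F. e \<noteq> f \<and> e \<inter> f \<noteq> {} \<longrightarrow> col e \<noteq> (col f :: nat)"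
    using F(2) unfolding k_edge_colorable_def by blast
  define H where "H = {e\<in>E. inc e \<in> F}"
  have HE: "H \<subseteq> E" by (auto simp: H_def)
  have "k_edge_colorable k H inc"
    unfolding k_edge_colorable_def
  proof (intro exI[of _ "\<lambda>e. col (inc e)"] conjI ballI impI)
    show "col (inc e) < k" if "e \<in> H" for e using col(1) that by (simp add: H_def)
    fix e f assume ef: "e \<in> H" "f \<in> H" "e \<noteq> f \<and> inc e \<inter> inc f \<noteq> {}"
    then have "inc e \<noteq> inc f" using inj_onD[OF assms(2), of e f] by (auto simp: H_def)
    then show "col (inc e) \<noteq> col (inc f)" using col(2) ef by (simp add: H_def)
  qed
  moreover have "F = inc ` H" using F(1) by (auto simp: H_def)
  then have "card F = card H" using inj_on_subset[OF assms(2) HE] by (simp add: card_image)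
  ultimately show "nu k (inc ` E) (\<lambda>e. e) \<le> nu k E inc" using nu_ge[OF assms(1) HE, of k inc] F(3) by simp
next
  obtain F where F: "F \<subseteq> E" "k_edge_colorable k F inc" "card F = nu k E inc"
    by (rule nu_attained[OF assms(1)])
  obtain col where col: "\<forall>e\<in>F. col e < k" "\<forall>e\<in>F. \<forall>f\<in>F. e \<noteq> f \<and> inc e \<inter> inc f \<noteq> {} \<longrightarrow> col e \<noteq> (col f :: nat)"
    using F(2) unfolding k_edge_colorable_def by blast
  have inj: "inj_on inc F" by (rule inj_on_subset[OF assms(2) F(1)])
  have "k_edge_colorable k (inc ` F) (\<lambda>e. e)"
    unfolding k_edge_colorable_def
  proof (intro exI[of _ "\<lambda>e. col (inv_into F inc e)"] conjI ballI impI)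
    show "col (inv_into F inc e) < k" if "e \<in> inc ` F" for e using col(1) inv_into_into[OF that] by blast
    fix e f assume "e \<in> inc ` F" "f \<in> inc ` F" and ef: "e \<noteq> f \<and> e \<inter> f \<noteq> {}"
    then obtain e' f' where e': "e' \<in> F" "f' \<in> F" "e = inc e'" "f = inc f'" by blast
    then have "inv_into F inc e = e'" "inv_into F inc f = f'" using inj by simp_all
    moreover have "e' \<noteq> f' \<and> inc e' \<inter> inc f' \<noteq> {}" using e' ef by blast
    ultimately show "col (inv_into F inc e) \<noteq> col (inv_into F inc f)" using col(2) e'(1,2) by simp
  qed
  then show "nu k E inc \<le> nu k (inc ` E) (\<lambda>e. e)"
    using nu_ge[OF finite_imageI[OF assms(1)], of "inc ` F" inc k "\<lambda>e. e"] F(1,3) inj by (auto simp: card_image)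
qed

text \<open>With no digon and no triangle left, every weight is at least three, so the total weight
  dominates the \<open>3 * card V\<close> of \<open>core_bound\<close>.\<close>

lemma weighted_bound_reduced:
  assumes R: "reducible_weights V E inc w"
    and simple: "\<And>k l. k \<in> E \<Longrightarrow> l \<in> E \<Longrightarrow> inc k = inc l \<Longrightarrow> k = l"
    and tf: "\<And>v. v \<in> V \<Longrightarrow> \<not> in_triangle E inc v"
  shows "weighted_bound V E inc w"
proof -
  have G: "multigraph V E inc" "cubic V E inc" "cut_bridgeless V E inc"
    and W: "\<And>v. v \<in> V \<Longrightarrow> 3 \<le> w v \<or> in_digon E inc v \<or> in_triangle E inc v"
    using R by (auto simp: reducible_weights_def)
  have inj: "inj_on inc E" using simple by (auto simp: inj_on_def)
  have pre: "card {e\<in>inc ` E. P e} = card {e\<in>E. P (inc e)}" for P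
  proof -
    have "{e\<in>inc ` E. P e} = inc ` {e\<in>E. P (inc e)}" by auto
    then show ?thesis using inj by (simp add: card_image inj_on_def)
  qed
  interpret cubic_graph V "inc ` E"
  proof
    show "finite V" by (rule multigraphD(1)[OF G(1)])
    show "e \<subseteq> V \<and> card e = 2" if "e \<in> inc ` E" for e using multigraphD(3,4)[OF G(1)] that by auto
    show "card {e\<in>inc ` E. v \<in> e} = 3" if "v \<in> V" for v unfolding pre by (rule cubicD[OF G(2) that])
    show False if xyz: "{x, y} \<in> inc ` E" "{y, z} \<in> inc ` E" "{x, z} \<in> inc ` E" for x y z
    proof -
      have "adj E inc x y" "adj E inc y z" "adj E inc z x"
        using xyz unfolding adj_def by (auto simp: image_iff insert_commute)
      then have "in_triangle E inc x" unfolding in_triangle_def by blast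
      moreover have "x \<in> V" using xyz(1) multigraphD(3)[OF G(1)] by auto
      ultimately show False using tf by blast
    qed
    show "cut_bridgeless V (inc ` E) (\<lambda>e. e)"
      using G(3) unfolding cut_bridgeless_def pre .
  qed
  have "3 \<le> w v" if "v \<in> V" for v
    using W[OF that] tf[OF that] simple unfolding in_digon_def by blast
  then have "(\<Sum>v\<in>V. 3) \<le> (\<Sum>v\<in>V. w v)" by (rule sum_mono)
  then show ?thesis
    using core_bound nu_image[OF multigraphD(2)[OF G(1)] inj] card_image[OF inj]
    unfolding weighted_bound_def by simp
qed

text \<open>Parallel edges are treated before triangles, because the contraction of a triangle
  presupposes a simple graph.\<close>

lemma weighted_bound_holds:
  fixes V :: "'v set" and E :: "'e set"
  shows "reducible_weights V E inc w \<Longrightarrow> weighted_bound V E inc w"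
proof (induction "card V" arbitrary: V E inc w rule: less_induct)
  case less
  note R = less.prems
  have "\<exists>(V' :: 'v set) (E' :: 'e set) inc' w'. card V' < card V \<and> reducible_weights V' E' inc' w' \<and>
    (weighted_bound V' E' inc' w' \<longrightarrow> weighted_bound V E inc w)"
    if nb: "\<not> weighted_bound V E inc w"
  proof (cases "\<exists>e\<in>E. \<exists>f\<in>E. e \<noteq> f \<and> inc e = inc f")
    case True
    then obtain e f where ef: "e \<in> E" "f \<in> E" "e \<noteq> f" "inc f = inc e" by metis
    show ?thesis
    proof (cases "\<exists>g\<in>E. inc g = inc e \<and> g \<noteq> e \<and> g \<noteq> f")
      case True
      then obtain g where "g \<in> E" "inc g = inc e" "e \<noteq> g" "f \<noteq> g" by blast
      then show ?thesis using reduce_triple_edge[OF R ef(1,2) _ ef(3) _ _ ef(4)] by blast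
    next
      case False
      then show ?thesis using reduce_digon[OF R ef] by blast
    qed
  next
    case False
    then have simple: "\<And>k l. k \<in> E \<Longrightarrow> l \<in> E \<Longrightarrow> inc k = inc l \<Longrightarrow> k = l" by blast
    obtain v where v: "in_triangle E inc v" using weighted_bound_reduced[OF R simple] nb by blast
    show ?thesis by (rule reduce_triangle[OF R _ v]) (rule simple)
  qed
  then show ?case using less.hyps by blast
qed

text \<open>Without a digon the three neighbours are distinct, and since they do not form a claw
  with \<open>v\<close>, two of them are adjacent.\<close>

lemma claw_free_cubic_vertex:
  assumes "multigraph V E inc" "cubic V E inc" "claw_free V E inc" "v \<in> V"
  shows "in_digon E inc v \<or> in_triangle E inc v"
proof (rule ccontr)
  assume no: "\<not> ?thesis"
  obtain e f g where efg: "{k\<in>E. v \<in> inc k} = {e, f, g}" "e \<noteq> f" "e \<noteq> g" "f \<noteq> g"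
    using cubicD[OF assms(2,4)] by (auto simp: card_3_iff)
  then have "e \<in> {k\<in>E. v \<in> inc k}" "f \<in> {k\<in>E. v \<in> inc k}" "g \<in> {k\<in>E. v \<in> inc k}" by simp_all
  then have E: "e \<in> E" "v \<in> inc e" "f \<in> E" "v \<in> inc f" "g \<in> E" "v \<in> inc g" by auto
  obtain a where a: "inc e = {v, a}" "v \<noteq> a" "a \<in> V" by (rule edge_ends[OF assms(1) E(1,2)])
  obtain b where b: "inc f = {v, b}" "v \<noteq> b" "b \<in> V" by (rule edge_ends[OF assms(1) E(3,4)])
  obtain d where d: "inc g = {v, d}" "v \<noteq> d" "d \<in> V" by (rule edge_ends[OF assms(1) E(5,6)])
  have "inc e \<noteq> inc f" "inc e \<noteq> inc g" "inc f \<noteq> inc g"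
    using no efg(2-4) E unfolding in_digon_def by blast+
  then have dist: "distinct [v, a, b, d]" using a b d by auto
  have va: "adj E inc v a" "adj E inc v b" "adj E inc v d" "adj E inc a v" "adj E inc b v" "adj E inc d v"
    using a b d E unfolding adj_def by (metis insert_commute)+
  then have "\<not> adj E inc a b" "\<not> adj E inc a d" "\<not> adj E inc b d"
    using no unfolding in_triangle_def by blast+
  then show False using assms(3,4) dist a(3) b(3) d(3) va unfolding claw_free_def by blast
qed

theorem theorem12:
  fixes V :: "'v set" and E :: "'e set" and inc :: "'e \<Rightarrow> 'v set"
  assumes "multigraph V E inc"
    and "cubic V E inc"
    and "bridgeless V E inc"
    and "claw_free V E inc"
    and "card V \<ge> 48"
  shows "real (nu 2 E inc) \<ge> (140 / 141) * ((real (card V) + 2 * real (nu 3 E inc)) / 4)"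
proof -
  \<comment> \<open>Each original vertex stands for itself; claw-freeness supplies the digon or
    triangle that weight one requires.\<close>
  have "reducible_weights V E inc (\<lambda>_. 1)"
    unfolding reducible_weights_def
    using assms(1,2) bridgeless_imp_cut_bridgeless[OF assms(1,3)] claw_free_cubic_vertex[OF assms(1,2,4)]
    by simp
  then have "weighted_bound V E inc (\<lambda>_. 1)" by (rule weighted_bound_holds)
  moreover have "3 * card V = 2 * card E"
  proof -
    have "3 * card V = (\<Sum>e\<in>E. card (inc e \<inter> V))"
      by (rule handshake[OF multigraphD(2,1)[OF assms(1)] cubicD[OF assms(2)]])
    also have "\<dots> = (\<Sum>e\<in>E. 2)"
      using multigraphD(3,4)[OF assms(1)] by (intro sum.cong) (auto simp: Int_absorb2)
    finally show ?thesis by simp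
  qed
  \<comment> \<open>With \<open>2 * card E = 3 * card V\<close> and total weight
    \<open>card V\<close>, the coefficient of \<open>card V\<close> is 141 - 1 - 105 = 35.\<close>
  ultimately have "35 * card V + 70 * nu 3 E inc \<le> 141 * nu 2 E inc"
    unfolding weighted_bound_def by simp
  then have "35 * real (card V) + 70 * real (nu 3 E inc) \<le> 141 * real (nu 2 E inc)" by linarith
  then show ?thesis by (simp add: field_simps)
qed

end
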